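(* For every integer $j \ge 57$ and every sufficiently large positive integer $n$ with $n > j-1$ and $n - j \notin \mathbf{B}^5$, the integer $n$ is the sum of exactly $j$ positive fifth powers.
   Context: For positive integers $j,k$, a positive integer $n$ is called $(j,k)$-representable if $n = x_1^k + \cdots + x_j^k$ with all $x_i$ positive integers. Let $\mathbf{B}_j^k$ denote the set of positive integers that are not $(j,k)$-representable, and put $S_j^k = \{ n - j : n \in \mathbf{B}_j^k,\ n > j\}$. Define $\mathbf{B}^k = \bigcap_{j \ge 1} S_j^k$ (the sets $S_j^k$ form a non-increasing chain in $j$, and $\mathbf{B}^k$ is their eventual common value). *)

theory Defs imports Main begin

definition representable :: "nat \<Rightarrow> nat \<Rightarrow> nat \<Rightarrow> bool" where
  "representable j k n \<longleftrightarrow>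
     (\<exists>x :: nat \<Rightarrow> nat. (\<forall>i\<in>{1..j}. x i > 0) \<and> n = (\<Sum>i=1..j. x i ^ k))"

definition nonrep :: "nat \<Rightarrow> nat \<Rightarrow> nat set" where
  "nonrep j k = {n. n > 0 \<and> \<not> representable j k n}"

(* The truncated subtraction on nat is exact here, since n > j. *)
definition shifted_nonrep :: "nat \<Rightarrow> nat \<Rightarrow> nat set" where
  "shifted_nonrep j k = {n - j | n. n \<in> nonrep j k \<and> n > j}"

(* The set written B^k; nonrep j k is B_j^k and shifted_nonrep j k is S_j^k. *)
definition stable_nonrep :: "nat \<Rightarrow> nat set" where
  "stable_nonrep k = (\<Inter>j\<in>{1..}. shifted_nonrep j k)"

end

theory Submission
  imports Defs
    "HOL-Analysis.Analysis"
    "HOL-Analysis.Kronecker_Approximation_Theorem"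
    "HOL-Computational_Algebra.Polynomial"
    "HOL-Real_Asymp.Real_Asymp"
begin

text \<open>
  If \<open>m = n - j\<close> lies outside the stable set, then \<open>m\<close> is a sum of numbers \<open>x ^ 5 - 1\<close>; for bounded \<open>m\<close>
  and large \<open>n\<close> the number of nonzero summands is at most \<open>m \<le> j\<close>, and one pads with ones. For large \<open>m\<close>
  the claim says that every large number is a sum of 57 positive fifth powers.

  This is proved by the circle method in the form of a discrete Fourier transform. Write the number as 37 fifth powers of
  numbers \<open>5 * Y * x + 1\<close> with \<open>P \<le> x < 2 * P\<close>, where \<open>Y = w!\<close>, plus two elements of a thick set of sums of 10 fifth
  powers lying in a prescribed residue class modulo \<open>25 * Y\<close> (diminishing ranges). On the minor arcs Weyl's
  inequality for the 37 variables beats the loss incurred by the thick sets, which are only treated by Parseval.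
  The choice of \<open>Y\<close> makes the complete exponential sums vanish for all moduli \<open>q > 1\<close> having a prime factor
  at most \<open>w\<close>. Hence the major arcs around fractions with denominator \<open>q > 1\<close> contribute at most a tail of the
  singular series, which is small if \<open>w\<close> is large, and no analysis of the singular series is needed.
\<close>


section \<open>Exponentials and geometric sums\<close>

text \<open>The split of 57 into 37, 10 and 10 rests on an exponent balance. With
  \<open>P = K ^ 3\<close> the 37th power of a minor arc sum saves a factor
  \<open>K powr (481/256)\<close>, about \<open>K ^ 1.88\<close>, while each thick set up to
  \<open>K ^ 15\<close> falls short of full size by at most about
  \<open>K powr (15 * (4/5) ^ 10)\<close>, roughly \<open>K ^ 1.61\<close>. Parseval controls the
  mean of a product of two factors, hence two thick sets. With 37 variables, Weyl's inequality alone
  also makes the singular series converge absolutely.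

  The delicate point is the order of choices: \<open>Y\<close> depends on the tolerance
  \<open>\<eta>\<close> for the tail of the singular series, so \<open>\<eta>\<close> must not
  depend on \<open>Y\<close>. This works because main term and tail both carry the factor
  \<open>K ^ 96 / Y ^ 4\<close>, and the constant in \<open>complete_sum_bound\<close> is uniform in
  \<open>Y\<close>. All other constants may depend on \<open>Y\<close>, as \<open>K\<close> is taken
  large last.

  The smooth model on the major arcs is not an integral but the polynomial
  \<open>density_poly\<close>: coefficients of its powers can be bounded below directly, and
  Parseval bounds its mean values.\<close>

definition unit_exp :: "real \<Rightarrow> complex" where
  "unit_exp x = cis (2 * pi * x)"

lemma unit_exp_add: "unit_exp (x + y) = unit_exp x * unit_exp y"
  by (simp add: unit_exp_def cis_mult ring_distribs)

lemma unit_exp_0 [simp]: "unit_exp 0 = 1"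
  by (simp add: unit_exp_def)

lemma unit_exp_minus: "unit_exp (- x) = cnj (unit_exp x)"
  by (simp add: unit_exp_def cis_cnj)

lemma unit_exp_diff: "unit_exp (x - y) = unit_exp x * cnj (unit_exp y)"
  using unit_exp_add[of x "-y"] by (simp add: unit_exp_minus)

lemma norm_unit_exp [simp]: "norm (unit_exp x) = 1"
  by (simp add: unit_exp_def)

lemma unit_exp_of_int [simp]: "unit_exp (of_int k) = 1"
  by (simp add: unit_exp_def)

lemma unit_exp_of_nat [simp]: "unit_exp (of_nat k) = 1"
  by (simp add: unit_exp_def)

lemma unit_exp_add_int: "unit_exp (x + of_int k) = unit_exp x"
  by (simp add: unit_exp_add)

lemma unit_exp_cong_int: "x - y \<in> \<int> \<Longrightarrow> unit_exp x = unit_exp y"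
  by (metis Ints_cases diff_add_cancel unit_exp_add_int add.commute)

lemma unit_exp_mult_nat: "unit_exp (of_nat k * x) = unit_exp x ^ k"
  by (induction k) (simp_all add: ring_distribs unit_exp_add)

lemma norm_unit_exp_diff: "norm (unit_exp x - unit_exp y) = 2 * \<bar>sin (pi * (x - y))\<bar>"
proof -
  have "unit_exp x - unit_exp y = unit_exp y * (unit_exp (x - y) - 1)"
    using unit_exp_add[of y "x - y"] by (simp add: algebra_simps)
  moreover have "norm (unit_exp (x - y) - 1) = 2 * \<bar>sin (pi * (x - y))\<bar>"
    using dist_exp_i_1[of "2 * pi * (x - y)"] by (simp add: unit_exp_def cis_conv_exp)
  ultimately show ?thesis
    by (simp add: norm_mult)
qed

lemma norm_unit_exp_diff_le: "norm (unit_exp x - unit_exp y) \<le> 2 * pi * \<bar>x - y\<bar>"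
  using abs_sin_x_le_abs_x[of "pi * (x - y)"] by (simp add: norm_unit_exp_diff abs_mult)

section \<open>Distance to the nearest integer, and bounds for geometric sums\<close>

definition dist_int :: "real \<Rightarrow> real" where
  "dist_int x = \<bar>x - of_int (round x)\<bar>"

lemma dist_int_nonneg [simp]: "dist_int x \<ge> 0"
  by (simp add: dist_int_def)

lemma dist_int_le_half: "dist_int x \<le> 1 / 2"
  using of_int_round_abs_le[of x] by (simp add: dist_int_def abs_minus_commute)

lemma dist_int_le: "dist_int x \<le> \<bar>x - of_int k\<bar>"
  using round_diff_minimal[of x k] by (simp add: dist_int_def)

lemma dist_int_minus: "dist_int (- x) = dist_int x"
proof -
  have "dist_int (- y) \<le> dist_int y" for y
    using dist_int_le[of "- y" "- round y"] by (simp add: dist_int_def)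
  from this[of x] this[of "- x"] show ?thesis by simp
qed

text \<open>A weak form of Jordan's inequality, obtained by halving the angle: for
  \<open>u = t / 2\<close> one has \<open>sin t = 2 * sin u * cos u\<close>, where
  \<open>sin u \<ge> u * cos u\<close> and \<open>cos u * cos u \<ge> 1 / 2\<close>.\<close>

lemma sin_ge_half: 
  assumes "0 \<le> t" "t \<le> pi / 2"
  shows "t / 2 \<le> sin t"
proof -
  define u where "u = t / 2"
  have u: "0 \<le> u" "u \<le> pi / 4" using assms by (auto simp: u_def)
  have "(\<lambda>u. sin u - u * cos u) 0 \<le> (\<lambda>u. sin u - u * cos u) u"
  proof (rule DERIV_nonneg_imp_nondecreasing[OF u(1)])
    fix x assume x: "0 \<le> x" "x \<le> u"
    have "((\<lambda>u. sin u - u * cos u) has_real_derivative (x * sin x)) (at x)"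
      by (auto intro!: derivative_eq_intros)
    moreover have "x * sin x \<ge> 0"
      using x u by (intro mult_nonneg_nonneg sin_ge_zero) auto
    ultimately show "\<exists>y. ((\<lambda>u. sin u - u * cos u) has_real_derivative y) (at x) \<and> 0 \<le> y"
      by blast
  qed
  then have 1: "u * cos u \<le> sin u" by simp
  have "cos (pi / 4) \<le> cos u"
    using u by (intro cos_monotone_0_pi_le) auto
  then have 2: "sqrt 2 / 2 \<le> cos u" by (simp add: cos_45)
  have c0: "cos u \<ge> 0" using 2 real_sqrt_ge_zero[of 2] by linarith
  have "(sqrt 2 / 2) * (sqrt 2 / 2) \<le> cos u * cos u"
    using 2 c0 by (intro mult_mono) auto
  then have 3: "1 / 2 \<le> cos u * cos u" by simp
  have "sin t = 2 * sin u * cos u" using sin_double[of u] by (simp add: u_def)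
  also have "\<dots> \<ge> 2 * (u * cos u) * cos u"
    using 1 c0 by (intro mult_right_mono mult_left_mono) auto
  finally have "sin t \<ge> 2 * u * (cos u * cos u)" by (simp add: mult_ac)
  moreover have "2 * u * (cos u * cos u) \<ge> 2 * u * (1/2)"
    using 3 u by (intro mult_left_mono) auto
  ultimately show ?thesis by (simp add: u_def)
qed

lemma norm_1_minus_unit_exp: "norm (1 - unit_exp x) \<ge> 2 * dist_int x"
proof -
  have "unit_exp x = unit_exp (x - of_int (round x))"
    by (rule unit_exp_cong_int) auto
  then have "norm (1 - unit_exp x) = 2 * \<bar>sin (pi * (x - of_int (round x)))\<bar>"
    using norm_unit_exp_diff[of "x - of_int (round x)" 0] by (simp add: norm_minus_commute)
  also have "\<bar>sin (pi * (x - of_int (round x)))\<bar> = \<bar>sin (pi * dist_int x)\<bar>"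
  proof (cases "x - of_int (round x) \<ge> 0")
    case False
    then have "pi * dist_int x = - (pi * (x - of_int (round x)))" by (simp add: dist_int_def algebra_simps)
    then show ?thesis by (simp only: sin_minus abs_minus_cancel)
  qed (simp add: dist_int_def)
  also have "2 * \<bar>sin (pi * dist_int x)\<bar> \<ge> 2 * (pi * dist_int x / 2)"
  proof -
    have "pi * dist_int x \<le> pi * (1/2)" using dist_int_le_half[of x] by (intro mult_left_mono) auto
    then have "pi * dist_int x / 2 \<le> sin (pi * dist_int x)"
      by (intro sin_ge_half) auto
    then show ?thesis by linarith
  qed
  also have "2 * (pi * dist_int x / 2) \<ge> 2 * dist_int x"
    using pi_gt3 by (simp add: mult_right_mono)
  finally show ?thesis by linarith
qed

text \<open>For \<open>P \<ge> 0\<close> this is the usual minimum of \<open>P\<close> and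
  \<open>1 / dist_int x\<close>. The case distinction is needed because \<open>1 / 0 = 0\<close>, so
  a literal minimum would vanish at integers.\<close>

definition geom_bound :: "real \<Rightarrow> real \<Rightarrow> real" where
  "geom_bound P x = (if P * dist_int x \<le> 1 then P else 1 / dist_int x)"

lemma geom_bound_minus: "geom_bound P (- x) = geom_bound P x"
  by (simp add: geom_bound_def dist_int_minus)

lemma geom_bound_abs: "geom_bound P (\<theta> * of_int \<bar>m\<bar>) = geom_bound P (\<theta> * of_int m)"
  by (cases "m \<ge> 0") (simp_all add: geom_bound_minus)

lemma geom_bound_nonneg: "P \<ge> 0 \<Longrightarrow> geom_bound P x \<ge> 0"
  by (simp add: geom_bound_def)

lemma geom_bound_le: 
  assumes "P \<ge> 0" 
  shows "geom_bound P x \<le> P"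
proof (cases "P * dist_int x \<le> 1")
  case False
  then have "dist_int x > 0"
    by (metis linorder_not_le mult_zero_right dist_int_nonneg order_le_less zero_le_one)
  then show ?thesis using False by (simp add: geom_bound_def field_simps)
qed (simp add: geom_bound_def)

lemma geom_bound_le_inverse: "P \<ge> 0 \<Longrightarrow> dist_int x > 0 \<Longrightarrow> geom_bound P x \<le> 1 / dist_int x"
  by (auto simp: geom_bound_def field_simps)

text \<open>The bound depends on an upper bound \<open>P\<close> for the length and not on the
  interval, because differencing produces subintervals of varying position and length.\<close>

lemma sum_unit_exp_linear:
  assumes "real l \<le> P"
  shows "norm (\<Sum>x\<in>{u..<u + int l}. unit_exp (\<theta> * of_int x + c)) \<le> geom_bound P \<theta>"
proof -
  let ?S = "\<Sum>x\<in>{u..<u + int l}. unit_exp (\<theta> * of_int x + c)"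
  have triv: "norm ?S \<le> real l"
    using norm_sum[of "\<lambda>x. unit_exp (\<theta> * of_int x + c)" "{u..<u + int l}"] by simp
  have S: "?S = (\<Sum>i<l. unit_exp (\<theta> * of_int u + c) * unit_exp \<theta> ^ i)"
  proof (rule sum.reindex_bij_witness[of _ "\<lambda>i. u + int i" "\<lambda>x. nat (x - u)"])
    fix x assume x: "x \<in> {u..<u + int l}"
    then have "x = u + int (nat (x - u))" by simp
    then have "\<theta> * of_int x + c = (\<theta> * of_int u + c) + of_nat (nat (x - u)) * \<theta>"
      by (metis (no_types, opaque_lifting) add.assoc add.commute distrib_left mult.commute of_int_add of_int_of_nat_eq)
    then show "unit_exp (\<theta> * of_int u + c) * unit_exp \<theta> ^ nat (x - u) = unit_exp (\<theta> * of_int x + c)"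
      by (simp only: unit_exp_add unit_exp_mult_nat)
  qed auto
  show ?thesis
  proof (cases "P * dist_int \<theta> \<le> 1")
    case True
    then show ?thesis using triv assms by (simp add: geom_bound_def)
  next
    case False
    have dist_int: "dist_int \<theta> > 0" using False by (metis linorder_not_le mult_zero_right dist_int_nonneg order_le_less zero_le_one)
    have ne: "unit_exp \<theta> \<noteq> 1"
      using norm_1_minus_unit_exp[of \<theta>] dist_int by auto
    have "?S = unit_exp (\<theta> * of_int u + c) * ((1 - unit_exp \<theta> ^ l) / (1 - unit_exp \<theta>))"
      using S sum_gp_strict[of "unit_exp \<theta>" l] ne by (simp add: sum_distrib_left[symmetric])
    then have "norm ?S = norm (1 - unit_exp \<theta> ^ l) / norm (1 - unit_exp \<theta>)"
      by (simp add: norm_mult norm_divide)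
    also have "\<dots> \<le> 2 / (2 * dist_int \<theta>)"
    proof (rule frac_le)
      show "norm (1 - unit_exp \<theta> ^ l) \<le> 2"
        using norm_triangle_ineq4[of 1 "unit_exp \<theta> ^ l"] by (simp add: norm_power)
    qed (use dist_int norm_1_minus_unit_exp[of \<theta>] in auto)
    finally show ?thesis using False by (simp add: geom_bound_def)
  qed
qed

lemma dist_int_ge_frac: "dist_int x \<ge> min (frac x) (1 - frac x)"
proof (cases "round x \<le> \<lfloor>x\<rfloor>")
  case True
  then have "real_of_int (round x) \<le> of_int \<lfloor>x\<rfloor>" by simp
  then show ?thesis by (auto simp: dist_int_def frac_def)
next
  case False
  then have "real_of_int (round x) \<ge> of_int (\<lfloor>x\<rfloor> + 1)" by (intro of_int_le_iff[THEN iffD2]) simp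
  then show ?thesis by (auto simp: dist_int_def frac_def)
qed

text \<open>The fraction \<open>b * d / q\<close> is not an integer, so it is at least
  \<open>1 / q\<close> away from all integers; replacing \<open>b / q\<close> by
  \<open>\<theta>\<close> moves it by at most \<open>1 / (2 * q)\<close>.\<close>

lemma dist_int_multiple_ge:
  fixes b :: int and q :: nat and d :: int
  assumes q: "q \<ge> 1" and ap: "\<bar>\<theta> - of_int b / of_nat q\<bar> \<le> 1 / (of_nat q)^2"
    and cop: "coprime b (int q)" and d: "d \<noteq> 0" "2 * \<bar>d\<bar> < int q"
  shows "dist_int (\<theta> * of_int d) \<ge> 1 / (2 * real q)"
proof -
  define r where "r = round (\<theta> * of_int d)"
  have "\<not> int q dvd b * d"
  proof
    assume "int q dvd b * d"
    then have "int q dvd d" using cop by (metis coprime_commute coprime_dvd_mult_right_iff)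
    then have "int q \<le> \<bar>d\<bar>" using d(1) by (meson dvd_imp_le_int zdvd_imp_le abs_ge_zero dvd_abs_iff zero_less_abs_iff)
    then show False using d by linarith
  qed
  then have "b * d - r * int q \<noteq> 0" by (metis diff_eq_diff_eq diff_self dvd_triv_right)
  then have "1 \<le> \<bar>b * d - r * int q\<bar>" by linarith
  then have "(1::real) \<le> \<bar>of_int (b * d - r * int q)\<bar>" by linarith
  then have "1 / real q \<le> \<bar>of_int (b * d - r * int q)\<bar> / real q"
    using q by (simp add: divide_right_mono)
  also have "\<dots> = \<bar>of_int b / real q * of_int d - of_int r\<bar>"
    using q by (simp add: field_simps abs_divide[symmetric])
  finally have 1: "1 / real q \<le> \<bar>of_int b / real q * of_int d - of_int r\<bar>" .
  have "\<bar>(\<theta> - of_int b / of_nat q) * of_int d\<bar> \<le> 1 / (of_nat q)^2 * \<bar>of_int d\<bar>"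
    unfolding abs_mult by (rule mult_right_mono[OF ap]) simp
  also have "\<dots> \<le> 1 / (of_nat q)^2 * (real q / 2)"
  proof (rule mult_left_mono)
    have "2 * real_of_int \<bar>d\<bar> \<le> real_of_int (int q)" using d(2) by linarith
    then show "\<bar>real_of_int d\<bar> \<le> real q / 2" by simp
  qed simp
  also have "\<dots> = 1 / (2 * real q)" using q by (simp add: power2_eq_square)
  finally have 2: "\<bar>(\<theta> - of_int b / of_nat q) * of_int d\<bar> \<le> 1 / (2 * real q)" .
  have "dist_int (\<theta> * of_int d) = \<bar>\<theta> * of_int d - of_int r\<bar>" by (simp add: dist_int_def r_def)
  also have "\<theta> * of_int d - of_int r = (\<theta> - of_int b / of_nat q) * of_int d + (of_int b / real q * of_int d - of_int r)"
    by (simp add: algebra_simps)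
  finally have "dist_int (\<theta> * of_int d) \<ge> 1 / real q - 1 / (2 * real q)" using 1 2 by linarith
  then show ?thesis using q by (simp add: field_simps)
qed

text \<open>Within a block of about \<open>q / 2\<close> consecutive \<open>m\<close> the fractional
  parts of \<open>\<theta> * m\<close> are separated by \<open>1 / (2 * q)\<close>. They therefore
  fall into different cells of that length, and the distances to the nearest integer grow like an
  arithmetic progression, which yields a harmonic sum.\<close>

lemma geom_bound_sum_block:
  fixes b :: int and q :: nat and m0 l :: nat
  assumes q: "q \<ge> 1" and ap: "\<bar>\<theta> - of_int b / of_nat q\<bar> \<le> 1 / (of_nat q)^2"
    and cop: "coprime b (int q)" and l: "2 * l \<le> q + 1" and P: "P \<ge> 0"
  shows "(\<Sum>m\<in>{m0..<m0 + l}. geom_bound P (\<theta> * of_nat m)) \<le> 2 * P + 4 * real q * harm (2 * q)"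
proof -
  \<comment> \<open>The index of the cell of length \<open>1 / (2 * q)\<close> containing the
    fractional part.\<close>
  define k where "k m = nat \<lfloor>2 * real q * frac (\<theta> * of_nat m)\<rfloor>" for m :: nat
  have kint: "int (k m) = \<lfloor>2 * real q * frac (\<theta> * of_nat m)\<rfloor>" for m
    by (simp add: k_def)
  have kle: "real (k m) \<le> 2 * real q * frac (\<theta> * of_nat m)" 
    and kgt: "2 * real q * frac (\<theta> * of_nat m) < real (k m) + 1" for m
    using kint[of m] by linarith+
  have klt: "k m < 2 * q" for m
  proof -
    have "2 * real q * frac (\<theta> * of_nat m) < 2 * real q * 1"
      using q frac_lt_1[of "\<theta> * of_nat m"] by (intro mult_strict_left_mono) auto
    then show ?thesis using kle[of m] by linarith
  qed
  have inj: "inj_on k {m0..<m0 + l}"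
  proof (rule inj_onI, rule ccontr)
    fix m m' assume m: "m \<in> {m0..<m0 + l}" "m' \<in> {m0..<m0 + l}" "k m = k m'" "m \<noteq> m'"
    define d where "d = int m - int m'"
    have "\<bar>d\<bar> \<le> int l - 1" using m(1,2) unfolding d_def atLeastLessThan_iff by linarith
    then have d: "d \<noteq> 0" "2 * \<bar>d\<bar> < int q" using m(4) l by (auto simp: d_def)
    have "\<bar>2 * real q * frac (\<theta> * of_nat m) - 2 * real q * frac (\<theta> * of_nat m')\<bar> < 1"
      using kle[of m] kgt[of m] kle[of m'] kgt[of m'] m(3) by linarith
    then have "2 * real q * \<bar>frac (\<theta> * of_nat m) - frac (\<theta> * of_nat m')\<bar> < 1"
      by (simp add: abs_mult right_diff_distrib[symmetric])
    then have 1: "\<bar>frac (\<theta> * of_nat m) - frac (\<theta> * of_nat m')\<bar> < 1 / (2 * real q)"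
      using q by (simp add: field_simps)
    have "frac (\<theta> * of_nat m) - frac (\<theta> * of_nat m') = \<theta> * of_int d - of_int (\<lfloor>\<theta> * of_nat m\<rfloor> - \<lfloor>\<theta> * of_nat m'\<rfloor>)"
      by (simp add: frac_def d_def algebra_simps)
    then have "dist_int (\<theta> * of_int d) < 1 / (2 * real q)"
      using 1 dist_int_le[of "\<theta> * of_int d" "\<lfloor>\<theta> * of_nat m\<rfloor> - \<lfloor>\<theta> * of_nat m'\<rfloor>"] by linarith
    then show False using dist_int_multiple_ge[OF q ap cop d] by linarith
  qed
  \<comment> \<open>\<open>h i\<close> bounds a term whose cell is \<open>i\<close> cells away from
    an integer; the trivial bound is used next to the integer. The nearest integer may lie on either
    side of the cell, hence the two arguments \<open>k m\<close> and \<open>2 * q - 1 - k m\<close>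
    below.\<close>
  define h where "h i = (if i = 0 then P else 2 * real q / real i)" for i :: nat
  have h0: "h i \<ge> 0" for i using P by (simp add: h_def)
  have bound: "geom_bound P (\<theta> * of_nat m) \<le> h (k m) + h (2 * q - 1 - k m)" for m
  proof (cases "k m = 0 \<or> 2 * q - 1 - k m = 0")
    case True
    then have "h (k m) = P \<or> h (2 * q - 1 - k m) = P" by (auto simp: h_def)
    then show ?thesis using geom_bound_le[OF P, of "\<theta> * of_nat m"] h0[of "k m"] h0[of "2*q-1-k m"]
      by linarith
  next
    case False
    have n1: "frac (\<theta> * of_nat m) \<ge> real (k m) / (2 * real q)"
      using kle[of m] q by (simp add: field_simps)
    have n2: "1 - frac (\<theta> * of_nat m) \<ge> real (2 * q - 1 - k m) / (2 * real q)"
      using kgt[of m] q klt[of m] by (simp add: field_simps of_nat_diff)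
    consider "dist_int (\<theta> * of_nat m) \<ge> real (k m) / (2 * real q)" | "dist_int (\<theta> * of_nat m) \<ge> real (2 * q - 1 - k m) / (2 * real q)"
      using dist_int_ge_frac[of "\<theta> * of_nat m"] n1 n2 by linarith
    then show ?thesis
    proof cases
      case 1
      have "real (k m) / (2 * real q) > 0" using False q by simp
      then have "geom_bound P (\<theta> * of_nat m) \<le> 1 / (real (k m) / (2 * real q))"
        using geom_bound_le_inverse[OF P, of "\<theta> * of_nat m"] 1 by (smt (verit) frac_le)
      also have "\<dots> = h (k m)" using False by (simp add: h_def)
      finally show ?thesis using h0[of "2*q-1-k m"] by linarith
    next
      case 2
      have "real (2*q-1-k m) / (2 * real q) > 0" using False q by simp
      then have "geom_bound P (\<theta> * of_nat m) \<le> 1 / (real (2*q-1-k m) / (2 * real q))"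
        using geom_bound_le_inverse[OF P, of "\<theta> * of_nat m"] 2 by (smt (verit) frac_le)
      also have "\<dots> = h (2*q-1-k m)" using False by (simp add: h_def)
      finally show ?thesis using h0[of "k m"] by linarith
    qed
  qed
  have "(\<Sum>m\<in>{m0..<m0 + l}. geom_bound P (\<theta> * of_nat m)) \<le> (\<Sum>m\<in>{m0..<m0 + l}. h (k m) + h (2 * q - 1 - k m))"
    by (intro sum_mono bound)
  also have "\<dots> = (\<Sum>i\<in>k ` {m0..<m0 + l}. h i + h (2 * q - 1 - i))"
    using inj by (simp add: sum.reindex)
  also have "\<dots> \<le> (\<Sum>i\<in>{..<2*q}. h i + h (2 * q - 1 - i))"
    using klt h0 by (intro sum_mono2) (auto intro: add_nonneg_nonneg)
  also have "\<dots> = 2 * (\<Sum>i<2*q. h i)"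
    using sum.nat_diff_reindex[of h "2 * q"] by (simp add: sum.distrib)
  also have "(\<Sum>i<2*q. h i) \<le> P + 2 * real q * harm (2 * q)"
  proof -
    have "(\<Sum>i<2*q. h i) \<le> (\<Sum>i\<in>insert 0 {1..2*q}. h i)"
      using h0 by (intro sum_mono2) auto
    also have "\<dots> = P + (\<Sum>i\<in>{1..2*q}. 2 * real q * inverse (real i))"
      by (simp add: h_def field_simps)
    also have "\<dots> = P + 2 * real q * harm (2 * q)"
      by (simp add: harm_def sum_distrib_left)
    finally show ?thesis .
  qed
  finally show ?thesis by simp
qed

lemma geom_bound_sum:
  fixes b :: int and q M :: nat
  assumes q: "q \<ge> 1" and ap: "\<bar>\<theta> - of_int b / of_nat q\<bar> \<le> 1 / (of_nat q)^2"
    and cop: "coprime b (int q)" and P: "P \<ge> 0"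
  shows "(\<Sum>m\<in>{1..M}. geom_bound P (\<theta> * of_nat m)) \<le> (2 * real M / real q + 1) * (2 * P + 4 * real q * harm (2 * q))"
proof -
  define l where "l = (q + 1) div 2"
  have l: "2 * l \<le> q + 1" "q \<le> 2 * l" using q by (auto simp: l_def)
  then have l0: "l > 0" using q by auto
  let ?B = "2 * P + 4 * real q * harm (2 * q)"
  have B0: "?B \<ge> 0" using P by (simp add: harm_nonneg)
  have "(\<Sum>m\<in>{1..M}. geom_bound P (\<theta> * of_nat m)) \<le> (\<Sum>m<(M div l + 1) * l. geom_bound P (\<theta> * of_nat m))"
  proof (intro sum_mono2)
    show "{1..M} \<subseteq> {..<(M div l + 1) * l}"
      using dividend_less_div_times[OF l0, of M] by auto
  qed (auto simp: geom_bound_nonneg P)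
  also have "\<dots> = (\<Sum>i<M div l + 1. \<Sum>m\<in>{i * l..<i * l + l}. geom_bound P (\<theta> * of_nat m))"
    by (rule sum.nat_group[symmetric])
  also have "\<dots> \<le> (\<Sum>i<M div l + 1. ?B)"
    by (intro sum_mono geom_bound_sum_block[OF q ap cop l(1) P])
  also have "\<dots> = real (M div l + 1) * ?B" by simp
  also have "\<dots> \<le> (2 * real M / real q + 1) * ?B"
  proof (rule mult_right_mono[OF _ B0])
    have "real (M div l) \<le> real M / real l" by (rule of_nat_div_le_of_nat)
    also have "\<dots> \<le> real M / (real q / 2)" using l q by (intro divide_left_mono) auto
    finally show "real (M div l + 1) \<le> 2 * real M / real q + 1" by (simp add: mult.commute)
  qed
  finally show ?thesis .
qed

section \<open>The divisor bound\<close>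

lemma card_divisors_prime_power_mult_le:
  fixes p m e :: nat
  assumes "prime p" "m > 0"
  shows "card {d. d dvd p ^ e * m} \<le> (e + 1) * card {d. d dvd m}"
proof -
  have "{d. d dvd p ^ e * m} \<subseteq> (\<lambda>(i, d). p ^ i * d) ` ({..e} \<times> {d. d dvd m})"
  proof
    fix d assume "d \<in> {d. d dvd p ^ e * m}"
    then obtain a b where ab: "d = a * b" "a dvd p ^ e" "b dvd m"
      using division_decomp[of d "p ^ e" m] by blast
    then obtain i where "i \<le> e" "a = p ^ i"
      using divides_primepow_nat[OF assms(1)] by blast
    then show "d \<in> (\<lambda>(i, d). p ^ i * d) ` ({..e} \<times> {d. d dvd m})"
      using ab by (intro image_eqI[of _ _ "(i, b)"]) auto
  qed
  moreover have fin: "finite ({..e} \<times> {d. d dvd m})"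
    using assms(2) by (intro finite_cartesian_product finite_divisors_nat) auto
  ultimately have "card {d. d dvd p ^ e * m} \<le> card ((\<lambda>(i, d). p ^ i * d) ` ({..e} \<times> {d. d dvd m}))"
    by (intro card_mono) auto
  also have "\<dots> \<le> card ({..e} \<times> {d. d dvd m})"
    by (rule card_image_le[OF fin])
  finally show ?thesis by (simp add: card_cartesian_product)
qed

text \<open>Prime powers are split off one at a time, \<open>p ^ e\<close> costing a factor
  \<open>e + 1\<close>. For \<open>p > B\<close>, that is beyond
  \<open>2 powr (1 / \<epsilon>)\<close>, this is at most
  \<open>2 ^ e \<le> (p ^ e) powr \<epsilon>\<close>, so nothing is lost; for smaller
  \<open>p\<close> a constant factor \<open>K\<close> is lost.\<close>

lemma divisor_bound:
  fixes \<epsilon> :: real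
  assumes eps: "\<epsilon> > 0"
  shows "\<exists>C>0. \<forall>n\<ge>1. real (card {d. d dvd n}) \<le> C * real n powr \<epsilon>"
proof -
  define B where "B = nat \<lceil>2 powr (1 / \<epsilon>)\<rceil>"
  define K where "K = max 1 (1 / (\<epsilon> * ln 2))"
  have K1: "K \<ge> 1" and K2: "K * (\<epsilon> * ln 2) \<ge> 1"
    using eps by (auto simp: K_def max_def field_simps)
  have small: "real e + 1 \<le> K * real (p ^ e) powr \<epsilon>" if "p \<ge> 2" for p e :: nat
  proof -
    have "(2 ^ e :: real) powr \<epsilon> = exp (\<epsilon> * (real e * ln 2))"
      by (simp add: powr_def ln_realpow)
    also have "\<dots> \<ge> 1 + \<epsilon> * (real e * ln 2)" by simp
    finally have 1: "(2 ^ e :: real) powr \<epsilon> \<ge> 1 + \<epsilon> * (real e * ln 2)" .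
    have "real (2 ^ e) \<le> real (p ^ e)" using that by (intro of_nat_mono power_mono) auto
    then have "(2 ^ e :: real) powr \<epsilon> \<le> real (p ^ e) powr \<epsilon>"
      using eps by (intro powr_mono2) auto
    then have "K * real (p ^ e) powr \<epsilon> \<ge> K * (1 + \<epsilon> * (real e * ln 2))"
      using 1 K1 by (intro mult_left_mono) auto
    moreover have "K * (1 + \<epsilon> * (real e * ln 2)) = K + real e * (K * (\<epsilon> * ln 2))"
      by (simp add: algebra_simps)
    moreover have "real e * (K * (\<epsilon> * ln 2)) \<ge> real e * 1"
      using K2 by (intro mult_left_mono) auto
    ultimately show ?thesis using K1 by linarith
  qed
  have large: "real e + 1 \<le> real (p ^ e) powr \<epsilon>" if "p > B" for p e :: nat
  proof -
    have "2 powr (1 / \<epsilon>) \<le> real p" using that unfolding B_def by linarith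
    then have "(2 powr (1 / \<epsilon>)) powr \<epsilon> \<le> real p powr \<epsilon>"
      using eps by (intro powr_mono2) auto
    then have 2: "2 \<le> real p powr \<epsilon>" using eps by (simp add: powr_powr)
    have "real e + 1 \<le> 2 ^ e" by (induction e) auto
    also have "\<dots> \<le> (real p powr \<epsilon>) ^ e" using 2 by (intro power_mono) auto
    also have "\<dots> = real (p ^ e) powr \<epsilon>"
      using that by (simp add: powr_powr mult.commute flip: powr_realpow)
    finally show ?thesis .
  qed
  \<comment> \<open>Only primes up to \<open>B\<close> cost a factor \<open>K\<close>, and their
    number is bounded independently of \<open>n\<close>.\<close>
  define s where "s n = card {p. prime p \<and> p \<le> B \<and> p dvd n}" for n :: nat
  have main: "real (card {d. d dvd n}) \<le> K ^ s n * real n powr \<epsilon>" if "n \<ge> 1" for n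
    using that
  proof (induction n rule: less_induct)
    case (less n)
    show ?case
    proof (cases "n = 1")
      case True
      then show ?thesis using K1 by (simp add: one_le_power)
    next
      case False
      then obtain p where p: "prime p" "p dvd n" using prime_factor_nat by blast
      then have p2: "p \<ge> 2" using prime_ge_2_nat by auto
      define e where "e = multiplicity p n"
      obtain m where m: "n = p ^ e * m" "\<not> p dvd m"
        using multiplicity_decompose'[of n p] p less.prems not_prime_unit unfolding e_def
        by (metis One_nat_def not_one_le_zero)
      have e: "e \<ge> 1" using p less.prems unfolding e_def
        by (metis One_nat_def Suc_leI multiplicity_eq_zero_iff neq0_conv not_one_le_zero not_prime_unit)
      have m0: "m \<ge> 1" using m less.prems by (cases m) auto
      have "m < n" using m e p2 m0
        by (metis One_nat_def less_le_trans mult.commute mult.right_neutral mult_less_cancel1 one_less_power Suc_le_lessD numeral_2_eq_2 lessI)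
      then have IH: "real (card {d. d dvd m}) \<le> K ^ s m * real m powr \<epsilon>"
        using less.IH m0 by blast
      have fin: "finite {p. prime p \<and> p \<le> B \<and> p dvd n}" for n by (rule finite_subset[of _ "{..B}"]) auto
      have "real (card {d. d dvd n}) \<le> (real e + 1) * real (card {d. d dvd m})"
      proof -
        have "card {d. d dvd n} \<le> (e + 1) * card {d. d dvd m}"
          using card_divisors_prime_power_mult_le[OF p(1), of m e] m0 m(1) by simp
        then have "real (card {d. d dvd n}) \<le> real ((e + 1) * card {d. d dvd m})"
          by (rule of_nat_mono)
        then show ?thesis by (simp add: algebra_simps)
      qed
      also have "\<dots> \<le> (real e + 1) * (K ^ s m * real m powr \<epsilon>)"
        using IH by (intro mult_left_mono) auto
      also have "\<dots> \<le> K ^ s n * real n powr \<epsilon>"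
      proof (cases "p > B")
        case True
        have "s m \<le> s n" unfolding s_def using m by (intro card_mono fin) auto
        then have "K ^ s m \<le> K ^ s n" using K1 by (intro power_increasing) auto
        have "(real e + 1) * (K ^ s m * real m powr \<epsilon>) \<le> real (p ^ e) powr \<epsilon> * (K ^ s n * real m powr \<epsilon>)"
          using large[OF True, of e] K1 \<open>K ^ s m \<le> K ^ s n\<close> by (intro mult_mono mult_right_mono) auto
        then show ?thesis by (simp add: m powr_mult mult_ac)
      next
        case False
        have "insert p {p. prime p \<and> p \<le> B \<and> p dvd m} \<subseteq> {p. prime p \<and> p \<le> B \<and> p dvd n}"
          using False p m by auto
        then have "card (insert p {p. prime p \<and> p \<le> B \<and> p dvd m}) \<le> s n"
          unfolding s_def by (intro card_mono fin)
        then have "Suc (s m) \<le> s n" using m fin unfolding s_def by simp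
        then have "K ^ Suc (s m) \<le> K ^ s n" using K1 by (intro power_increasing) auto
        have "(real e + 1) * (K ^ s m * real m powr \<epsilon>) \<le> (K * real (p ^ e) powr \<epsilon>) * (K ^ s m * real m powr \<epsilon>)"
          using small[OF p2, of e] K1 by (intro mult_right_mono) auto
        also have "\<dots> = K ^ Suc (s m) * (real (p ^ e) powr \<epsilon> * real m powr \<epsilon>)" by simp
        also have "\<dots> \<le> K ^ s n * (real (p ^ e) powr \<epsilon> * real m powr \<epsilon>)"
          using \<open>K ^ Suc (s m) \<le> K ^ s n\<close> by (intro mult_right_mono) auto
        finally show ?thesis by (simp add: m powr_mult mult_ac)
      qed
      finally show ?thesis .
    qed
  qed
  have "real (card {d. d dvd n}) \<le> K ^ (Suc B) * real n powr \<epsilon>" if "n \<ge> 1" for n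
  proof -
    have "s n \<le> card {..B}" unfolding s_def by (intro card_mono) auto
    then have "K ^ s n \<le> K ^ Suc B" using K1 by (intro power_increasing) auto
    then have "K ^ s n * real n powr \<epsilon> \<le> K ^ Suc B * real n powr \<epsilon>" by (intro mult_right_mono) auto
    then show ?thesis using main[OF that] by linarith
  qed
  moreover have "K ^ Suc B > 0" using K1 by simp
  ultimately show ?thesis by blast
qed

section \<open>Weyl differencing\<close>

definition shift_diff :: "int \<Rightarrow> (int \<Rightarrow> real) \<Rightarrow> int \<Rightarrow> real" where
  "shift_diff h \<phi> x = \<phi> (x + h) - \<phi> x"

text \<open>Encodes that differencing by any \<open>k\<close> shifts in turn leaves a linear phase
  whose slope is \<open>\<theta>\<close> times the product of the shifts. Only this slope enters the
  estimates, so the lower coefficients of the phase are never tracked.\<close>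

fun iter_lin :: "nat \<Rightarrow> real \<Rightarrow> (int \<Rightarrow> real) \<Rightarrow> bool" where
  "iter_lin 0 \<theta> \<phi> \<longleftrightarrow> (\<exists>c. \<forall>x. \<phi> x = \<theta> * of_int x + c)"
| "iter_lin (Suc k) \<theta> \<phi> \<longleftrightarrow> (\<forall>h. iter_lin k (\<theta> * of_int h) (shift_diff h \<phi>))"

text \<open>Expanding the square and sorting the pairs by their difference \<open>h\<close> leaves,
  for each \<open>h\<close>, a sum over an interval of length at most \<open>P\<close>. This is why
  the hypothesis on \<open>B\<close> quantifies over all such intervals.\<close>

lemma weyl_difference:
  assumes B: "\<And>h u l. \<bar>h\<bar> < int P \<Longrightarrow> l \<le> P \<Longrightarrow> norm (\<Sum>x\<in>{u..<u + int l}. unit_exp (shift_diff h \<phi> x)) \<le> B h"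
    and l: "l \<le> P"
  shows "norm (\<Sum>x\<in>{u..<u + int l}. unit_exp (\<phi> x)) ^ 2 \<le> (\<Sum>h\<in>{- int P<..<int P}. B h)"
proof -
  define I where "I = {u..<u + int l}"
  define H where "H = {- int P<..<int P}"
  let ?S = "\<Sum>x\<in>I. unit_exp (\<phi> x)"
  have "complex_of_real (norm ?S ^ 2) = cnj ?S * ?S"
    using complex_norm_square[of ?S] by (simp only: mult.commute)
  also have "\<dots> = (\<Sum>x\<in>I. \<Sum>y\<in>I. cnj (unit_exp (\<phi> x)) * unit_exp (\<phi> y))"
    by (simp add: sum_product)
  also have "\<dots> = (\<Sum>(x, y)\<in>I \<times> I. unit_exp (\<phi> y - \<phi> x))"
    by (simp add: sum.cartesian_product unit_exp_diff mult.commute)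
  also have "\<dots> = (\<Sum>(h, x)\<in>Sigma H (\<lambda>h. {x\<in>I. x + h \<in> I}). unit_exp (shift_diff h \<phi> x))"
    by (rule sum.reindex_bij_witness[of _ "\<lambda>(h, x). (x, x + h)" "\<lambda>(x, y). (y - x, x)"])
       (use l in \<open>auto simp: shift_diff_def I_def H_def\<close>)
  also have "\<dots> = (\<Sum>h\<in>H. \<Sum>x\<in>{x\<in>I. x + h \<in> I}. unit_exp (shift_diff h \<phi> x))"
    by (subst sum.Sigma) (auto simp: H_def I_def intro: finite_subset[of _ "{u..<u + int l}"])
  finally have "norm ?S ^ 2 = norm (\<Sum>h\<in>H. \<Sum>x\<in>{x\<in>I. x + h \<in> I}. unit_exp (shift_diff h \<phi> x))"
    by (metis norm_of_real abs_of_nonneg zero_le_power2)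
  also have "\<dots> \<le> (\<Sum>h\<in>H. norm (\<Sum>x\<in>{x\<in>I. x + h \<in> I}. unit_exp (shift_diff h \<phi> x)))"
    by (rule norm_sum)
  also have "\<dots> \<le> (\<Sum>h\<in>H. B h)"
  proof (rule sum_mono)
    fix h assume h: "h \<in> H"
    define u' where "u' = max u (u - h)"
    define l' where "l' = nat (min (u + int l) (u + int l - h) - u')"
    have "{x\<in>I. x + h \<in> I} = {u'..<u' + int l'}"
      by (auto simp: I_def u'_def l'_def)
    moreover have "l' \<le> P" using l by (auto simp: l'_def u'_def)
    ultimately show "norm (\<Sum>x\<in>{x\<in>I. x + h \<in> I}. unit_exp (shift_diff h \<phi> x)) \<le> B h"
      using B[of h l' u'] h by (auto simp: H_def)
  qed
  finally show ?thesis by (simp add: I_def H_def)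
qed

text \<open>The power mean inequality for exponents \<open>2 ^ k\<close>, by iterating the
  Cauchy-Schwarz inequality.\<close>

lemma sum_power_le:
  fixes b :: "'a \<Rightarrow> real"
  assumes "\<And>i. i \<in> H \<Longrightarrow> b i \<ge> 0"
  shows "(\<Sum>i\<in>H. b i) ^ (2 ^ k) \<le> real (card H) ^ (2 ^ k - 1) * (\<Sum>i\<in>H. b i ^ (2 ^ k))"
  using assms
proof (induction k arbitrary: b)
  case (Suc k)
  have "(\<Sum>i\<in>H. b i) ^ (2 ^ Suc k) = ((\<Sum>i\<in>H. b i) ^ 2) ^ (2 ^ k)"
    by (simp add: power_mult)
  also have "\<dots> \<le> (real (card H) * (\<Sum>i\<in>H. (b i)^2)) ^ (2 ^ k)"
    using sum_squared_le_sum_of_squares[of b H]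
    by (intro power_mono) (simp_all add: mult.commute)
  also have "\<dots> = real (card H) ^ (2 ^ k) * (\<Sum>i\<in>H. (b i)^2) ^ (2 ^ k)"
    by (simp add: power_mult_distrib)
  also have "\<dots> \<le> real (card H) ^ (2 ^ k) * (real (card H) ^ (2 ^ k - 1) * (\<Sum>i\<in>H. ((b i)^2) ^ (2 ^ k)))"
    by (intro mult_left_mono Suc.IH) auto
  also have "\<dots> = real (card H) ^ (2 ^ k + (2 ^ k - 1)) * (\<Sum>i\<in>H. b i ^ (2 ^ Suc k))"
    by (simp only: power_add mult.assoc power_Suc power_mult)
  also have "2 ^ k + (2 ^ k - 1) = (2 ^ Suc k - 1 :: nat)" by simp
  finally show ?case .
qed simp

fun geom_bound_iter :: "nat \<Rightarrow> nat \<Rightarrow> real \<Rightarrow> real" where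
  "geom_bound_iter P 0 \<theta> = geom_bound P \<theta>"
| "geom_bound_iter P (Suc k) \<theta> = (\<Sum>h\<in>{- int P<..<int P}. geom_bound_iter P k (\<theta> * of_int h))"

text \<open>The exponent of \<open>2 * P\<close> in the iterated bound: in step \<open>Suc k\<close>
  a sum over fewer than \<open>2 * P\<close> shifts is raised to the power \<open>2 ^ k\<close>,
  which by \<open>sum_power_le\<close> costs \<open>2 ^ k - 1\<close> such factors.\<close>

fun weyl_exp :: "nat \<Rightarrow> nat" where
  "weyl_exp 0 = 0"
| "weyl_exp (Suc k) = (2 ^ k - 1) + weyl_exp k"

lemma geom_bound_iter_nonneg: "geom_bound_iter P k \<theta> \<ge> 0"
  by (induction k arbitrary: \<theta>) (auto simp: geom_bound_nonneg intro: sum_nonneg)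

lemma le_root: "a \<ge> 0 \<Longrightarrow> n > 0 \<Longrightarrow> a ^ n \<le> y \<Longrightarrow> a \<le> root n y"
  by (metis real_root_le_mono real_root_power_cancel)

lemma weyl_iterated:
  assumes "iter_lin k \<theta> \<phi>" "l \<le> P"
  shows "norm (\<Sum>x\<in>{u..<u + int l}. unit_exp (\<phi> x)) ^ (2 ^ k) \<le> (2 * real P) ^ weyl_exp k * geom_bound_iter P k \<theta>"
  using assms
proof (induction k arbitrary: \<theta> \<phi> u l)
  case 0
  then obtain c where c: "\<And>x. \<phi> x = \<theta> * of_int x + c" by auto
  then show ?case using sum_unit_exp_linear[of l "real P" \<theta> c u] 0 by (simp add: c)
next
  case (Suc k)
  define H where "H = {- int P<..<int P}"
  \<comment> \<open>The induction hypothesis bounds a \<open>2 ^ k\<close>-th power, whereas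
    \<open>weyl_difference\<close> wants a bound for the norm itself; hence the root.\<close>
  define B where "B h = root (2 ^ k) ((2 * real P) ^ weyl_exp k * geom_bound_iter P k (\<theta> * of_int h))" for h
  have nn: "(2 * real P) ^ weyl_exp k * geom_bound_iter P k (\<theta> * of_int h) \<ge> 0" for h
    by (intro mult_nonneg_nonneg geom_bound_iter_nonneg) auto
  have B0: "B h \<ge> 0" for h using nn by (simp add: B_def)
  have "norm (\<Sum>x\<in>{u..<u + int l}. unit_exp (\<phi> x)) ^ 2 \<le> (\<Sum>h\<in>H. B h)"
    unfolding H_def
  proof (rule weyl_difference[OF _ Suc.prems(2)])
    fix h u l assume l: "l \<le> P"
    have "iter_lin k (\<theta> * of_int h) (shift_diff h \<phi>)" using Suc.prems(1) by simp
    from Suc.IH[OF this l, of u] show "norm (\<Sum>x\<in>{u..<u + int l}. unit_exp (shift_diff h \<phi> x)) \<le> B h"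
      unfolding B_def by (intro le_root) auto
  qed
  then have "(norm (\<Sum>x\<in>{u..<u + int l}. unit_exp (\<phi> x)) ^ 2) ^ (2 ^ k) \<le> (\<Sum>h\<in>H. B h) ^ (2 ^ k)"
    by (intro power_mono) auto
  also have "\<dots> \<le> real (card H) ^ (2 ^ k - 1) * (\<Sum>h\<in>H. B h ^ (2 ^ k))"
    by (rule sum_power_le) (rule B0)
  also have "(\<Sum>h\<in>H. B h ^ (2 ^ k)) = (\<Sum>h\<in>H. (2 * real P) ^ weyl_exp k * geom_bound_iter P k (\<theta> * of_int h))"
    using nn by (simp add: B_def)
  also have "\<dots> = (2 * real P) ^ weyl_exp k * geom_bound_iter P (Suc k) \<theta>"
    by (simp add: H_def sum_distrib_left)
  also have "real (card H) ^ (2 ^ k - 1) * ((2 * real P) ^ weyl_exp k * geom_bound_iter P (Suc k) \<theta>)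
     \<le> (2 * real P) ^ (2 ^ k - 1) * ((2 * real P) ^ weyl_exp k * geom_bound_iter P (Suc k) \<theta>)"
  proof (intro mult_right_mono power_mono)
    show "real (card H) \<le> 2 * real P" by (simp add: H_def)
  qed (auto intro!: mult_nonneg_nonneg geom_bound_iter_nonneg simp del: geom_bound_iter.simps)
  also have "\<dots> = (2 * real P) ^ weyl_exp (Suc k) * geom_bound_iter P (Suc k) \<theta>"
    unfolding weyl_exp.simps power_add by (simp only: mult.assoc)
  finally show ?case by (simp add: power_mult del: geom_bound_iter.simps)
qed

lemma weyl_four:
  assumes "iter_lin 4 \<theta> \<phi>" "l \<le> P"
  shows "norm (\<Sum>x\<in>{u..<u + int l}. unit_exp (\<phi> x)) ^ 16 \<le> (2 * real P) ^ 11 * geom_bound_iter P 4 \<theta>"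
proof -
  have "weyl_exp 4 = 11" by (simp add: numeral_eq_Suc)
  then show ?thesis using weyl_iterated[OF assms, of u] by simp
qed

text \<open>Differencing a polynomial of degree \<open>d\<close> by \<open>h\<close> multiplies its
  leading coefficient by \<open>d * h\<close>; from degree 5 down to degree 1 this gives
  \<open>5 * 4 * 3 * 2 = 120\<close>.\<close>

lemma iter_lin_degree_5:
  assumes \<phi>: "\<And>x. \<phi> x = a5 * of_int x ^ 5 + a4 * of_int x ^ 4 + a3 * of_int x ^ 3 + a2 * of_int x ^ 2 + a1 * of_int x + a0"
    and \<theta>: "\<theta> = 120 * a5"
  shows "iter_lin 4 \<theta> \<phi>"
proof -
  have s1: "iter_lin (Suc 0) (2 * c2) \<phi>" if "\<And>x. \<phi> x = c2 * of_int x ^ 2 + c1 * of_int x + c0" for \<phi> c2 c1 c0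
    unfolding iter_lin.simps
  proof (intro allI exI)
    fix h x show "shift_diff h \<phi> x = 2 * c2 * of_int h * of_int x + (c2 * of_int h ^ 2 + c1 * of_int h)"
      by (simp add: shift_diff_def that power2_eq_square algebra_simps)
  qed
  have s2: "iter_lin (Suc (Suc 0)) (6 * c3) \<phi>" if "\<And>x. \<phi> x = c3 * of_int x ^ 3 + c2 * of_int x ^ 2 + c1 * of_int x + c0" for \<phi> c3 c2 c1 c0
  proof (subst iter_lin.simps, intro allI)
    fix h
    have "shift_diff h \<phi> x = (3 * c3 * of_int h) * of_int x ^ 2 + (3 * c3 * of_int h ^ 2 + 2 * c2 * of_int h) * of_int x 
       + (c3 * of_int h ^ 3 + c2 * of_int h ^ 2 + c1 * of_int h)" for x
      unfolding shift_diff_def that of_int_add by algebra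
    from s1[OF this] show "iter_lin (Suc 0) (6 * c3 * of_int h) (shift_diff h \<phi>)"
      by (simp add: mult_ac)
  qed
  have s3: "iter_lin (Suc (Suc (Suc 0))) (24 * c4) \<phi>" if "\<And>x. \<phi> x = c4 * of_int x ^ 4 + c3 * of_int x ^ 3 + c2 * of_int x ^ 2 + c1 * of_int x + c0" for \<phi> c4 c3 c2 c1 c0
  proof (subst iter_lin.simps, intro allI)
    fix h
    have "shift_diff h \<phi> x = (4 * c4 * of_int h) * of_int x ^ 3 + (6 * c4 * of_int h ^ 2 + 3 * c3 * of_int h) * of_int x ^ 2
       + (4 * c4 * of_int h ^ 3 + 3 * c3 * of_int h ^ 2 + 2 * c2 * of_int h) * of_int x 
       + (c4 * of_int h ^ 4 + c3 * of_int h ^ 3 + c2 * of_int h ^ 2 + c1 * of_int h)" for x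
      unfolding shift_diff_def that of_int_add by algebra
    from s2[OF this] show "iter_lin (Suc (Suc 0)) (24 * c4 * of_int h) (shift_diff h \<phi>)"
      by (simp add: mult_ac)
  qed
  have "iter_lin (Suc (Suc (Suc (Suc 0)))) (120 * a5) \<phi>"
  proof (subst iter_lin.simps, intro allI)
    fix h
    have "shift_diff h \<phi> x = (5 * a5 * of_int h) * of_int x ^ 4 + (10 * a5 * of_int h ^ 2 + 4 * a4 * of_int h) * of_int x ^ 3
       + (10 * a5 * of_int h ^ 3 + 6 * a4 * of_int h ^ 2 + 3 * a3 * of_int h) * of_int x ^ 2
       + (5 * a5 * of_int h ^ 4 + 4 * a4 * of_int h ^ 3 + 3 * a3 * of_int h ^ 2 + 2 * a2 * of_int h) * of_int x 
       + (a5 * of_int h ^ 5 + a4 * of_int h ^ 4 + a3 * of_int h ^ 3 + a2 * of_int h ^ 2 + a1 * of_int h)" for x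
      unfolding shift_diff_def \<phi> of_int_add by algebra
    from s3[OF this] show "iter_lin (Suc (Suc (Suc 0))) (120 * a5 * of_int h) (shift_diff h \<phi>)"
      by (simp add: mult_ac)
  qed
  then show ?thesis using \<theta> by (simp add: numeral_eq_Suc del: iter_lin.simps)
qed

section \<open>Weyl's inequality\<close>

lemma harm_le_powr:
  fixes a :: real
  assumes "0 < a" "a \<le> 1" "q \<ge> 1"
  shows "harm (2 * q) \<le> (2 + 1 / a) * real q powr a"
proof -
  have "harm (Suc n) - ln (real (Suc n)) \<le> (1 :: real)" for n
    using decseqD[OF decseq_harm_diff_ln, of 0 n] by (simp add: harm_expand)
  from this[of "2 * q - 1"] have "harm (2 * q) \<le> 1 + ln (real (2 * q))"
    using assms(3) by simp
  also have "ln (real (2 * q)) = ln 2 + ln (real q)" using assms(3) by (simp add: ln_mult)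
  also have "ln 2 \<le> (1 :: real)" using ln_2_less_1 by simp
  also have "ln (real q) \<le> real q powr a / a"
    using assms by (intro ln_powr_bound) auto
  finally have "harm (2 * q) \<le> 2 + real q powr a / a" by simp
  moreover have "real q powr a \<ge> 1" using assms by (intro ge_one_powr_ge_zero) auto
  ultimately show ?thesis by (simp add: ring_distribs)
qed

lemma geom_bound_iter_four:
  "geom_bound_iter P 4 \<theta> = (\<Sum>(h1, h2, h3, h4)\<in>{- int P<..<int P} \<times> {- int P<..<int P} \<times> {- int P<..<int P} \<times> {- int P<..<int P}.
      geom_bound P (\<theta> * of_int (h1 * h2 * h3 * h4)))"
  by (simp add: numeral_eq_Suc sum.cartesian_product[symmetric] mult.assoc)

lemma card_int_divisors_le:
  assumes "k \<ge> (1 :: nat)"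
  shows "finite {h :: int. nat \<bar>h\<bar> dvd k}" "card {h :: int. nat \<bar>h\<bar> dvd k} \<le> 2 * card {d. d dvd k}"
proof -
  have sub: "{h :: int. nat \<bar>h\<bar> dvd k} \<subseteq> int ` {d. d dvd k} \<union> (\<lambda>d. - int d) ` {d. d dvd k}"
  proof
    fix h :: int assume h: "h \<in> {h. nat \<bar>h\<bar> dvd k}"
    have "h = int (nat \<bar>h\<bar>) \<or> h = - int (nat \<bar>h\<bar>)" by linarith
    then show "h \<in> int ` {d. d dvd k} \<union> (\<lambda>d. - int d) ` {d. d dvd k}"
      using h by blast
  qed
  have fin: "finite {d. d dvd k}" using assms by (intro finite_divisors_nat) auto
  show "finite {h :: int. nat \<bar>h\<bar> dvd k}"
    by (rule finite_subset[OF sub]) (use fin in auto)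
  have "card {h :: int. nat \<bar>h\<bar> dvd k} \<le> card (int ` {d. d dvd k} \<union> (\<lambda>d. - int d) ` {d. d dvd k})"
    by (rule card_mono[OF _ sub]) (use fin in auto)
  also have "\<dots> \<le> card (int ` {d. d dvd k}) + card ((\<lambda>d. - int d) ` {d. d dvd k})"
    by (rule card_Un_le)
  also have "\<dots> \<le> card {d. d dvd k} + card {d. d dvd k}"
    by (intro add_mono card_image_le fin)
  finally show "card {h :: int. nat \<bar>h\<bar> dvd k} \<le> 2 * card {d. d dvd k}" by simp
qed

text \<open>Quadruples with product 0 have a vanishing entry, so there are few of them and the
  trivial bound suffices. In a quadruple with product \<open>k\<close> or \<open>- k\<close>, where
  \<open>k > 0\<close>, every entry is a signed divisor of \<open>k\<close>, so at most
  \<open>(2 * D) ^ 4\<close> quadruples belong to the same \<open>k\<close>.\<close>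

lemma geom_bound_iter_four_le:
  assumes D: "\<And>k. 1 \<le> k \<Longrightarrow> k \<le> P ^ 4 \<Longrightarrow> real (card {d. d dvd k}) \<le> D" and P: "P \<ge> 1"
  shows "geom_bound_iter P 4 \<theta> \<le> 32 * real P ^ 4 + 16 * D ^ 4 * (\<Sum>k\<in>{1..P^4}. geom_bound P (\<theta> * real k))"
proof -
  define H where "H = {- int P<..<int P}"
  define T where "T = H \<times> H \<times> H \<times> H"
  define \<pi> where "\<pi> = (\<lambda>(h1, h2, h3, h4). h1 * h2 * h3 * h4 :: int)"
  have finH: "finite H" by (simp add: H_def)
  have finT: "finite T" by (simp add: T_def finH)
  have cardH: "real (card H) \<le> 2 * real P" by (simp add: H_def)
  have g0: "geom_bound P x \<ge> 0" for x by (simp add: geom_bound_nonneg)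
  define Z where "Z = {t\<in>T. \<pi> t = 0}"
  define N where "N = {t\<in>T. \<pi> t \<noteq> 0}"
  have eq: "geom_bound_iter P 4 \<theta> = (\<Sum>t\<in>T. geom_bound P (\<theta> * of_int (\<pi> t)))"
    unfolding geom_bound_iter_four T_def H_def \<pi>_def by (simp add: case_prod_unfold)
  also have "\<dots> = (\<Sum>t\<in>Z. geom_bound P (\<theta> * of_int (\<pi> t))) + (\<Sum>t\<in>N. geom_bound P (\<theta> * of_int (\<pi> t)))"
    unfolding Z_def N_def using finT by (subst sum.union_disjoint[symmetric]) (auto intro: sum.cong)
  also have "(\<Sum>t\<in>Z. geom_bound P (\<theta> * of_int (\<pi> t))) \<le> 32 * real P ^ 4"
  proof -
    have "Z \<subseteq> ({0} \<times> H \<times> H \<times> H) \<union> (H \<times> {0} \<times> H \<times> H) \<union> (H \<times> H \<times> {0} \<times> H) \<union> (H \<times> H \<times> H \<times> {0})"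
      by (auto simp: Z_def T_def \<pi>_def)
    then have "card Z \<le> card (({0::int} \<times> H \<times> H \<times> H) \<union> (H \<times> {0::int} \<times> H \<times> H) \<union> (H \<times> H \<times> {0::int} \<times> H) \<union> (H \<times> H \<times> H \<times> {0::int}))"
      using finH by (intro card_mono) auto
    also have "\<dots> \<le> card ({0::int} \<times> H \<times> H \<times> H) + card (H \<times> {0::int} \<times> H \<times> H) + card (H \<times> H \<times> {0::int} \<times> H) + card (H \<times> H \<times> H \<times> {0::int})"
      by (intro order.trans[OF card_Un_le] add_mono order.refl)
    also have "\<dots> = 4 * card H ^ 3"
      by (simp add: card_cartesian_product power3_eq_cube)
    finally have "real (card Z) \<le> real (4 * card H ^ 3)" by (rule of_nat_mono)
    also have "\<dots> \<le> 4 * (2 * real P) ^ 3" using power_mono[OF cardH, of 3] by simp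
    finally have cZ: "real (card Z) \<le> 32 * real P ^ 3" by (simp add: power_mult_distrib)
    have "(\<Sum>t\<in>Z. geom_bound P (\<theta> * of_int (\<pi> t))) \<le> (\<Sum>t\<in>Z. real P)"
      by (intro sum_mono geom_bound_le) auto
    also have "\<dots> = real (card Z) * real P" by simp
    also have "\<dots> \<le> 32 * real P ^ 3 * real P" using cZ by (intro mult_right_mono) auto
    finally show ?thesis by (simp add: eval_nat_numeral)
  qed
  also have "(\<Sum>t\<in>N. geom_bound P (\<theta> * of_int (\<pi> t))) \<le> 16 * D ^ 4 * (\<Sum>k\<in>{1..P^4}. geom_bound P (\<theta> * real k))"
  proof -
    define \<kappa> where "\<kappa> t = nat \<bar>\<pi> t\<bar>" for t
    have range: "\<kappa> t \<in> {1..P^4}" if t: "t \<in> N" for t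
    proof -
      obtain a b c d where t': "t = (a, b, c, d)" by (cases t) auto
      have ab: "\<bar>a\<bar> \<le> int P" "\<bar>b\<bar> \<le> int P" "\<bar>c\<bar> \<le> int P" "\<bar>d\<bar> \<le> int P"
        using t by (auto simp: t' N_def T_def H_def)
      have "\<bar>\<pi> t\<bar> = \<bar>a\<bar> * \<bar>b\<bar> * \<bar>c\<bar> * \<bar>d\<bar>" by (simp add: \<pi>_def t' abs_mult)
      also have "\<dots> \<le> int P * int P * int P * int P"
        using ab by (intro mult_mono) auto
      finally have "\<bar>\<pi> t\<bar> \<le> int (P ^ 4)" by (simp add: eval_nat_numeral)
      moreover have "\<pi> t \<noteq> 0" using t by (simp add: N_def)
      ultimately show ?thesis by (auto simp: \<kappa>_def nat_le_iff)
    qed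
    have finN: "finite N" using finT by (simp add: N_def)
    have "(\<Sum>t\<in>N. geom_bound P (\<theta> * of_int (\<pi> t))) = (\<Sum>t\<in>N. geom_bound P (\<theta> * real (\<kappa> t)))"
      by (intro sum.cong refl) (metis \<kappa>_def geom_bound_abs of_int_of_nat_eq int_nat_eq abs_ge_zero)
    also have "\<dots> = (\<Sum>k\<in>{1..P^4}. \<Sum>t\<in>{t\<in>N. \<kappa> t = k}. geom_bound P (\<theta> * real (\<kappa> t)))"
      by (rule sum.group[symmetric]) (use finN range in auto)
    also have "\<dots> \<le> (\<Sum>k\<in>{1..P^4}. 16 * D ^ 4 * geom_bound P (\<theta> * real k))"
    proof (rule sum_mono)
      fix k assume k: "k \<in> {1..P^4}"
      define E where "E = {h :: int. nat \<bar>h\<bar> dvd k}"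
      have E: "finite E" "card E \<le> 2 * card {d. d dvd k}"
        using card_int_divisors_le[of k] k by (auto simp: E_def)
      have "{t\<in>N. \<kappa> t = k} \<subseteq> E \<times> E \<times> E \<times> E"
      proof
        fix t assume "t \<in> {t\<in>N. \<kappa> t = k}"
        moreover obtain a b c d where t': "t = (a, b, c, d)" by (cases t) auto
        ultimately have kk: "k = nat \<bar>a\<bar> * nat \<bar>b\<bar> * nat \<bar>c\<bar> * nat \<bar>d\<bar>"
          by (auto simp: \<kappa>_def \<pi>_def abs_mult nat_mult_distrib)
        show "t \<in> E \<times> E \<times> E \<times> E"
          unfolding t' E_def kk by (simp add: dvd_mult dvd_mult2)
      qed
      then have "card {t\<in>N. \<kappa> t = k} \<le> card (E \<times> E \<times> E \<times> E)"
        using E by (intro card_mono) auto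
      also have "\<dots> = card E ^ 4" by (simp add: card_cartesian_product eval_nat_numeral)
      finally have "real (card {t\<in>N. \<kappa> t = k}) \<le> real (card E ^ 4)" by (rule of_nat_mono)
      also have "\<dots> = real (card E) ^ 4" by simp
      also have "\<dots> \<le> (2 * D) ^ 4"
      proof (rule power_mono)
        have "real (card E) \<le> real (2 * card {d. d dvd k})" using E(2) by (rule of_nat_mono)
        also have "\<dots> \<le> 2 * D" using D[of k] k by simp
        finally show "real (card E) \<le> 2 * D" .
      qed simp
      finally have c: "real (card {t\<in>N. \<kappa> t = k}) \<le> 16 * D ^ 4" by (simp add: power_mult_distrib)
      have "(\<Sum>t\<in>{t\<in>N. \<kappa> t = k}. geom_bound P (\<theta> * real (\<kappa> t))) = real (card {t\<in>N. \<kappa> t = k}) * geom_bound P (\<theta> * real k)"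
        by simp
      also have "\<dots> \<le> 16 * D ^ 4 * geom_bound P (\<theta> * real k)"
        using c g0 by (intro mult_right_mono) auto
      finally show "(\<Sum>t\<in>{t\<in>N. \<kappa> t = k}. geom_bound P (\<theta> * real (\<kappa> t))) \<le> 16 * D ^ 4 * geom_bound P (\<theta> * real k)" .
    qed
    finally show ?thesis by (simp add: sum_distrib_left)
  qed
  finally show ?thesis by simp
qed

text \<open>The customary arbitrarily small loss is fixed as the exponent \<open>1/16\<close>, half
  of it spent on the divisor bound and half on the harmonic sum. \<open>C\<close> is uniform in the
  phase, which matters since the polynomial depends on \<open>Y\<close>.\<close>

theorem weyl_inequality:
  "\<exists>C>0. \<forall>P q b \<theta> \<phi> u. 1 \<le> P \<longrightarrow> 1 \<le> q \<longrightarrow> q \<le> P ^ 5 \<longrightarrow> coprime b (int q) \<longrightarrow>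
     \<bar>\<theta> - of_int b / real q\<bar> \<le> 1 / (real q)^2 \<longrightarrow> iter_lin 4 \<theta> \<phi> \<longrightarrow>
     norm (\<Sum>x\<in>{u..<u + int P}. unit_exp (\<phi> x)) ^ 16 
       \<le> C * real P powr (16 + 1/16) * (1 / real P + 1 / real q + real q / real P ^ 5)"
proof -
  \<comment> \<open>\<open>512 = 4 * 4 * 32\<close>: the products of shifts are at most
    \<open>P ^ 4\<close> and the divisor bound enters to the fourth power, so its total cost is
    \<open>P powr (1/32)\<close>.\<close>
  obtain C0 where C0: "C0 > 0" "\<And>n. n \<ge> 1 \<Longrightarrow> real (card {d. d dvd n}) \<le> C0 * real n powr (1/512)"
    using divisor_bound[of "1/512"] by auto
  define C where "C = 2 ^ 11 * (32 + 16 * C0 ^ 4 * 648 * 4)"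
  have "norm (\<Sum>x\<in>{u..<u + int P}. unit_exp (\<phi> x)) ^ 16 
       \<le> C * real P powr (16 + 1/16) * (1 / real P + 1 / real q + real q / real P ^ 5)"
    if P: "1 \<le> P" and q: "1 \<le> q" "q \<le> P ^ 5" and cop: "coprime b (int q)" 
      and ap: "\<bar>\<theta> - of_int b / real q\<bar> \<le> 1 / (real q)^2" and lin: "iter_lin 4 \<theta> \<phi>" 
    for P q :: nat and b :: int and \<theta> \<phi> u
  proof -
    define D where "D = C0 * real P powr (1/128)"
    define X where "X = 1 / real P + 1 / real q + real q / real P ^ 5"
    define e where "e = real P powr (1/32)"
    have e1: "e \<ge> 1" unfolding e_def using P by (intro ge_one_powr_ge_zero) auto
    have X0: "X \<ge> 1 / real P" by (simp add: X_def)
    have "real (card {d. d dvd k}) \<le> D" if k: "1 \<le> k" "k \<le> P ^ 4" for k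
    proof -
      have "real k \<le> real (P ^ 4)" using k(2) by (rule of_nat_mono)
      then have "real k powr (1/512) \<le> (real P ^ 4) powr (1/512)"
        by (intro powr_mono2) auto
      also have "\<dots> = real P powr (1/128)"
        using P by (simp add: powr_powr flip: powr_numeral)
      finally have "C0 * real k powr (1/512) \<le> D"
        unfolding D_def using C0(1) by (intro mult_left_mono) auto
      then show ?thesis using C0(2)[OF k(1)] by linarith
    qed
    then have 1: "geom_bound_iter P 4 \<theta> \<le> 32 * real P ^ 4 + 16 * D ^ 4 * (\<Sum>k\<in>{1..P^4}. geom_bound P (\<theta> * real k))"
      by (rule geom_bound_iter_four_le) (use P in auto)
    have D4: "D ^ 4 = C0 ^ 4 * e"
      unfolding D_def e_def using P by (simp add: power_mult_distrib powr_power)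
    \<comment> \<open>\<open>160 = 5 * 32\<close>, because \<open>q \<le> P ^ 5\<close>.\<close>
    have "harm (2 * q) \<le> (2 + 1 / (1/160)) * real q powr (1/160)"
      using q by (intro harm_le_powr) auto
    also have "real q powr (1/160) \<le> (real P ^ 5) powr (1/160)"
      using of_nat_mono[OF q(2), where ?'a = real] by (intro powr_mono2) auto
    also have "(real P ^ 5) powr (1/160) = e"
      unfolding e_def using P by (simp add: powr_powr flip: powr_numeral)
    finally have harm: "harm (2 * q) \<le> 162 * e" by simp
    have "(\<Sum>k\<in>{1..P^4}. geom_bound P (\<theta> * real k)) \<le> (2 * real (P ^ 4) / real q + 1) * (2 * real P + 4 * real q * harm (2 * q))"
      by (rule geom_bound_sum[OF q(1) ap cop]) auto
    also have "\<dots> \<le> (2 * real P ^ 4 / real q + 1) * (648 * e * (real P + real q))"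
    proof (intro mult_mono)
      have "4 * real q * harm (2 * q) \<le> 4 * real q * (162 * e)"
        using harm by (intro mult_left_mono) auto
      moreover have "2 * real P \<le> 648 * e * real P" using e1 by (intro mult_right_mono) auto
      ultimately show "2 * real P + 4 * real q * harm (2 * q) \<le> 648 * e * (real P + real q)"
        by (simp add: algebra_simps)
    qed (auto simp: harm_nonneg)
    also have "\<dots> = 648 * e * ((2 * real P ^ 4 / real q + 1) * (real P + real q))"
      by simp
    also have "(2 * real P ^ 4 / real q + 1) * (real P + real q) \<le> 4 * (real P ^ 5 * X)"
    proof -
      have "(2 * real P ^ 4 / real q + 1) * (real P + real q) = 2 * real P ^ 5 / real q + 2 * real P ^ 4 + real P + real q"
        using q by (simp add: field_simps eval_nat_numeral)
      moreover have "real P ^ 5 * X = real P ^ 4 + real P ^ 5 / real q + real q"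
        using P q by (simp add: X_def field_simps eval_nat_numeral)
      moreover have "real P \<le> real P ^ 4" using P by (simp add: self_le_power)
      moreover have "real P ^ 5 / real q \<ge> 0" "real P ^ 4 \<ge> 0" by auto
      ultimately show ?thesis by linarith
    qed
    finally have 2: "(\<Sum>k\<in>{1..P^4}. geom_bound P (\<theta> * real k)) \<le> 648 * e * (4 * (real P ^ 5 * X))"
      using e1 by (simp add: mult_left_mono)
    have 3: "real P ^ 4 \<le> e * e * (real P ^ 5 * X)"
    proof -
      have "real P ^ 4 = 1 * (real P ^ 5 * (1 / real P))" using P by (simp add: eval_nat_numeral)
      also have "\<dots> \<le> (e * e) * (real P ^ 5 * X)"
        using e1 X0 mult_mono[OF e1 e1] by (intro mult_mono) auto
      finally show ?thesis .
    qed
    have "geom_bound_iter P 4 \<theta> \<le> 32 * (e * e * (real P ^ 5 * X)) + 16 * (C0 ^ 4 * e) * (648 * e * (4 * (real P ^ 5 * X)))"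
    proof -
      have "16 * (C0 ^ 4 * e) * (\<Sum>k\<in>{1..P^4}. geom_bound P (\<theta> * real k)) \<le> 16 * (C0 ^ 4 * e) * (648 * e * (4 * (real P ^ 5 * X)))"
        using C0(1) e1 by (intro mult_left_mono[OF 2]) auto
      then show ?thesis using 1 3 unfolding D4 by linarith
    qed
    also have "\<dots> = (32 + 16 * C0 ^ 4 * 648 * 4) * (e * e) * (real P ^ 5 * X)"
      by (simp add: algebra_simps)
    finally have 4: "geom_bound_iter P 4 \<theta> \<le> (32 + 16 * C0 ^ 4 * 648 * 4) * (e * e) * (real P ^ 5 * X)" .
    have ee: "e * e = real P powr (1/16)" by (simp add: e_def flip: powr_add)
    have "norm (\<Sum>x\<in>{u..<u + int P}. unit_exp (\<phi> x)) ^ 16 \<le> (2 * real P) ^ 11 * geom_bound_iter P 4 \<theta>"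
      by (rule weyl_four[OF lin]) simp
    also have "\<dots> \<le> (2 * real P) ^ 11 * ((32 + 16 * C0 ^ 4 * 648 * 4) * (e * e) * (real P ^ 5 * X))"
      using 4 by (intro mult_left_mono) auto
    also have "\<dots> = C * (real P ^ 16 * (e * e)) * X"
      unfolding C_def power_mult_distrib by (simp add: algebra_simps flip: power_add)
    also have "real P ^ 16 * (e * e) = real P powr (16 + 1/16)"
      using P unfolding ee powr_add by (simp add: powr_numeral)
    finally show ?thesis unfolding X_def .
  qed
  moreover have "C > 0" using C0(1) unfolding C_def by (intro mult_pos_pos add_pos_pos) auto
  ultimately show ?thesis by blast
qed

section \<open>Trigonometric polynomials\<close>

text \<open>Finitely supported weights on the natural numbers are encoded as polynomials: products
  are then convolutions, and coefficients of \<open>p ^ s\<close> count weighted sums of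
  \<open>s\<close> terms. \<open>trig\<close> is the Fourier transform.\<close>

definition trig :: "real poly \<Rightarrow> real \<Rightarrow> complex" where
  "trig p \<alpha> = poly (map_poly of_real p) (unit_exp \<alpha>)"

lemma trig_0 [simp]: "trig 0 \<alpha> = 0"
  by (simp add: trig_def)

lemma trig_pCons: "trig (pCons a p) \<alpha> = of_real a + unit_exp \<alpha> * trig p \<alpha>"
  by (simp add: trig_def map_poly_pCons)

lemma trig_add: "trig (p + q) \<alpha> = trig p \<alpha> + trig q \<alpha>"
proof -
  have "map_poly of_real (p + q) = (map_poly of_real p + map_poly of_real q :: complex poly)"
    by (intro poly_eqI) (simp add: coeff_map_poly)
  then show ?thesis by (simp add: trig_def)
qed

lemma trig_smult: "trig (smult c p) \<alpha> = of_real c * trig p \<alpha>"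
proof -
  have "map_poly of_real (smult c p) = (smult (of_real c) (map_poly of_real p) :: complex poly)"
    by (intro poly_eqI) (simp add: coeff_map_poly)
  then show ?thesis by (simp add: trig_def)
qed

lemma trig_mult: "trig (p * q) \<alpha> = trig p \<alpha> * trig q \<alpha>"
proof (induction p)
  case (pCons a p)
  then show ?case by (simp add: trig_add trig_smult trig_pCons ring_distribs)
qed simp

lemma trig_1 [simp]: "trig 1 \<alpha> = 1"
  using trig_pCons[of 1 0 \<alpha>] by (simp add: one_pCons)

lemma trig_power: "trig (p ^ n) \<alpha> = trig p \<alpha> ^ n"
  by (induction n) (simp_all add: trig_mult)

lemma trig_sum: "trig (\<Sum>i\<in>A. p i) \<alpha> = (\<Sum>i\<in>A. trig (p i) \<alpha>)"
  by (induction A rule: infinite_finite_induct) (simp_all add: trig_add)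

lemma trig_monom: "trig (monom c n) \<alpha> = of_real c * unit_exp (\<alpha> * real n)"
  by (simp add: trig_def map_poly_monom poly_monom unit_exp_mult_nat[symmetric] mult.commute)

lemma trig_altdef: 
  assumes "degree p < T"
  shows "trig p \<alpha> = (\<Sum>m<T. of_real (coeff p m) * unit_exp (\<alpha> * real m))"
proof -
  have "p = (\<Sum>m<T. monom (coeff p m) m)"
    using assms poly_as_sum_of_monoms'[of p "T - 1"] by (cases T) (auto simp: lessThan_Suc_atMost)
  then have "trig p \<alpha> = trig (\<Sum>m<T. monom (coeff p m) m) \<alpha>" by simp
  then show ?thesis by (simp add: trig_sum trig_monom)
qed

lemma unit_exp_eq_1_imp: "unit_exp x = 1 \<Longrightarrow> x \<in> \<int>"
proof -
  assume "unit_exp x = 1"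
  then have "dist_int x = 0" using norm_1_minus_unit_exp[of x] dist_int_nonneg[of x] by simp
  then have "x = of_int (round x)" by (simp add: dist_int_def)
  then show ?thesis by (metis Ints_of_int)
qed

lemma sum_unit_exp_orthogonal:
  fixes k :: int
  assumes "T > 0"
  shows "(\<Sum>t<T. unit_exp (of_int k * (real t / real T - \<theta>))) = (if int T dvd k then of_nat T * unit_exp (- of_int k * \<theta>) else 0)"
proof -
  have "(\<Sum>t<T. unit_exp (of_int k * (real t / real T - \<theta>))) = (\<Sum>t<T. unit_exp (- of_int k * \<theta>) * unit_exp (of_int k / real T) ^ t)"
    by (intro sum.cong refl) (simp add: unit_exp_mult_nat[symmetric] unit_exp_add[symmetric] algebra_simps)
  also have "\<dots> = unit_exp (- of_int k * \<theta>) * (\<Sum>t<T. unit_exp (of_int k / real T) ^ t)"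
    by (simp add: sum_distrib_left)
  also have "(\<Sum>t<T. unit_exp (of_int k / real T) ^ t) = (if int T dvd k then of_nat T else 0)"
  proof (cases "int T dvd k")
    case True
    then obtain j where "k = int T * j" by blast
    then have "of_int k / real T = of_int j" using assms by simp
    then show ?thesis using True by simp
  next
    case False
    have "unit_exp (of_int k / real T) \<noteq> 1"
    proof
      assume "unit_exp (of_int k / real T) = 1"
      then obtain j where "of_int k / real T = of_int j" using unit_exp_eq_1_imp by (metis Ints_cases)
      then have "real_of_int k = real_of_int (j * int T)" using assms by (simp add: field_simps)
      then have "k = j * int T" by (simp only: of_int_eq_iff)
      then show False using False by simp
    qed
    moreover have "unit_exp (of_int k / real T) ^ T = 1"
      using assms by (simp add: unit_exp_mult_nat[symmetric])
    ultimately show ?thesis using False by (simp add: sum_gp_strict)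
  qed
  finally show ?thesis by simp
qed

text \<open>As the degree is below \<open>T\<close>, no two exponents agree modulo \<open>T\<close>.
  Discrete inversion on the grid \<open>t / T\<close> therefore recovers the coefficient exactly and
  replaces integration over the circle.\<close>

lemma coeff_trig:
  assumes "degree p < T" "n < T"
  shows "(\<Sum>t<T. trig p (real t / real T) * unit_exp (- (real t / real T * real n))) = of_nat T * of_real (coeff p n)"
proof -
  have T: "T > 0" using assms by simp
  have "(\<Sum>t<T. trig p (real t / real T) * unit_exp (- (real t / real T * real n)))
     = (\<Sum>t<T. \<Sum>m<T. of_real (coeff p m) * unit_exp (of_int (int m - int n) * (real t / real T - 0)))"
    unfolding trig_altdef[OF assms(1)] sum_distrib_right mult.assoc unit_exp_add[symmetric]
    by (intro sum.cong refl arg_cong2[where f = "(*)"] arg_cong[where f = unit_exp]) (simp add: algebra_simps diff_divide_distrib)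
  also have "\<dots> = (\<Sum>m<T. of_real (coeff p m) * (\<Sum>t<T. unit_exp (of_int (int m - int n) * (real t / real T - 0))))"
    by (subst sum.swap) (simp add: sum_distrib_left)
  also have "\<dots> = (\<Sum>m<T. of_real (coeff p m) * (if m = n then of_nat T else 0))"
  proof (intro sum.cong refl arg_cong2[where f = "(*)"])
    fix m assume "m \<in> {..<T}"
    have "int T dvd int m - int n \<longleftrightarrow> m = n"
    proof
      assume "int T dvd int m - int n"
      then have "int m mod int T = int n mod int T" by (simp add: mod_eq_dvd_iff)
      then show "m = n" using \<open>m \<in> {..<T}\<close> assms(2) by simp
    qed simp
    then show "(\<Sum>t<T. unit_exp (of_int (int m - int n) * (real t / real T - 0))) = (if m = n then of_nat T else 0)"
      unfolding sum_unit_exp_orthogonal[OF T] by simp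
  qed
  also have "\<dots> = of_nat T * of_real (coeff p n)"
    using assms(2) by (simp add: if_distrib mult.commute cong: if_cong)
  finally show ?thesis .
qed

text \<open>Shifting the grid by \<open>\<theta>\<close> multiplies each coefficient by a number of
  modulus 1 and so does not change the mean square. The shift is later a fraction
  \<open>a / q\<close>, so that all major arcs are treated alike.\<close>

lemma parseval:
  assumes "degree p < T"
  shows "(\<Sum>t<T. norm (trig p (real t / real T - \<theta>)) ^ 2) = real T * (\<Sum>m<T. coeff p m ^ 2)"
proof -
  have T: "T > 0" using assms by simp
  have "complex_of_real (\<Sum>t<T. norm (trig p (real t / real T - \<theta>)) ^ 2) 
     = (\<Sum>t<T. trig p (real t / real T - \<theta>) * cnj (trig p (real t / real T - \<theta>)))"
    by (simp only: of_real_sum complex_norm_square)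
  also have "\<dots> = (\<Sum>t<T. \<Sum>m<T. \<Sum>n<T. of_real (coeff p m) * of_real (coeff p n) * unit_exp (of_int (int m - int n) * (real t / real T - \<theta>)))"
    by (simp add: trig_altdef[OF assms] sum_product unit_exp_minus[symmetric] unit_exp_diff left_diff_distrib mult_ac)
  also have "\<dots> = (\<Sum>m<T. \<Sum>n<T. of_real (coeff p m) * of_real (coeff p n) * (\<Sum>t<T. unit_exp (of_int (int m - int n) * (real t / real T - \<theta>))))"
  proof -
    have "(\<Sum>t<T. \<Sum>m<T. \<Sum>n<T. F t m n) = (\<Sum>m<T. \<Sum>n<T. \<Sum>t<T. F t m n)" for F :: "nat \<Rightarrow> nat \<Rightarrow> nat \<Rightarrow> complex"
    proof -
      have "(\<Sum>t<T. \<Sum>m<T. \<Sum>n<T. F t m n) = (\<Sum>m<T. \<Sum>t<T. \<Sum>n<T. F t m n)" by (rule sum.swap)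
      also have "\<dots> = (\<Sum>m<T. \<Sum>n<T. \<Sum>t<T. F t m n)" by (rule sum.cong[OF refl sum.swap])
      finally show ?thesis .
    qed
    then show ?thesis by (simp only: sum_distrib_left)
  qed
  also have "\<dots> = (\<Sum>m<T. \<Sum>n<T. if n = m then of_real (coeff p m) * of_real (coeff p n) * of_nat T else 0)"
  proof (intro sum.cong refl)
    fix m n assume mn: "m \<in> {..<T}" "n \<in> {..<T}"
    have "int T dvd int m - int n \<longleftrightarrow> n = m"
    proof
      assume "int T dvd int m - int n"
      then have "int m mod int T = int n mod int T" by (simp add: mod_eq_dvd_iff)
      then show "n = m" using mn by simp
    qed simp
    then show "complex_of_real (coeff p m) * of_real (coeff p n) * (\<Sum>t<T. unit_exp (of_int (int m - int n) * (real t / real T - \<theta>)))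
       = (if n = m then of_real (coeff p m) * of_real (coeff p n) * of_nat T else 0)"
      unfolding sum_unit_exp_orthogonal[OF T] by auto
  qed
  also have "\<dots> = complex_of_real (real T * (\<Sum>m<T. coeff p m ^ 2))"
    by (simp add: sum_distrib_left power2_eq_square mult_ac)
  finally show ?thesis by (simp only: of_real_eq_iff)
qed

lemma coeff_mult_neq_0:
  assumes "coeff (p * q) n \<noteq> (0 :: real)"
  shows "\<exists>i j. n = i + j \<and> coeff p i \<noteq> 0 \<and> coeff q j \<noteq> 0"
proof -
  have "(\<Sum>i\<le>n. coeff p i * coeff q (n - i)) \<noteq> 0" using assms by (simp add: coeff_mult)
  then obtain i where "i \<in> {..n}" "coeff p i * coeff q (n - i) \<noteq> 0"
    by (meson sum.neutral)
  then show ?thesis by (intro exI[of _ i] exI[of _ "n - i"]) auto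
qed

lemma coeff_power_neq_0:
  assumes "coeff (p ^ s) n \<noteq> (0 :: real)"
  shows "\<exists>m. (\<forall>i<s. coeff p (m i) \<noteq> 0) \<and> n = (\<Sum>i<s. m i)"
  using assms
proof (induction s arbitrary: n)
  case 0
  then show ?case by (auto simp: split: if_splits)
next
  case (Suc s)
  then obtain i j where ij: "n = i + j" "coeff p i \<noteq> 0" "coeff (p ^ s) j \<noteq> 0"
    using coeff_mult_neq_0[of p "p ^ s" n] by auto
  obtain m where "\<forall>i<s. coeff p (m i) \<noteq> 0" "j = (\<Sum>i<s. m i)" using Suc.IH[OF ij(3)] by blast
  then have "(\<forall>k<Suc s. coeff p ((m(s := i)) k) \<noteq> 0)" "n = (\<Sum>k<Suc s. (m(s := i)) k)"
    using ij by (auto simp: less_Suc_eq)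
  then show ?case by blast
qed

lemma coeff_power_nonneg: "(\<And>i. coeff p i \<ge> 0) \<Longrightarrow> coeff (p ^ s) n \<ge> (0 :: real)"
  by (induction s arbitrary: n) (auto simp: coeff_mult intro!: sum_nonneg mult_nonneg_nonneg)

text \<open>The interval for \<open>\<mu>\<close> keeps the length \<open>2 * \<delta>\<close> throughout the induction, because two such intervals whose
  centres are at distance at most \<open>\<delta>\<close> still share a subinterval of length \<open>\<delta>\<close>.\<close>
lemma coeff_power_ge:
  assumes c: "\<And>m. coeff p m \<ge> 0" "\<And>m. \<bar>real m - z\<bar> \<le> \<delta> \<Longrightarrow> coeff p m \<ge> \<gamma>"
    and \<gamma>: "\<gamma> \<ge> 0" and \<delta>: "\<delta> \<ge> 1" "\<delta> \<le> z"
    and \<mu>: "\<bar>real \<mu> - real (Suc s) * z\<bar> \<le> \<delta>"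
  shows "coeff (p ^ Suc s) \<mu> \<ge> \<gamma> ^ Suc s * (\<delta> - 1) ^ s"
  using \<mu>
proof (induction s arbitrary: \<mu>)
  case 0
  then show ?case using c(2) by simp
next
  case (Suc s)
  define d where "d = real \<mu> - real (Suc (Suc s)) * z"
  have d: "\<bar>d\<bar> \<le> \<delta>" using Suc.prems by (simp add: d_def)
  \<comment> \<open>The half of the window around \<open>z\<close> on the side to which
    \<open>\<mu>\<close> deviates; for \<open>m\<close> in it, both \<open>m\<close> and
    \<open>\<mu> - m\<close> stay within \<open>\<delta>\<close> of their centres.\<close>
  define lo where "lo = (if d \<ge> 0 then z else z - \<delta>)"
  define A where "A = {m. lo \<le> real m \<and> real m \<le> lo + \<delta>}"
  have zmu: "real \<mu> = d + z + real (Suc s) * z" by (simp add: d_def algebra_simps)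
  define w where "w = real (Suc s) * z"
  have w: "w \<ge> z" using \<delta> by (simp add: w_def mult_le_cancel_right1)
  have sub: "A \<subseteq> {..\<mu>}"
  proof
    fix m assume m: "m \<in> A"
    then have "real m \<le> lo + \<delta>" by (simp add: A_def)
    also have "\<dots> \<le> real \<mu>" using zmu d \<delta> w unfolding w_def[symmetric] by (auto simp: lo_def split: if_splits)
    finally show "m \<in> {..\<mu>}" by simp
  qed
  have A: "coeff p m \<ge> \<gamma>" "coeff (p ^ Suc s) (\<mu> - m) \<ge> \<gamma> ^ Suc s * (\<delta> - 1) ^ s" if "m \<in> A" for m
  proof -
    have m: "lo \<le> real m" "real m \<le> lo + \<delta>" "m \<le> \<mu>" using that sub by (auto simp: A_def)
    show "coeff p m \<ge> \<gamma>" using m by (intro c(2)) (auto simp: lo_def split: if_splits)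
    have "real (\<mu> - m) - real (Suc s) * z = d + z - real m"
      using m(3) zmu by (simp add: of_nat_diff)
    then have "\<bar>real (\<mu> - m) - real (Suc s) * z\<bar> \<le> \<delta>"
      using m d by (auto simp: lo_def split: if_splits)
    then show "coeff (p ^ Suc s) (\<mu> - m) \<ge> \<gamma> ^ Suc s * (\<delta> - 1) ^ s" by (rule Suc.IH)
  qed
  have lo0: "lo \<ge> 0" using \<delta> by (auto simp: lo_def)
  have card: "real (card A) \<ge> \<delta> - 1"
  proof -
    have sub2: "{nat \<lceil>lo\<rceil>..nat \<lfloor>lo + \<delta>\<rfloor>} \<subseteq> A"
    proof
      fix m assume "m \<in> {nat \<lceil>lo\<rceil>..nat \<lfloor>lo + \<delta>\<rfloor>}"
      then show "m \<in> A" using lo0 \<delta> by (auto simp: A_def nat_le_iff le_nat_iff ceiling_le_iff le_floor_iff)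
    qed
    have "finite A" using finite_subset[OF sub] by simp
    then have "card {nat \<lceil>lo\<rceil>..nat \<lfloor>lo + \<delta>\<rfloor>} \<le> card A" by (rule card_mono[OF _ sub2])
    moreover have "real (card {nat \<lceil>lo\<rceil>..nat \<lfloor>lo + \<delta>\<rfloor>}) \<ge> \<delta> - 1"
    proof -
      have "card {nat \<lceil>lo\<rceil>..nat \<lfloor>lo + \<delta>\<rfloor>} = Suc (nat \<lfloor>lo + \<delta>\<rfloor>) - nat \<lceil>lo\<rceil>" by simp
      moreover have "real (nat \<lfloor>lo + \<delta>\<rfloor>) \<ge> lo + \<delta> - 1" "real (nat \<lceil>lo\<rceil>) \<le> lo + 1" using lo0 \<delta> by linarith+
      ultimately show ?thesis by linarith
    qed
    ultimately show ?thesis by linarith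
  qed
  have nn: "coeff p m * coeff (p ^ Suc s) (\<mu> - m) \<ge> 0" for m
    by (intro mult_nonneg_nonneg coeff_power_nonneg c(1))
  have "\<gamma> ^ Suc (Suc s) * (\<delta> - 1) ^ Suc s = (\<delta> - 1) * (\<gamma> * (\<gamma> ^ Suc s * (\<delta> - 1) ^ s))"
    by simp
  also have "\<dots> \<le> real (card A) * (\<gamma> * (\<gamma> ^ Suc s * (\<delta> - 1) ^ s))"
    using card \<gamma> \<delta> by (intro mult_right_mono) auto
  also have "\<dots> = (\<Sum>m\<in>A. \<gamma> * (\<gamma> ^ Suc s * (\<delta> - 1) ^ s))" by simp
  also have "\<dots> \<le> (\<Sum>m\<in>A. coeff p m * coeff (p ^ Suc s) (\<mu> - m))"
    using \<gamma> \<delta> by (intro sum_mono mult_mono A) (auto simp: c(1))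
  also have "\<dots> \<le> (\<Sum>m\<le>\<mu>. coeff p m * coeff (p ^ Suc s) (\<mu> - m))"
    by (rule sum_mono2) (use sub nn in auto)
  also have "\<dots> = coeff (p ^ Suc (Suc s)) \<mu>" by (simp add: coeff_mult)
  finally show ?case .
qed

section \<open>The quintic polynomial and its complete exponential sums\<close>

text \<open>This is \<open>((5 * Y * x + 1) ^ 5 - 1) / (25 * Y)\<close>. The factor 5 in front of
  \<open>Y\<close> makes all coefficients integral, and the polynomial is congruent to
  \<open>x\<close> modulo \<open>Y\<close>.\<close>

definition quintic :: "int \<Rightarrow> int \<Rightarrow> int" where
  "quintic Y x = 125 * Y ^ 4 * x ^ 5 + 125 * Y ^ 3 * x ^ 4 + 50 * Y ^ 2 * x ^ 3 + 10 * Y * x ^ 2 + x"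

lemma quintic_eq: "(5 * Y * x + 1) ^ 5 = 25 * Y * quintic Y x + 1"
  unfolding quintic_def by algebra

lemma iter_lin_quintic:
  "iter_lin 4 (15000 * of_int Y ^ 4 * \<alpha>) (\<lambda>x. \<alpha> * of_int (quintic Y x))"
  by (rule iter_lin_degree_5[of _ "125 * of_int Y ^ 4 * \<alpha>" "125 * of_int Y ^ 3 * \<alpha>" "50 * of_int Y ^ 2 * \<alpha>" "10 * of_int Y * \<alpha>" "\<alpha>" 0])
     (simp_all add: quintic_def algebra_simps)

text \<open>The divisibility by \<open>h\<close> gives periodicity modulo \<open>q\<close>; the
  cofactor, being 1 modulo \<open>Y\<close>, gives the vanishing of complete sums when
  \<open>h\<close> is \<open>q\<close> divided by a prime factor of \<open>Y\<close>.\<close>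

lemma quintic_shift: "\<exists>R. quintic Y (x + h) - quintic Y x = h * (1 + Y * R)"
proof
  show "quintic Y (x + h) - quintic Y x = h * (1 + Y * (10 * (2 * x + h) + 50 * Y * (3 * x^2 + 3 * x * h + h^2)
     + 125 * Y^2 * (4 * x^3 + 6 * x^2 * h + 4 * x * h^2 + h^3) 
     + 125 * Y^3 * (5 * x^4 + 10 * x^3 * h + 10 * x^2 * h^2 + 5 * x * h^3 + h^4)))"
    unfolding quintic_def by algebra
qed

definition complete_sum :: "int \<Rightarrow> nat \<Rightarrow> int \<Rightarrow> complex" where
  "complete_sum Y q a = (\<Sum>x\<in>{0..<int q}. unit_exp (of_int (a * quintic Y x) / real q))"

lemma unit_exp_quintic_periodic:
  assumes "q > 0"
  shows "unit_exp (of_int (a * quintic Y (x + int q * k)) / real q) = unit_exp (of_int (a * quintic Y x) / real q)"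
proof -
  obtain R where R: "quintic Y (x + int q * k) - quintic Y x = int q * k * (1 + Y * R)"
    using quintic_shift by blast
  then have e: "quintic Y (x + int q * k) = quintic Y x + int q * k * (1 + Y * R)" by simp
  show ?thesis
  proof (rule unit_exp_cong_int)
    have "of_int (a * quintic Y (x + int q * k)) / real q - of_int (a * quintic Y x) / real q = of_int (a * k * (1 + Y * R))"
      unfolding e using assms by (simp add: field_simps)
    then show "of_int (a * quintic Y (x + int q * k)) / real q - of_int (a * quintic Y x) / real q \<in> \<int>"
      by (metis Ints_of_int)
  qed
qed

lemma sum_periodic_int:
  fixes F :: "int \<Rightarrow> 'a :: comm_monoid_add"
  assumes q: "q > 0" and per: "\<And>x k. F (x + int q * k) = F x"
  shows "(\<Sum>x\<in>{u..<u + int q}. F x) = (\<Sum>x\<in>{0..<int q}. F x)"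
proof (rule sum.reindex_bij_witness[of _ "\<lambda>y. u + (y - u) mod int q" "\<lambda>x. x mod int q"])
  fix x assume x: "x \<in> {u..<u + int q}"
  have "(x mod int q - u) mod int q = (x - u) mod int q" by (simp add: mod_diff_left_eq)
  also have "\<dots> = x - u" using x by (intro mod_pos_pos_trivial) auto
  finally show "u + (x mod int q - u) mod int q = x" by simp
  show "x mod int q \<in> {0..<int q}" using q by simp
  show "F (x mod int q) = F x"
    using per[of "x mod int q" "x div int q"] by (simp add: mult.commute)
next
  fix y assume y: "y \<in> {0..<int q}"
  have "(u + (y - u) mod int q) mod int q = (u + (y - u)) mod int q" by (simp only: mod_add_right_eq)
  also have "\<dots> = y" using y by simp
  finally show "(u + (y - u) mod int q) mod int q = y" .
  show "u + (y - u) mod int q \<in> {u..<u + int q}" using q by simp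
qed

lemma complete_sum_shift:
  assumes "q > 0"
  shows "(\<Sum>x\<in>{u..<u + int q}. unit_exp (of_int (a * quintic Y x) / real q)) = complete_sum Y q a"
  unfolding complete_sum_def by (rule sum_periodic_int) (use assms unit_exp_quintic_periodic in auto)

lemma norm_complete_sum_le: "norm (complete_sum Y q a) \<le> real q"
  using norm_sum[of "\<lambda>x. unit_exp (of_int (a * quintic Y x) / real q)" "{0..<int q}"] by (simp add: complete_sum_def)

text \<open>Shifting the summation variable by \<open>q / p\<close> multiplies the sum by the nontrivial root of unity 
  \<open>unit_exp (a / p)\<close>, since \<open>quintic\<close> is the identity modulo \<open>Y\<close>.\<close>
lemma complete_sum_eq_0:
  assumes q: "q > 0" and p: "prime p" "p dvd q" "int p dvd Y" and cop: "coprime a (int q)"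
  shows "complete_sum Y q a = 0"
proof -
  obtain h where h: "q = p * h" using p(2) by blast
  have p0: "p > 0" using p(1) prime_gt_0_nat by blast
  have h0: "h > 0" using q h by (cases h) auto
  have shift: "unit_exp (of_int (a * quintic Y (x + int h)) / real q) = unit_exp (of_int a / real p) * unit_exp (of_int (a * quintic Y x) / real q)" for x
  proof -
    obtain R where "quintic Y (x + int h) - quintic Y x = int h * (1 + Y * R)"
      using quintic_shift by blast
    then have e: "quintic Y (x + int h) = quintic Y x + int h * (1 + Y * R)" by simp
    obtain Z where Z: "Y = int p * Z" using p(3) by blast
    have "of_int (a * quintic Y (x + int h)) / real q = (of_int a / real p + of_int (a * quintic Y x) / real q) + of_int (a * Z * R)"
      unfolding e using h Z p0 h0 by (simp add: field_simps)
    then show ?thesis by (simp only: unit_exp_add unit_exp_of_int mult_1_right)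
  qed
  have "complete_sum Y q a = (\<Sum>x\<in>{int h..<int h + int q}. unit_exp (of_int (a * quintic Y x) / real q))"
    using complete_sum_shift[OF q] by simp
  also have "\<dots> = (\<Sum>x\<in>{0..<int q}. unit_exp (of_int (a * quintic Y (x + int h)) / real q))"
    by (rule sum.reindex_bij_witness[of _ "\<lambda>x. x + int h" "\<lambda>x. x - int h"]) auto
  also have "\<dots> = unit_exp (of_int a / real p) * complete_sum Y q a"
    unfolding shift complete_sum_def sum_distrib_left ..
  finally have "complete_sum Y q a * (1 - unit_exp (of_int a / real p)) = 0" by (simp add: algebra_simps)
  moreover have "unit_exp (of_int a / real p) \<noteq> 1"
  proof
    assume "unit_exp (of_int a / real p) = 1"
    then obtain j where "of_int a / real p = of_int j" using unit_exp_eq_1_imp by (metis Ints_cases)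
    then have "real_of_int a = real_of_int (j * int p)" using p0 by (simp add: field_simps)
    then have "a = j * int p" by (simp only: of_int_eq_iff)
    then have "int p dvd a" by simp
    moreover have "int p dvd int q" using p(2) by simp
    ultimately have "is_unit (int p)" using cop by (meson coprime_common_divisor)
    then show False using p(1) by (simp add: prime_nat_iff)
  qed
  ultimately show ?thesis by simp
qed

text \<open>The primes dividing 15000 are 2, 3 and 5. If \<open>30\<close> divides \<open>Y\<close>,
  a modulus coprime to \<open>Y\<close> is coprime to 15000 as well, so the leading coefficient
  after differencing is still a reduced fraction with denominator \<open>q\<close>.\<close>

lemma coprime_weyl_numerator:
  assumes Y: "30 dvd Y" and "coprime a (int q)" "coprime Y (int q)"
  shows "coprime (15000 * Y ^ 4 * a) (int q)"
proof -
  have "(30 :: int) ^ 4 dvd Y ^ 4" using Y by (rule dvd_power_same)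
  moreover have "(15000 :: int) dvd 30 ^ 4" by (rule dvdI[of _ _ 54]) simp
  ultimately have "15000 dvd Y ^ 4" by (rule dvd_trans[rotated])
  moreover have cY: "coprime (Y ^ 4) (int q)" using assms by simp
  ultimately have "coprime 15000 (int q)" by (rule coprime_divisors[OF _ dvd_refl])
  then show ?thesis using cY assms by simp
qed

text \<open>Weyl's inequality with \<open>P = q\<close>: one period is summed, and all three terms
  of the bound are at most \<open>1 / q\<close>. The exponent is \<open>37/16 * (1 - 1/16)\<close>;
  being larger than 2, it makes the sum over all \<open>q\<close> and \<open>a\<close> converge.
  \<open>C\<close> does not depend on \<open>Y\<close>, since \<open>Y\<close> enters only through a
  reduced fraction with denominator \<open>q\<close>.\<close>

lemma complete_sum_bound:
  "\<exists>C>0. \<forall>Y q a. 30 dvd Y \<longrightarrow> q \<ge> 1 \<longrightarrow> coprime a (int q) \<longrightarrow> coprime Y (int q) \<longrightarrow>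
     (norm (complete_sum Y q a) / real q) ^ 37 \<le> C * real q powr (- 555/256)"
proof -
  obtain C where C: "C > 0" "\<And>P q b \<theta> \<phi> u. 1 \<le> P \<Longrightarrow> 1 \<le> q \<Longrightarrow> q \<le> P ^ 5 \<Longrightarrow> coprime b (int q) \<Longrightarrow>
     \<bar>\<theta> - of_int b / real q\<bar> \<le> 1 / (real q)^2 \<Longrightarrow> iter_lin 4 \<theta> \<phi> \<Longrightarrow>
     norm (\<Sum>x\<in>{u..<u + int P}. unit_exp (\<phi> x)) ^ 16 
       \<le> C * real P powr (16 + 1/16) * (1 / real P + 1 / real q + real q / real P ^ 5)"
    using weyl_inequality by blast
  have "(norm (complete_sum Y q a) / real q) ^ 37 \<le> (3 * C) powr (37/16) * real q powr (- 555/256)"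
    if Y: "30 dvd Y" and q: "q \<ge> 1" and cop: "coprime a (int q)" "coprime Y (int q)" for Y q a
  proof -
    define b where "b = 15000 * Y ^ 4 * a"
    have cb: "coprime b (int q)" unfolding b_def by (rule coprime_weyl_numerator[OF Y cop])
    have lin: "iter_lin 4 (of_int b / real q) (\<lambda>x. of_int (a * quintic Y x) / real q)"
      using iter_lin_quintic[of Y "of_int a / real q"] by (simp add: b_def mult_ac)
    have "norm (complete_sum Y q a) ^ 16 = norm (\<Sum>x\<in>{0..<0 + int q}. unit_exp (of_int (a * quintic Y x) / real q)) ^ 16"
      by (simp add: complete_sum_def)
    also have "\<dots> \<le> C * real q powr (16 + 1/16) * (1 / real q + 1 / real q + real q / real q ^ 5)"
      by (rule C(2)[OF q q _ cb _ lin]) (use q in \<open>auto simp: self_le_power\<close>)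
    also have "\<dots> \<le> C * real q powr (16 + 1/16) * (3 / real q)"
    proof (rule mult_left_mono)
      have "real q / real q ^ 5 \<le> 1 / real q"
      proof -
        have "real q / real q ^ 5 = 1 / real q ^ 4" using q by (simp add: eval_nat_numeral)
        also have "\<dots> \<le> 1 / real q" using q by (intro divide_left_mono) (auto simp: self_le_power)
        finally show ?thesis .
      qed
      then show "1 / real q + 1 / real q + real q / real q ^ 5 \<le> 3 / real q" by simp
    qed (use C in auto)
    also have "real q powr (16 + 1/16) = real q ^ 16 * real q powr (1/16)"
      using q unfolding powr_add by (simp add: powr_numeral)
    finally have 1: "norm (complete_sum Y q a) ^ 16 \<le> C * (real q ^ 16 * real q powr (1/16)) * (3 / real q)" .
    define z where "z = norm (complete_sum Y q a) / real q"
    have z0: "z \<ge> 0" by (simp add: z_def)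
    have "z ^ 16 = norm (complete_sum Y q a) ^ 16 / real q ^ 16" by (simp add: z_def power_divide)
    also have "\<dots> \<le> C * (real q ^ 16 * real q powr (1/16)) * (3 / real q) / real q ^ 16"
      using 1 by (intro divide_right_mono) auto
    also have "\<dots> = 3 * C * (real q powr (1/16) / real q)" using q by simp
    also have "real q powr (1/16) / real q = real q powr (1/16 - 1)"
      using q powr_diff[of "real q" "1/16" 1] by simp
    finally have 2: "z ^ 16 \<le> 3 * C * real q powr (- 15/16)" by simp
    have "z ^ 37 = (z ^ 16) powr (37/16)"
      using z0 by (cases "z = 0") (simp_all add: powr_powr flip: powr_numeral)
    also have "\<dots> \<le> (3 * C * real q powr (- 15/16)) powr (37/16)"
      using 2 z0 by (intro powr_mono2) auto
    also have "\<dots> = (3 * C) powr (37/16) * real q powr (- 555/256)"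
      using C q by (simp add: powr_mult powr_powr)
    finally show ?thesis by (simp add: z_def)
  qed
  moreover have "(3 * C) powr (37/16) > 0" using C by simp
  ultimately show ?thesis by blast
qed

section \<open>Major arcs\<close>

definition value_poly :: "(nat \<Rightarrow> nat) \<Rightarrow> nat \<Rightarrow> real poly" where
  "value_poly g P = (\<Sum>i<P. monom 1 (g i))"

text \<open>The unit mass at \<open>g i\<close> is spread evenly over the gap up to \<open>g (Suc i)\<close>. The result has almost the same
  Fourier transform near 0 as \<open>value_poly\<close>, but, its coefficients being monotone, decays away from 0.\<close>
definition density_poly :: "(nat \<Rightarrow> nat) \<Rightarrow> nat \<Rightarrow> real poly" where
  "density_poly g P = (\<Sum>i<P. \<Sum>m\<in>{g i..<g (Suc i)}. monom (1 / real (g (Suc i) - g i)) m)"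

lemma trig_value_poly: "trig (value_poly g P) \<alpha> = (\<Sum>i<P. unit_exp (\<alpha> * real (g i)))"
  by (simp add: value_poly_def trig_sum trig_monom)

lemma trig_density_poly: "trig (density_poly g P) \<alpha> = (\<Sum>i<P. of_real (1 / real (g (Suc i) - g i)) * (\<Sum>m\<in>{g i..<g (Suc i)}. unit_exp (\<alpha> * real m)))"
  unfolding density_poly_def trig_sum trig_monom by (simp add: sum_distrib_left)

lemma coeff_value_poly_neq_0: "coeff (value_poly g P) m \<noteq> 0 \<Longrightarrow> \<exists>i<P. m = g i"
  unfolding value_poly_def coeff_sum by (metis (mono_tags, lifting) coeff_monom lessThan_iff sum.neutral)

lemma coeff_density_poly: "coeff (density_poly g P) m = (\<Sum>i<P. if m \<in> {g i..<g (Suc i)} then 1 / real (g (Suc i) - g i) else 0)"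
  unfolding density_poly_def coeff_sum coeff_monom by (intro sum.cong refl) (simp add: sum.delta)

lemma coeff_density_poly_nonneg: "coeff (density_poly g P) m \<ge> 0"
  unfolding coeff_density_poly by (intro sum_nonneg) auto

text \<open>Summation by parts: for decreasing nonnegative weights the total variation telescopes to
  at most \<open>w 0\<close>.\<close>

lemma abel_bound:
  fixes w :: "nat \<Rightarrow> real" and E :: "nat \<Rightarrow> complex"
  assumes "\<And>i. w i \<ge> 0" "\<And>i. w (Suc i) \<le> w i" "\<And>i. norm (E i) \<le> 1"
  shows "norm (\<Sum>i<n. of_real (w i) * (E (Suc i) - E i)) \<le> 2 * w 0"
proof -
    have eq: "(\<Sum>i<n. of_real (w i) * (E (Suc i) - E i)) = of_real (w n) * E n - of_real (w 0) * E 0 + (\<Sum>i<n. of_real (w i - w (Suc i)) * E (Suc i))"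
      by (induction n) (simp_all add: algebra_simps)
    have "norm (\<Sum>i<n. of_real (w i - w (Suc i)) * E (Suc i)) \<le> (\<Sum>i<n. w i - w (Suc i))"
    proof (rule sum_norm_le)
      fix i
      have "norm (of_real (w i - w (Suc i)) * E (Suc i)) = (w i - w (Suc i)) * norm (E (Suc i))"
        unfolding norm_mult norm_of_real using assms(2)[of i] by simp
      also have "\<dots> \<le> (w i - w (Suc i)) * 1" using assms(2,3) by (intro mult_left_mono) auto
      finally show "norm (of_real (w i - w (Suc i)) * E (Suc i)) \<le> w i - w (Suc i)" by simp
    qed
    also have "\<dots> = w 0 - w n" by (induction n) auto
    finally have 1: "norm (\<Sum>i<n. of_real (w i - w (Suc i)) * E (Suc i)) \<le> w 0 - w n" .
    have 2: "norm (of_real (w i) * E i) \<le> w i" for i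
      using assms(1)[of i] assms(3)[of i] mult_left_mono[of "norm (E i)" 1 "w i"] by (simp add: norm_mult)
    show ?thesis unfolding eq
      using norm_triangle_ineq[of "of_real (w n) * E n - of_real (w 0) * E 0" "\<Sum>i<n. of_real (w i - w (Suc i)) * E (Suc i)"]
        norm_triangle_ineq4[of "of_real (w n) * E n" "of_real (w 0) * E 0"] 1 2[of n] 2[of 0] by linarith
  qed

section \<open>The density of a convex sequence whose gaps lie between \<open>A\<close> and
  \<open>B\<close>\<close>

context
  fixes g :: "nat \<Rightarrow> nat" and P :: nat and A B :: real
  assumes smono: "strict_mono g" and A0: "A > 0"
    and A: "\<And>i. i < P \<Longrightarrow> A \<le> real (g (Suc i) - g i)"
    and B: "\<And>i. i < P \<Longrightarrow> real (g (Suc i) - g i) \<le> B"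
    and conv: "\<And>i. g (Suc i) - g i \<le> g (Suc (Suc i)) - g (Suc i)"
begin

lemma g_mono: "i \<le> j \<Longrightarrow> g i \<le> g j"
  using smono by (simp add: strict_mono_less_eq)

lemma g_Suc: "g i < g (Suc i)"
  using smono by (simp add: strict_mono_Suc_iff)

lemma coeff_density_poly_eq:
  assumes "i < P" "m \<in> {g i..<g (Suc i)}"
  shows "coeff (density_poly g P) m = 1 / real (g (Suc i) - g i)"
proof -
  have "coeff (density_poly g P) m = (\<Sum>j<P. if j = i then 1 / real (g (Suc i) - g i) else 0)"
    unfolding coeff_density_poly
  proof (intro sum.cong refl)
    fix j
    have "m \<in> {g j..<g (Suc j)} \<longleftrightarrow> j = i"
    proof
      assume m: "m \<in> {g j..<g (Suc j)}"
      have "\<not> i < j" using g_mono[of "Suc i" j] m assms by auto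
      moreover have "\<not> j < i" using g_mono[of "Suc j" i] m assms by auto
      ultimately show "j = i" by simp
    qed (use assms in auto)
    then show "(if m \<in> {g j..<g (Suc j)} then 1 / real (g (Suc j) - g j) else 0) = (if j = i then 1 / real (g (Suc i) - g i) else 0)"
      by auto
  qed
  then show ?thesis using assms by simp
qed

lemma g_interval: 
  assumes "g 0 \<le> m" "m < g P"
  shows "\<exists>i<P. m \<in> {g i..<g (Suc i)}"
proof -
  have "P > 0" using assms by (cases P) auto
  define i where "i = (LEAST i. m < g (Suc i))"
  have below: "m < g (Suc (P - 1))" using assms \<open>P > 0\<close> by simp
  have 1: "m < g (Suc i)" unfolding i_def by (rule LeastI[of "\<lambda>i. m < g (Suc i)", OF below])
  have 2: "i \<le> P - 1" unfolding i_def by (rule Least_le) (rule below)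
  have 3: "g i \<le> m"
  proof (cases i)
    case (Suc j)
    then have "\<not> m < g (Suc j)" using not_less_Least[of j "\<lambda>i. m < g (Suc i)"] by (simp add: i_def)
    then show ?thesis using Suc by simp
  qed (use assms in simp)
  show ?thesis using 1 2 3 \<open>P > 0\<close> by (intro exI[of _ i]) auto
qed

lemma coeff_density_poly_ge: 
  assumes "g 0 \<le> m" "m < g P" 
  shows "coeff (density_poly g P) m \<ge> 1 / B"
proof -
  obtain i where i: "i < P" "m \<in> {g i..<g (Suc i)}" using g_interval[OF assms] by blast
  show ?thesis unfolding coeff_density_poly_eq[OF i] using A[OF i(1)] B[OF i(1)] A0 by (intro divide_left_mono) auto
qed

lemma coeff_density_poly_le: "coeff (density_poly g P) m \<le> 1 / A"
proof (cases "\<exists>i<P. m \<in> {g i..<g (Suc i)}")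
  case True
  then obtain i where i: "i < P" "m \<in> {g i..<g (Suc i)}" by blast
  show ?thesis unfolding coeff_density_poly_eq[OF i] using A[OF i(1)] A0 by (intro divide_left_mono) auto
next
  case False
  then have "coeff (density_poly g P) m = 0" unfolding coeff_density_poly by (intro sum.neutral) auto
  then show ?thesis using A0 by simp
qed

lemma sum_coeff_density_poly:
  assumes "g P \<le> T"
  shows "(\<Sum>m<T. coeff (density_poly g P) m) = real P"
proof -
  have "(\<Sum>m<T. coeff (density_poly g P) m) = (\<Sum>i<P. \<Sum>m<T. if m \<in> {g i..<g (Suc i)} then 1 / real (g (Suc i) - g i) else 0)"
    unfolding coeff_density_poly by (rule sum.swap)
  also have "\<dots> = (\<Sum>i<P. 1)"
  proof (intro sum.cong refl)
    fix i assume "i \<in> {..<P}"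
    then have "{..<T} \<inter> {g i..<g (Suc i)} = {g i..<g (Suc i)}"
      using g_mono[of "Suc i" P] assms by auto
    then have "(\<Sum>m<T. if m \<in> {g i..<g (Suc i)} then 1 / real (g (Suc i) - g i) else 0) = (\<Sum>m\<in>{g i..<g (Suc i)}. 1 / real (g (Suc i) - g i))"
      by (subst sum.inter_restrict[symmetric]) auto
    also have "\<dots> = 1" using g_Suc[of i] by simp
    finally show "(\<Sum>m<T. if m \<in> {g i..<g (Suc i)} then 1 / real (g (Suc i) - g i) else 0) = 1" .
  qed
  finally show ?thesis by simp
qed

lemma sum_coeff_density_poly_sq:
  assumes "g P \<le> T"
  shows "(\<Sum>m<T. coeff (density_poly g P) m ^ 2) \<le> real P / A"
proof -
  have "(\<Sum>m<T. coeff (density_poly g P) m ^ 2) \<le> (\<Sum>m<T. 1 / A * coeff (density_poly g P) m)"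
    unfolding power2_eq_square by (intro sum_mono mult_right_mono coeff_density_poly_le coeff_density_poly_nonneg)
  also have "\<dots> = 1 / A * real P" unfolding sum_distrib_left[symmetric] sum_coeff_density_poly[OF assms] ..
  finally show ?thesis by simp
qed

lemma degree_value_poly: "degree (value_poly g P) \<le> g P"
  unfolding value_poly_def
proof (rule degree_sum_le)
  fix i assume "i \<in> {..<P}"
  then show "degree (monom (1::real) (g i)) \<le> g P" using degree_monom_le[of "1::real" "g i"] g_mono[of i P] by simp
qed simp

lemma degree_density_poly: "degree (density_poly g P) \<le> g P"
  unfolding density_poly_def
proof (intro degree_sum_le)
  fix i m assume "i \<in> {..<P}" "m \<in> {g i..<g (Suc i)}"
  then have "m \<le> g P" using g_mono[of "Suc i" P] by simp
  then show "degree (monom (1 / real (g (Suc i) - g i)) m) \<le> g P"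
    using degree_monom_le[of "1 / real (g (Suc i) - g i)" m] by simp
qed simp_all

lemma norm_trig_density_poly_le: "norm (trig (density_poly g P) \<alpha>) \<le> real P"
proof -
  have "norm (trig (density_poly g P) \<alpha>) \<le> (\<Sum>i<P. norm (of_real (1 / real (g (Suc i) - g i)) * (\<Sum>m\<in>{g i..<g (Suc i)}. unit_exp (\<alpha> * real m))))"
    unfolding trig_density_poly by (rule norm_sum)
  also have "\<dots> \<le> (\<Sum>i<P. 1)"
  proof (rule sum_mono)
    fix i
    have "norm (\<Sum>m\<in>{g i..<g (Suc i)}. unit_exp (\<alpha> * real m)) \<le> real (g (Suc i) - g i)"
      using norm_sum[of "\<lambda>m. unit_exp (\<alpha> * real m)" "{g i..<g (Suc i)}"] by simp
    then have "1 / real (g (Suc i) - g i) * norm (\<Sum>m\<in>{g i..<g (Suc i)}. unit_exp (\<alpha> * real m)) \<le> 1 / real (g (Suc i) - g i) * real (g (Suc i) - g i)"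
      by (rule mult_left_mono) simp
    also have "\<dots> = 1" using g_Suc[of i] by simp
    finally show "norm (of_real (1 / real (g (Suc i) - g i)) * (\<Sum>m\<in>{g i..<g (Suc i)}. unit_exp (\<alpha> * real m))) \<le> 1"
      by (simp add: norm_mult norm_divide)
  qed
  finally show ?thesis by simp
qed

lemma telescope: "(\<Sum>i<n. real (g (Suc i)) - real (g i)) = real (g n) - real (g 0)"
  by (rule sum_lessThan_telescope)

text \<open>Each unit mass is moved only within its own gap, which changes its phase by at most
  \<open>2 * pi * \<bar>\<beta>\<bar>\<close> times the gap; the gaps telescope.\<close>

lemma value_poly_density_poly_diff:
  "norm (trig (value_poly g P) \<beta> - trig (density_poly g P) \<beta>) \<le> 2 * pi * \<bar>\<beta>\<bar> * (real (g P) - real (g 0))"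
proof -
  have "norm (trig (value_poly g P) \<beta> - trig (density_poly g P) \<beta>) = norm (\<Sum>i<P. unit_exp (\<beta> * real (g i)) - of_real (1 / real (g (Suc i) - g i)) * (\<Sum>m\<in>{g i..<g (Suc i)}. unit_exp (\<beta> * real m)))"
    by (simp add: trig_value_poly trig_density_poly sum_subtractf)
  also have "\<dots> \<le> (\<Sum>i<P. 2 * pi * \<bar>\<beta>\<bar> * (real (g (Suc i)) - real (g i)))"
  proof (rule sum_norm_le)
    fix i
    define D where "D = real (g (Suc i) - g i)"
    have D: "D > 0" "D = real (g (Suc i)) - real (g i)" using g_Suc[of i] by (auto simp: D_def of_nat_diff)
    have card: "of_nat (card {g i..<g (Suc i)}) = complex_of_real D" by (simp add: D_def)
    have "unit_exp (\<beta> * real (g i)) - of_real (1 / D) * (\<Sum>m\<in>{g i..<g (Suc i)}. unit_exp (\<beta> * real m))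
       = of_real (1 / D) * (\<Sum>m\<in>{g i..<g (Suc i)}. unit_exp (\<beta> * real (g i)) - unit_exp (\<beta> * real m))"
      unfolding sum_subtractf sum_constant card using D(1) by (simp add: field_simps)
    also have "norm \<dots> \<le> 1 / D * (\<Sum>m\<in>{g i..<g (Suc i)}. norm (unit_exp (\<beta> * real (g i)) - unit_exp (\<beta> * real m)))"
      unfolding norm_mult using D(1) by (intro mult_mono norm_sum) (auto simp: norm_divide)
    also have "\<dots> \<le> 1 / D * (\<Sum>m\<in>{g i..<g (Suc i)}. 2 * pi * \<bar>\<beta>\<bar> * D)"
    proof (intro mult_left_mono sum_mono)
      fix m assume m: "m \<in> {g i..<g (Suc i)}"
      have "norm (unit_exp (\<beta> * real (g i)) - unit_exp (\<beta> * real m)) \<le> 2 * pi * \<bar>\<beta> * real (g i) - \<beta> * real m\<bar>"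
        by (rule norm_unit_exp_diff_le)
      also have "\<bar>\<beta> * real (g i) - \<beta> * real m\<bar> = \<bar>\<beta>\<bar> * (real m - real (g i))"
        using m by (simp add: abs_mult flip: right_diff_distrib)
      also have "\<dots> \<le> \<bar>\<beta>\<bar> * D" using m D(2) by (intro mult_left_mono) auto
      finally show "norm (unit_exp (\<beta> * real (g i)) - unit_exp (\<beta> * real m)) \<le> 2 * pi * \<bar>\<beta>\<bar> * D" by simp
    qed (use D in auto)
    also have "\<dots> = 2 * pi * \<bar>\<beta>\<bar> * D" using D(1) by (simp add: D_def)
    finally show "norm (unit_exp (\<beta> * real (g i)) - of_real (1 / real (g (Suc i) - g i)) * (\<Sum>m\<in>{g i..<g (Suc i)}. unit_exp (\<beta> * real m)))
       \<le> 2 * pi * \<bar>\<beta>\<bar> * (real (g (Suc i)) - real (g i))"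
      using D(2) by (simp add: D_def)
  qed
  also have "\<dots> = 2 * pi * \<bar>\<beta>\<bar> * (real (g P) - real (g 0))"
    by (simp only: telescope flip: sum_distrib_left)
  finally show ?thesis .
qed

text \<open>Multiplication by \<open>1 - unit_exp \<beta>\<close> collapses the geometric sum over
  each gap to a difference of consecutive \<open>E i\<close>. By convexity the reciprocal gaps
  decrease, so \<open>abel_bound\<close> applies and only the first one, at most
  \<open>1 / A\<close>, survives.\<close>

lemma density_poly_decay:
  assumes dist_int: "dist_int \<beta> > 0" and P: "P > 0"
  shows "norm (trig (density_poly g P) \<beta>) \<le> 1 / (A * dist_int \<beta>)"
proof -
  define w where "w i = 1 / real (g (Suc i) - g i)" for i
  define E where "E i = unit_exp (\<beta> * real (g i))" for i
  have ne: "unit_exp \<beta> \<noteq> 1" using norm_1_minus_unit_exp[of \<beta>] dist_int by auto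
  have geo: "(1 - z) * (\<Sum>m\<in>{a..<b}. z ^ m) = z ^ a - z ^ b" if "a \<le> b" for a b and z :: complex
    using that
  proof (induction b rule: dec_induct)
    case (step n)
    have "(1 - z) * (\<Sum>m\<in>{a..<Suc n}. z ^ m) = (1 - z) * (\<Sum>m\<in>{a..<n}. z ^ m) + (1 - z) * z ^ n"
      using step.hyps by (simp add: distrib_left)
    then show ?case unfolding step.IH by (simp add: left_diff_distrib)
  qed simp
  have inner: "(1 - unit_exp \<beta>) * (\<Sum>m\<in>{g i..<g (Suc i)}. unit_exp (\<beta> * real m)) = - (E (Suc i) - E i)" for i
  proof -
    have "(\<Sum>m\<in>{g i..<g (Suc i)}. unit_exp (\<beta> * real m)) = (\<Sum>m\<in>{g i..<g (Suc i)}. unit_exp \<beta> ^ m)"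
      by (simp add: unit_exp_mult_nat[symmetric] mult.commute)
    then have "(1 - unit_exp \<beta>) * (\<Sum>m\<in>{g i..<g (Suc i)}. unit_exp (\<beta> * real m)) = unit_exp \<beta> ^ g i - unit_exp \<beta> ^ g (Suc i)"
      using geo[of "g i" "g (Suc i)" "unit_exp \<beta>"] g_Suc[of i] by simp
    then show ?thesis by (simp add: E_def unit_exp_mult_nat[symmetric] mult.commute)
  qed
  have "(1 - unit_exp \<beta>) * trig (density_poly g P) \<beta> = - (\<Sum>i<P. of_real (w i) * (E (Suc i) - E i))"
  proof -
    have "(1 - unit_exp \<beta>) * trig (density_poly g P) \<beta> = (\<Sum>i<P. of_real (w i) * ((1 - unit_exp \<beta>) * (\<Sum>m\<in>{g i..<g (Suc i)}. unit_exp (\<beta> * real m))))"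
      unfolding trig_density_poly sum_distrib_left w_def by (intro sum.cong refl) (simp only: mult.left_commute)
    then show ?thesis unfolding inner mult_minus_right sum_negf .
  qed
  then have "norm (1 - unit_exp \<beta>) * norm (trig (density_poly g P) \<beta>) = norm (\<Sum>i<P. of_real (w i) * (E (Suc i) - E i))"
    by (metis norm_minus_cancel norm_mult)
  also have "\<dots> \<le> 2 * w 0"
  proof (rule abel_bound)
    show "w (Suc i) \<le> w i" for i
      unfolding w_def using conv[of i] g_Suc[of i] by (intro divide_left_mono) auto
  qed (auto simp: w_def E_def)
  also have "w 0 \<le> 1 / A" unfolding w_def using A[OF P] A0 by (intro divide_left_mono) auto
  finally have 1: "norm (1 - unit_exp \<beta>) * norm (trig (density_poly g P) \<beta>) \<le> 2 / A" by simp
  have "2 * dist_int \<beta> * norm (trig (density_poly g P) \<beta>) \<le> norm (1 - unit_exp \<beta>) * norm (trig (density_poly g P) \<beta>)"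
    by (intro mult_right_mono norm_1_minus_unit_exp) auto
  with 1 have "2 * dist_int \<beta> * norm (trig (density_poly g P) \<beta>) \<le> 2 / A" by linarith
  then show ?thesis using dist_int A0 by (simp add: field_simps)
qed

text \<open>On a block of length \<open>q\<close> the smooth phase is frozen at the left end, and
  \<open>F\<close> sums to \<open>S\<close>. The freezing errors telescope over the blocks, and the
  incomplete last block costs at most \<open>q\<close>.\<close>

lemma block_approx:
  fixes F :: "nat \<Rightarrow> complex"
  assumes F: "\<And>i. norm (F i) \<le> 1" and S: "\<And>k. (\<Sum>i\<in>{k * q..<k * q + q}. F i) = S" and q: "q > 0"
  shows "norm ((\<Sum>i<P. F i * unit_exp (\<beta> * real (g i))) - S * (\<Sum>k<P div q. unit_exp (\<beta> * real (g (k * q)))))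
     \<le> real q + 2 * pi * \<bar>\<beta>\<bar> * real q * (real (g P) - real (g 0))"
proof -
  define n where "n = P div q"
  have nq: "n * q \<le> P" "P < n * q + q" using q div_mult_mod_eq[of P q] mod_less_divisor[OF q, of P] unfolding n_def by linarith+
  define h where "h i = F i * unit_exp (\<beta> * real (g i))" for i
  have split: "(\<Sum>i<P. h i) = (\<Sum>i<n * q. h i) + (\<Sum>i\<in>{n * q..<P}. h i)"
    using nq(1) by (metis atLeast0LessThan le0 sum.atLeastLessThan_concat)
  have "norm (\<Sum>i\<in>{n * q..<P}. h i) \<le> (\<Sum>i\<in>{n * q..<P}. 1)"
    by (rule sum_norm_le) (simp add: h_def norm_mult F)
  also have "\<dots> \<le> real q"
  proof -
    have "P - n * q \<le> q" using nq by linarith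
    then have "real (P - n * q) \<le> real q" by (rule of_nat_mono)
    then show ?thesis by (simp only: sum_constant card_atLeastLessThan mult_1_right)
  qed
  finally have rest: "norm (\<Sum>i\<in>{n * q..<P}. h i) \<le> real q" .
  have "norm ((\<Sum>i<n * q. h i) - S * (\<Sum>k<n. unit_exp (\<beta> * real (g (k * q))))) = norm (\<Sum>k<n. (\<Sum>i\<in>{k * q..<k * q + q}. h i) - S * unit_exp (\<beta> * real (g (k * q))))"
    by (simp add: sum.nat_group[symmetric] sum_subtractf sum_distrib_left)
  also have "\<dots> \<le> (\<Sum>k<n. 2 * pi * \<bar>\<beta>\<bar> * real q * (real (g (Suc k * q)) - real (g (k * q))))"
  proof (rule sum_norm_le)
    fix k
    have "(\<Sum>i\<in>{k * q..<k * q + q}. h i) - S * unit_exp (\<beta> * real (g (k * q))) 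
       = (\<Sum>i\<in>{k * q..<k * q + q}. F i * (unit_exp (\<beta> * real (g i)) - unit_exp (\<beta> * real (g (k * q)))))"
      by (simp add: h_def S[of k, symmetric] right_diff_distrib sum_subtractf sum_distrib_right)
    also have "norm \<dots> \<le> (\<Sum>i\<in>{k * q..<k * q + q}. 2 * pi * \<bar>\<beta>\<bar> * (real (g (Suc k * q)) - real (g (k * q))))"
    proof (rule sum_norm_le)
      fix i assume i: "i \<in> {k * q..<k * q + q}"
      have g: "g (k * q) \<le> g i" "g i \<le> g (Suc k * q)" using i by (auto intro!: g_mono)
      have "norm (F i * (unit_exp (\<beta> * real (g i)) - unit_exp (\<beta> * real (g (k * q))))) \<le> 1 * norm (unit_exp (\<beta> * real (g i)) - unit_exp (\<beta> * real (g (k * q))))"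
        unfolding norm_mult by (intro mult_right_mono F) auto
      also have "\<dots> \<le> 2 * pi * \<bar>\<beta> * real (g i) - \<beta> * real (g (k * q))\<bar>"
        using norm_unit_exp_diff_le by simp
      also have "\<bar>\<beta> * real (g i) - \<beta> * real (g (k * q))\<bar> = \<bar>\<beta>\<bar> * (real (g i) - real (g (k * q)))"
        using g by (simp add: abs_mult flip: right_diff_distrib)
      also have "\<dots> \<le> \<bar>\<beta>\<bar> * (real (g (Suc k * q)) - real (g (k * q)))"
        using g by (intro mult_left_mono) auto
      finally show "norm (F i * (unit_exp (\<beta> * real (g i)) - unit_exp (\<beta> * real (g (k * q))))) \<le> 2 * pi * \<bar>\<beta>\<bar> * (real (g (Suc k * q)) - real (g (k * q)))"
        by simp
    qed
    also have "\<dots> = 2 * pi * \<bar>\<beta>\<bar> * real q * (real (g (Suc k * q)) - real (g (k * q)))" by simp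
    finally show "norm ((\<Sum>i\<in>{k * q..<k * q + q}. h i) - S * unit_exp (\<beta> * real (g (k * q)))) \<le> 2 * pi * \<bar>\<beta>\<bar> * real q * (real (g (Suc k * q)) - real (g (k * q)))" .
  qed
  also have "\<dots> = 2 * pi * \<bar>\<beta>\<bar> * real q * (real (g (n * q)) - real (g 0))"
    using sum_lessThan_telescope[of "\<lambda>k. real (g (k * q))" n] by (simp only: flip: sum_distrib_left) simp
  also have "\<dots> \<le> 2 * pi * \<bar>\<beta>\<bar> * real q * (real (g P) - real (g 0))"
    using g_mono[OF nq(1)] by (intro mult_left_mono) auto
  finally have main: "norm ((\<Sum>i<n * q. h i) - S * (\<Sum>k<n. unit_exp (\<beta> * real (g (k * q))))) \<le> 2 * pi * \<bar>\<beta>\<bar> * real q * (real (g P) - real (g 0))" .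
  show ?thesis
    unfolding h_def[symmetric] n_def[symmetric] split
    using norm_triangle_ineq[of "(\<Sum>i<n * q. h i) - S * (\<Sum>k<n. unit_exp (\<beta> * real (g (k * q))))" "\<Sum>i\<in>{n * q..<P}. h i"] main rest
    by (simp add: algebra_simps)
qed

text \<open>\<open>block_approx\<close> is applied to \<open>F\<close> and to the constant 1. Both
  produce the same block sum \<open>W\<close>, which is eliminated; so the twisted sum is compared
  with \<open>value_poly\<close> itself and \<open>W\<close> need not be evaluated.\<close>

lemma major_bound:
  fixes F :: "nat \<Rightarrow> complex"
  assumes F: "\<And>i. norm (F i) \<le> 1" and S: "\<And>k. (\<Sum>i\<in>{k * q..<k * q + q}. F i) = S" and q: "q > 0"
    and Sq: "norm S \<le> real q"
  shows "norm (\<Sum>i<P. F i * unit_exp (\<beta> * real (g i)))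
     \<le> norm S / real q * norm (trig (value_poly g P) \<beta>) + 2 * (real q + 2 * pi * \<bar>\<beta>\<bar> * real q * (real (g P) - real (g 0)))"
proof -
  define W where "W = (\<Sum>k<P div q. unit_exp (\<beta> * real (g (k * q))))"
  define R where "R = real q + 2 * pi * \<bar>\<beta>\<bar> * real q * (real (g P) - real (g 0))"
  have 1: "norm ((\<Sum>i<P. F i * unit_exp (\<beta> * real (g i))) - S * W) \<le> R"
    unfolding W_def R_def by (rule block_approx[OF F S q])
  have "norm ((\<Sum>i<P. 1 * unit_exp (\<beta> * real (g i))) - of_nat q * W) \<le> R"
    unfolding W_def R_def by (rule block_approx[OF _ _ q]) auto
  then have 2: "norm (trig (value_poly g P) \<beta> - of_nat q * W) \<le> R" by (simp add: trig_value_poly)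
  have "real q * norm W = norm (of_nat q * W)" by (simp add: norm_mult)
  also have "\<dots> \<le> norm (trig (value_poly g P) \<beta>) + R"
    using norm_triangle_ineq3[of "trig (value_poly g P) \<beta>" "of_nat q * W"] 2 by linarith
  finally have "norm W \<le> (norm (trig (value_poly g P) \<beta>) + R) / real q"
    using q by (simp add: field_simps)
  then have "norm S * norm W \<le> norm S * ((norm (trig (value_poly g P) \<beta>) + R) / real q)"
    by (intro mult_left_mono) auto
  also have "\<dots> = norm S / real q * norm (trig (value_poly g P) \<beta>) + norm S / real q * R"
    by (simp add: field_simps add_divide_distrib)
  also have "norm S / real q * R \<le> 1 * R"
  proof (rule mult_right_mono)
    show "norm S / real q \<le> 1" using Sq q by (simp add: field_simps)
    show "0 \<le> R" using norm_ge_zero order_trans 1 by blast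
  qed
  finally have 3: "norm (S * W) \<le> norm S / real q * norm (trig (value_poly g P) \<beta>) + R" by (simp add: norm_mult)
  have "norm (\<Sum>i<P. F i * unit_exp (\<beta> * real (g i))) \<le> norm (S * W) + norm ((\<Sum>i<P. F i * unit_exp (\<beta> * real (g i))) - S * W)"
    using norm_triangle_ineq[of "S * W" "(\<Sum>i<P. F i * unit_exp (\<beta> * real (g i))) - S * W"] by simp
  moreover define M where "M = norm S / real q * norm (trig (value_poly g P) \<beta>)"
  ultimately show ?thesis using 1 3 unfolding R_def[symmetric] M_def[symmetric] by linarith
qed

end

section \<open>Sums of fifth powers in residue classes\<close>

lemma card_residue_class_ge:
  fixes y :: real and \<rho> :: nat
  assumes M: "M \<ge> (1 :: nat)" and y: "y \<ge> 8 * real M"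
  defines "A \<equiv> {x :: nat. y / 2 \<le> real x \<and> real x \<le> y \<and> x mod M = \<rho> mod M}"
  shows "finite A" "real (card A) \<ge> y / (4 * real M)"
proof -
  have "A \<subseteq> {..nat \<lfloor>y\<rfloor>}" by (auto simp: A_def le_nat_floor)
  then show fin: "finite A" using finite_subset by blast
  define K where "K = {nat \<lceil>y / (2 * real M)\<rceil>..nat \<lfloor>y / real M - 1\<rfloor>}"
  have z1: "y / (2 * real M) \<ge> 4" using y M by (simp add: field_simps)
  have z2: "y / real M - 1 \<ge> 7" using y M by (simp add: field_simps)
  have sub: "(\<lambda>k. M * k + \<rho> mod M) ` K \<subseteq> A"
  proof safe
    fix k assume k: "k \<in> K"
    have k1: "y / (2 * real M) \<le> real k" using k z1 unfolding K_def atLeastAtMost_iff by linarith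
    have k2: "real k \<le> y / real M - 1" using k z2 unfolding K_def atLeastAtMost_iff by linarith
    have "y / 2 \<le> real M * real k" using k1 M by (simp add: field_simps)
    moreover have "real M * real k \<le> y - real M" using k2 M by (simp add: field_simps)
    moreover have "real (\<rho> mod M) \<le> real M" using M by simp
    ultimately show "M * k + \<rho> mod M \<in> A" by (auto simp: A_def)
  qed
  have inj: "inj_on (\<lambda>k. M * k + \<rho> mod M) K" using M by (auto intro!: inj_onI)
  have "card K \<le> card A"
    using card_mono[OF fin sub] card_image[OF inj] by simp
  moreover have "real (card K) \<ge> y / (2 * real M) - 2"
  proof -
    have "card K = Suc (nat \<lfloor>y / real M - 1\<rfloor>) - nat \<lceil>y / (2 * real M)\<rceil>" by (simp add: K_def)
    moreover have "real (nat \<lfloor>y / real M - 1\<rfloor>) \<ge> y / real M - 2" using z2 by linarith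
    moreover have "real (nat \<lceil>y / (2 * real M)\<rceil>) \<le> y / (2 * real M) + 1" using z1 by linarith
    moreover have "y / real M = 2 * (y / (2 * real M))" by simp
    ultimately show ?thesis by linarith
  qed
  moreover have "y / (2 * real M) = 2 * (y / (4 * real M))" by simp
  moreover have "y / (4 * real M) \<ge> 2" using y M by (simp add: field_simps)
  ultimately show "real (card A) \<ge> y / (4 * real M)" by linarith
qed

lemma fifth_power_gap:
  fixes x y :: real
  assumes "0 \<le> x" "x + 1 \<le> y"
  shows "x ^ 5 + 5 * x ^ 4 \<le> y ^ 5"
proof -
  have "(x + 1) ^ 5 = x ^ 5 + 5 * x ^ 4 + 10 * x ^ 3 + 10 * x ^ 2 + 5 * x + 1" by algebra
  moreover have "10 * x ^ 3 + 10 * x ^ 2 + 5 * x + 1 \<ge> 0" using assms by simp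
  moreover have "(x + 1) ^ 5 \<le> y ^ 5" using assms by (intro power_mono) auto
  ultimately show ?thesis by linarith
qed

text \<open>Diminishing ranges: the largest base \<open>x\<close> runs over \<open>y / 2\<close> to
  \<open>y\<close> with \<open>y ^ 5 = X / 2\<close>, and the remaining sum is kept below
  \<open>(y / 2) ^ 4\<close>. This is less than the gap of at least \<open>5 * x ^ 4\<close> to the
  next fifth power, so all the sums are distinct. The new exponent is \<open>1/5 + 4/5 * e\<close>,
  that is, the deficit from 1 is multiplied by \<open>4/5\<close>.\<close>

lemma many_sums_of_fifth_powers:
  fixes \<rho> :: "nat \<Rightarrow> nat"
  assumes M: "M \<ge> (1 :: nat)"
  shows "\<exists>c>0. \<exists>X0. \<forall>X\<ge>X0. \<exists>S. finite S \<and> (\<forall>u\<in>S. real u \<le> X) \<and> real (card S) \<ge> c * X powr (1 - (4/5) ^ r) \<and>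
     (\<forall>u\<in>S. \<exists>x. (\<forall>j<r. x j > 0 \<and> x j mod M = \<rho> j mod M) \<and> u = (\<Sum>j<r. x j ^ 5))"
proof (induction r)
  case 0
  show ?case
  proof (rule exI[of _ "1::real"], rule conjI, simp, rule exI[of _ "1::real"], intro allI impI)
    fix X :: real assume "X \<ge> 1"
    then show "\<exists>S. finite S \<and> (\<forall>u\<in>S. real u \<le> X) \<and> real (card S) \<ge> 1 * X powr (1 - (4/5) ^ 0) \<and>
     (\<forall>u\<in>S. \<exists>x. (\<forall>j<0. x j > 0 \<and> x j mod M = \<rho> j mod M) \<and> u = (\<Sum>j<0. x j ^ 5))"
      by (intro exI[of _ "{0}"]) auto
  qed
next
  case (Suc r)
  define e where "e = 1 - (4/5 :: real) ^ r"
  obtain c X0 where c: "c > 0" and IH: "\<And>X. X \<ge> X0 \<Longrightarrow> \<exists>S. finite S \<and> (\<forall>u\<in>S. real u \<le> X) \<and> real (card S) \<ge> c * X powr e \<and>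
     (\<forall>u\<in>S. \<exists>x. (\<forall>j<r. x j > 0 \<and> x j mod M = \<rho> j mod M) \<and> u = (\<Sum>j<r. x j ^ 5))"
    using Suc.IH unfolding e_def by blast
  define k where "k = (1/16) * (1/2 :: real) powr (4/5)"
  define c' where "c' = (1 / (4 * real M)) * (1/2) powr (1/5) * (c * k powr e)"
  have lim1: "eventually (\<lambda>X. (X / 2) powr (1/5) \<ge> 8 * real M) at_top"
    by real_asymp
  have lim2: "eventually (\<lambda>X. ((X / 2) powr (1/5) / 2) ^ 4 \<ge> X0) at_top"
    by real_asymp
  have "eventually (\<lambda>X. X \<ge> (1 :: real) \<and> (X / 2) powr (1/5) \<ge> 8 * real M \<and> ((X / 2) powr (1/5) / 2) ^ 4 \<ge> X0) at_top"
    by (intro eventually_conj lim1 lim2 eventually_ge_at_top)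
  then obtain X1 where X1: "\<And>X. X \<ge> X1 \<Longrightarrow> X \<ge> 1 \<and> (X / 2) powr (1/5) \<ge> 8 * real M \<and> ((X / 2) powr (1/5) / 2) ^ 4 \<ge> X0"
    unfolding eventually_at_top_linorder by blast
  have "\<exists>S. finite S \<and> (\<forall>u\<in>S. real u \<le> X) \<and> real (card S) \<ge> c' * X powr (1 - (4/5) ^ Suc r) \<and>
     (\<forall>u\<in>S. \<exists>x. (\<forall>j<Suc r. x j > 0 \<and> x j mod M = \<rho> j mod M) \<and> u = (\<Sum>j<Suc r. x j ^ 5))" if X: "X \<ge> X1" for X
  proof -
    define y where "y = (X / 2) powr (1/5)"
    define X' where "X' = (y / 2) ^ 4"
    have X_1: "X \<ge> 1" and y8: "y \<ge> 8 * real M" and X'0: "X' \<ge> X0"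
      using X1[OF X] by (auto simp: y_def X'_def)
    have y1: "y \<ge> 8" using y8 M by (smt (verit) of_nat_1 of_nat_mono)
    have y5: "y ^ 5 = X / 2"
      unfolding y_def using X_1 by (simp add: powr_powr flip: powr_numeral)
    have "X' \<le> y ^ 4" unfolding X'_def using y1 by (intro power_mono) auto
    also have "y ^ 4 \<le> y ^ 5" using y1 by (intro power_increasing) auto
    finally have X'2: "X' \<le> X / 2" using y5 by simp
    obtain S' where S': "finite S'" "\<And>u. u \<in> S' \<Longrightarrow> real u \<le> X'" "real (card S') \<ge> c * X' powr e"
      "\<And>u. u \<in> S' \<Longrightarrow> \<exists>x. (\<forall>j<r. x j > 0 \<and> x j mod M = \<rho> j mod M) \<and> u = (\<Sum>j<r. x j ^ 5)"
      using IH[OF X'0] by blast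
    define A where "A = {x :: nat. y / 2 \<le> real x \<and> real x \<le> y \<and> x mod M = \<rho> r mod M}"
    have A: "finite A" "real (card A) \<ge> y / (4 * real M)"
      using card_residue_class_ge[OF M y8, of "\<rho> r"] by (auto simp: A_def)
    define S where "S = (\<lambda>(x, u). x ^ 5 + u) ` (A \<times> S')"
    have no: "\<not> x < x'" if "x \<in> A" "x' \<in> A" "u \<in> S'" "u' \<in> S'" "x ^ 5 + u = x' ^ 5 + u'" for x x' u u'
    proof
      assume "x < x'"
      then have "real x ^ 5 + 5 * real x ^ 4 \<le> real x' ^ 5" by (intro fifth_power_gap) auto
      moreover have "real x ^ 5 + real u = real x' ^ 5 + real u'"
        using arg_cong[OF that(5), of real] by simp
      ultimately have "5 * real x ^ 4 \<le> real u" by (smt (verit) of_nat_0_le_iff)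
      moreover have "X' \<le> real x ^ 4" unfolding X'_def using that(1) y1 by (intro power_mono) (auto simp: A_def)
      moreover have "X' > 0" unfolding X'_def using y1 by simp
      ultimately show False using S'(2)[OF that(3)] by linarith
    qed
    have inj: "inj_on (\<lambda>(x, u). x ^ 5 + u) (A \<times> S')"
    proof (rule inj_onI, clarify)
      fix x u x' u' assume h: "x \<in> A" "u \<in> S'" "x' \<in> A" "u' \<in> S'" "x ^ 5 + u = x' ^ 5 + u'"
      have "x = x'" using no[OF h(1,3,2,4,5)] no[OF h(3,1,4,2) h(5)[symmetric]] by simp
      then show "x = x' \<and> u = u'" using h(5) by simp
    qed
    have fin: "finite S" by (simp add: S_def A S')
    have le: "real v \<le> X" if v: "v \<in> S" for v
    proof -
      obtain x u where xu: "x \<in> A" "u \<in> S'" "v = x ^ 5 + u" using v by (auto simp: S_def)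
      have "real x ^ 5 \<le> y ^ 5" using xu(1) by (intro power_mono) (auto simp: A_def)
      then show ?thesis using S'(2)[OF xu(2)] xu(3) y5 X'2 by simp
    qed
    have card: "real (card S) \<ge> c' * X powr (1 - (4/5) ^ Suc r)"
    proof -
      have "X' = (1/16) * y ^ 4" by (simp add: X'_def power_divide)
      also have "y ^ 4 = (X / 2) powr (4/5)"
        unfolding y_def using X_1 by (simp add: powr_powr flip: powr_numeral)
      also have "X / 2 = (1/2) * X" by simp
      also have "\<dots> powr (4/5) = (1/2) powr (4/5) * X powr (4/5)" using X_1 by (subst powr_mult) auto
      finally have X'k: "X' = k * X powr (4/5)" by (simp add: k_def)
      have "(k * X powr (4/5)) powr e = k powr e * X powr (4/5 * e)"
        using powr_mult[of k "X powr (4/5)" e] by (simp add: powr_powr k_def)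
      then have X'eq: "X' powr e = k powr e * X powr (4/5 * e)" by (simp only: X'k)
      have yeq: "y = (1/2) powr (1/5) * X powr (1/5)"
        unfolding y_def using X_1 powr_mult[of "1/2" X "1/5"] by simp
      have "c' * X powr (1 - (4/5) ^ Suc r) = c' * (X powr (1/5) * X powr (4/5 * e))"
        unfolding powr_add[symmetric] by (simp add: e_def algebra_simps)
      also have "\<dots> = (y / (4 * real M)) * (c * X' powr e)"
        unfolding X'eq yeq c'_def by (simp add: mult_ac)
      also have "\<dots> \<le> real (card A) * real (card S')"
        using A(2) S'(3) y1 c by (intro mult_mono) auto
      also have "\<dots> = real (card S)"
        unfolding S_def card_image[OF inj] by (simp add: card_cartesian_product)
      finally show ?thesis .
    qed
    have rep: "\<exists>x. (\<forall>j<Suc r. x j > 0 \<and> x j mod M = \<rho> j mod M) \<and> v = (\<Sum>j<Suc r. x j ^ 5)" if v: "v \<in> S" for v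
    proof -
      obtain z u where xu: "z \<in> A" "u \<in> S'" "v = z ^ 5 + u" using v by (auto simp: S_def)
      obtain x where x: "\<And>j. j < r \<Longrightarrow> x j > 0 \<and> x j mod M = \<rho> j mod M" "u = (\<Sum>j<r. x j ^ 5)"
        using S'(4)[OF xu(2)] by blast
      have "z > 0" using xu(1) y1 by (cases z) (auto simp: A_def)
      then show ?thesis using x xu
        by (intro exI[of _ "x(r := z)"]) (auto simp: A_def less_Suc_eq)
    qed
    show ?thesis using fin le card rep by blast
  qed
  moreover have "c' > 0" unfolding c'_def k_def using M c by (intro mult_pos_pos) auto
  ultimately show ?case by blast
qed

text \<open>The orders of units modulo 16, 9 and 5 divide 4, 6 and 4, hence all divide
  \<open>24 = 25 - 1\<close>. The hypotheses say that \<open>a\<close> is a unit or 0 modulo 16 and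
  modulo 9, which is automatic modulo 5.\<close>

lemma dvd_power_25_minus: 
  fixes a :: int
  assumes "odd a \<or> 16 dvd a" "\<not> 3 dvd a \<or> 9 dvd a"
  shows "720 dvd a ^ 25 - a"
proof -
  have "16 dvd a ^ 25 - a"
  proof -
    have "a mod 16 = 0 \<or> a mod 16 = 1 \<or> a mod 16 = 3 \<or> a mod 16 = 5 \<or> a mod 16 = 7 \<or> a mod 16 = 9 \<or> a mod 16 = 11 \<or> a mod 16 = 13 \<or> a mod 16 = 15"
      using assms(1) by presburger
    then have "(a mod 16) ^ 25 mod 16 = a mod 16" by auto
    then show ?thesis by (metis mod_eq_dvd_iff power_mod mod_mod_trivial)
  qed
  moreover have "9 dvd a ^ 25 - a"
  proof -
    have "a mod 9 = 0 \<or> a mod 9 = 1 \<or> a mod 9 = 2 \<or> a mod 9 = 4 \<or> a mod 9 = 5 \<or> a mod 9 = 7 \<or> a mod 9 = 8"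
      using assms(2) by presburger
    then have "(a mod 9) ^ 25 mod 9 = a mod 9" by auto
    then show ?thesis by (metis mod_eq_dvd_iff power_mod mod_mod_trivial)
  qed
  moreover have "5 dvd a ^ 25 - a"
  proof -
    have "a mod 5 = 0 \<or> a mod 5 = 1 \<or> a mod 5 = 2 \<or> a mod 5 = 3 \<or> a mod 5 = 4" by presburger
    then have "(a mod 5) ^ 25 mod 5 = a mod 5" by auto
    then show ?thesis by (metis mod_eq_dvd_iff power_mod mod_mod_trivial)
  qed
  moreover have "720 dvd x" if "16 dvd x" "9 dvd x" "5 dvd x" for x :: int
  proof -
    obtain k where k: "x = 16 * k" using \<open>16 dvd x\<close> by blast
    \<comment> \<open>Since \<open>4 * 16 = 9 * 7 + 1\<close>, the difference is \<open>k\<close>;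
      likewise \<open>4 * 144 = 5 * 115 + 1\<close> below.\<close>
    have "9 dvd 4 * x - 9 * (7 * k)" using \<open>9 dvd x\<close> by (intro dvd_diff dvd_mult dvd_triv_left)
    then have "9 dvd k" by (simp add: k)
    then obtain l where l: "k = 9 * l" by blast
    have "5 dvd 4 * x - 5 * (115 * l)" using \<open>5 dvd x\<close> by (intro dvd_diff dvd_mult dvd_triv_left)
    then have "5 dvd l" by (simp add: k l)
    then show ?thesis using k l by auto
  qed
  ultimately show ?thesis by blast
qed

text \<open>Since \<open>a ^ 25\<close> is congruent to \<open>a\<close>, one may take fifth powers of numbers \<open>a ^ 5\<close>, where \<open>a\<close> and \<open>s - a\<close> both satisfy the
  hypotheses of \<open>dvd_power_25_minus\<close>.\<close>
lemma two_fifth_powers_mod_720: "\<exists>z w :: int. 720 dvd z ^ 5 + w ^ 5 - s"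
proof -
  define good where "good b \<longleftrightarrow> (odd b \<or> 16 dvd b) \<and> (\<not> 3 dvd b \<or> 9 dvd b)" for b :: int
  have good: "good b" if "odd b" "\<not> 3 dvd b" for b using that by (simp add: good_def)
  have "\<exists>a. good a \<and> good (s - a)"
  \<comment> \<open>The witnesses 1, 9, 16 and 0 are good themselves, and in each case
    \<open>s - a\<close> becomes coprime to 6.\<close>
  proof (cases "even s"; cases "3 dvd s")
    assume "even s" "3 dvd s"
    then have "odd (s - 1)" "\<not> 3 dvd s - 1" by presburger+
    then show ?thesis using good by (intro exI[of _ 1]) (simp add: good_def)
  next
    assume "even s" "\<not> 3 dvd s"
    then have "odd (s - 9)" "\<not> 3 dvd s - 9" by presburger+
    then show ?thesis using good by (intro exI[of _ 9]) (simp add: good_def)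
  next
    assume "odd s" "3 dvd s"
    then have "odd (s - 16)" "\<not> 3 dvd s - 16" by presburger+
    then show ?thesis using good by (intro exI[of _ 16]) (simp add: good_def)
  next
    assume "odd s" "\<not> 3 dvd s"
    then show ?thesis using good by (intro exI[of _ 0]) (simp add: good_def)
  qed
  then obtain a where "720 dvd a ^ 25 - a" "720 dvd (s - a) ^ 25 - (s - a)"
    using dvd_power_25_minus unfolding good_def by blast
  then have "720 dvd (a ^ 25 - a) + ((s - a) ^ 25 - (s - a))" by (rule dvd_add)
  moreover have "(b ^ 5) ^ 5 = b ^ 25" for b :: int by (simp flip: power_mult)
  ultimately have "720 dvd (a ^ 5) ^ 5 + ((s - a) ^ 5) ^ 5 - s" by (simp add: add_diff_eq)
  then show ?thesis by blast
qed

text \<open>The multisets \<open>{-3, 0, 1, 4}\<close> and \<open>{-2, -2, 3, 3}\<close> have the same power sums up to degree 3, so shifting both by \<open>t\<close>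
  and taking the difference of the sums of fifth powers gives a linear function of \<open>t\<close>, namely \<open>720 * t + 360\<close>.\<close>
lemma int_sum_of_ten_fifth_powers: "\<exists>z :: nat \<Rightarrow> int. r = (\<Sum>j<10. z j ^ 5)"
proof -
  obtain u w :: int where "720 dvd u ^ 5 + w ^ 5 - (r - 360)" using two_fifth_powers_mod_720 by blast
  then obtain t' where "u ^ 5 + w ^ 5 - (r - 360) = 720 * t'" by blast
  then have t: "r = 720 * (- t') + 360 + u ^ 5 + w ^ 5" by linarith
  define t where "t = - t'"
  define z where "z = (\<lambda>j::nat. [t + 4, t - 3, t + 1, t, - t - 3, - t - 3, 2 - t, 2 - t, u, w] ! j)"
  have "(\<Sum>j<10. z j ^ 5) = (t + 4) ^ 5 + (t - 3) ^ 5 + (t + 1) ^ 5 + t ^ 5 + (- t - 3) ^ 5 + (- t - 3) ^ 5 + (2 - t) ^ 5 + (2 - t) ^ 5 + u ^ 5 + w ^ 5"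
  proof -
    have "(\<Sum>j<10. f j) = f 0 + f 1 + f 2 + f 3 + f 4 + f 5 + f 6 + f 7 + f 8 + f 9" for f :: "nat \<Rightarrow> int"
      by (simp add: eval_nat_numeral)
    then show ?thesis by (simp add: z_def)
  qed
  also have "\<dots> = r" unfolding t t_def by algebra
  finally show ?thesis by metis
qed

lemma residue_sum_of_ten_fifth_powers:
  assumes "M \<ge> (1 :: nat)"
  shows "\<exists>\<rho> :: nat \<Rightarrow> nat. int M dvd (\<Sum>j<10. int (\<rho> j) ^ 5) - r"
proof -
  obtain z :: "nat \<Rightarrow> int" where z: "r = (\<Sum>j<10. z j ^ 5)" using int_sum_of_ten_fifth_powers by blast
  define \<rho> where "\<rho> j = nat (z j mod int M)" for j
  have "int (\<rho> j) = z j mod int M" for j using assms by (simp add: \<rho>_def)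
  then have "((\<Sum>j<10. int (\<rho> j) ^ 5) - (\<Sum>j<10. z j ^ 5)) = (\<Sum>j<10. (z j mod int M) ^ 5 - z j ^ 5)"
    by (simp add: sum_subtractf)
  also have "int M dvd \<dots>"
  proof (rule dvd_sum)
    fix j
    show "int M dvd (z j mod int M) ^ 5 - z j ^ 5"
      by (simp add: mod_eq_dvd_iff[symmetric] power_mod)
  qed
  finally show ?thesis using z by auto
qed

section \<open>Estimates for the quintic sequence\<close>

lemma fifth_power_diff_bounds:
  fixes a b :: int
  assumes "0 \<le> b" "b \<le> a"
  shows "5 * (a - b) * b ^ 4 \<le> a ^ 5 - b ^ 5" "a ^ 5 - b ^ 5 \<le> 5 * (a - b) * a ^ 4"
proof -
  have eq: "a ^ 5 - b ^ 5 = (a - b) * (a ^ 4 + a ^ 3 * b + a ^ 2 * b ^ 2 + a * b ^ 3 + b ^ 4)" by algebra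
  have m: "b ^ i * b ^ j \<le> a ^ i * b ^ j" "a ^ i * b ^ j \<le> a ^ i * a ^ j" for i j
    using assms by (auto intro!: mult_mono power_mono)
  have l: "5 * b ^ 4 \<le> a ^ 4 + a ^ 3 * b + a ^ 2 * b ^ 2 + a * b ^ 3 + b ^ 4"
    using m(1)[of 4 0] m(1)[of 3 1] m(1)[of 2 2] m(1)[of 1 3] by (simp flip: power_add power_Suc power_Suc2)
  have u: "a ^ 4 + a ^ 3 * b + a ^ 2 * b ^ 2 + a * b ^ 3 + b ^ 4 \<le> 5 * a ^ 4"
    using m(2)[of 0 4] m(2)[of 3 1] m(2)[of 2 2] m(2)[of 1 3] by (simp flip: power_add power_Suc power_Suc2)
  show "5 * (a - b) * b ^ 4 \<le> a ^ 5 - b ^ 5"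
  proof -
    have e: "5 * (a - b) * b ^ 4 = (a - b) * (5 * b ^ 4)" by simp
    show ?thesis unfolding eq e by (rule mult_left_mono[OF l]) (use assms in simp)
  qed
  show "a ^ 5 - b ^ 5 \<le> 5 * (a - b) * a ^ 4"
  proof -
    have e: "5 * (a - b) * a ^ 4 = (a - b) * (5 * a ^ 4)" by simp
    show ?thesis unfolding eq e by (rule mult_left_mono[OF u]) (use assms in simp)
  qed
qed

text \<open>By \<open>quintic_eq\<close>, \<open>25 * Y\<close> times the step is the difference of
  the fifth powers of two numbers at distance \<open>5 * Y\<close>, both at least
  \<open>5 * Y * P\<close>; thus 625 is \<open>5 ^ 4\<close>.\<close>

lemma quintic_step_lower:
  assumes "Y \<ge> 1" "0 \<le> P" "P \<le> x"
  shows "625 * Y ^ 4 * P ^ 4 \<le> quintic Y (x + 1) - quintic Y x"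
proof -
  have "25 * Y * (625 * Y ^ 4 * P ^ 4) = 5 * (5 * Y) * (5 * Y * P) ^ 4" by algebra
  also have "\<dots> \<le> 5 * (5 * Y) * (5 * Y * x + 1) ^ 4"
  proof (intro mult_left_mono power_mono)
    have "5 * Y * P \<le> 5 * Y * x" using assms by (intro mult_left_mono) auto
    then show "5 * Y * P \<le> 5 * Y * x + 1" by linarith
  qed (use assms in auto)
  also have "\<dots> \<le> (5 * Y * (x + 1) + 1) ^ 5 - (5 * Y * x + 1) ^ 5"
    using fifth_power_diff_bounds(1)[of "5 * Y * x + 1" "5 * Y * (x + 1) + 1"] assms by (simp add: algebra_simps)
  also have "\<dots> = 25 * Y * (quintic Y (x + 1) - quintic Y x)" unfolding quintic_eq by (simp add: algebra_simps)
  finally show ?thesis using assms by simp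
qed

text \<open>The constant is \<open>11 ^ 4\<close>: for \<open>x + 1 \<le> 2 * P\<close> the larger
  base \<open>5 * Y * (x + 1) + 1\<close> is at most \<open>11 * Y * P\<close>.\<close>

lemma quintic_step_upper:
  assumes "Y \<ge> 1" "0 \<le> x" "x + 1 \<le> 2 * P" 
  shows "quintic Y (x + 1) - quintic Y x \<le> 14641 * Y ^ 4 * P ^ 4"
proof -
  have P: "P \<ge> 1" using assms by linarith
  have "25 * Y * (quintic Y (x + 1) - quintic Y x) = (5 * Y * (x + 1) + 1) ^ 5 - (5 * Y * x + 1) ^ 5"
    unfolding quintic_eq by (simp add: algebra_simps)
  also have "\<dots> \<le> 5 * (5 * Y) * (5 * Y * (x + 1) + 1) ^ 4"
    using fifth_power_diff_bounds(2)[of "5 * Y * x + 1" "5 * Y * (x + 1) + 1"] assms by (simp add: algebra_simps)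
  also have "\<dots> \<le> 5 * (5 * Y) * (11 * Y * P) ^ 4"
  proof (intro mult_left_mono power_mono)
    have "5 * Y * (x + 1) \<le> 5 * Y * (2 * P)" using assms by (intro mult_left_mono) auto
    moreover have "1 * 1 \<le> Y * P" using assms P by (intro mult_mono) auto
    moreover have "5 * Y * (2 * P) = 10 * (Y * P)" "11 * Y * P = 11 * (Y * P)" by simp_all
    ultimately show "5 * Y * (x + 1) + 1 \<le> 11 * Y * P" by linarith
  qed (use assms in auto)
  also have "\<dots> = 25 * Y * (14641 * Y ^ 4 * P ^ 4)" by algebra
  finally show ?thesis using assms by simp
qed

lemma quintic_convex:
  assumes "Y \<ge> 0" "x \<ge> 0"
  shows "quintic Y (x + 1) - quintic Y x \<le> quintic Y (x + 2) - quintic Y (x + 1)"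
proof -
  have "(quintic Y (x + 2) - quintic Y (x + 1)) - (quintic Y (x + 1) - quintic Y x) = 125 * Y ^ 4 * (20 * x ^ 3 + 60 * x ^ 2 + 70 * x + 30)
     + 125 * Y ^ 3 * (12 * x ^ 2 + 24 * x + 14) + 50 * Y ^ 2 * (6 * x + 6) + 20 * Y"
    unfolding quintic_def by algebra
  also have "\<dots> \<ge> 0" using assms by simp
  finally show ?thesis by simp
qed

definition quintic_seq :: "nat \<Rightarrow> nat \<Rightarrow> nat \<Rightarrow> nat" where
  "quintic_seq Y P i = nat (quintic (int Y) (int (P + i)))"

text \<open>\<open>K\<close> is the bound separating small from large denominators. With
  \<open>P = K ^ 3\<close> all scales are integral powers of \<open>K\<close>: the values have order
  \<open>K ^ 15\<close>, the major arcs have radius at most \<open>1 / K ^ 14\<close>, and Weyl's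
  inequality saves \<open>1 / K\<close>.\<close>

abbreviation value_K :: "nat \<Rightarrow> nat \<Rightarrow> real poly" where
  "value_K Y K \<equiv> value_poly (quintic_seq Y (K ^ 3)) (K ^ 3)"

abbreviation density_K :: "nat \<Rightarrow> nat \<Rightarrow> real poly" where
  "density_K Y K \<equiv> density_poly (quintic_seq Y (K ^ 3)) (K ^ 3)"

abbreviation width :: "nat \<Rightarrow> nat \<Rightarrow> real" where
  "width Y K \<equiv> real (quintic_seq Y (K ^ 3) (K ^ 3)) - real (quintic_seq Y (K ^ 3) 0)"

abbreviation reduced :: "nat \<Rightarrow> int set" where
  "reduced q \<equiv> {a\<in>{0..int q}. coprime a (int q)}"

abbreviation minor_size :: "nat \<Rightarrow> real" where
  "minor_size K \<equiv> real K powr (111 - 481/256)"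

abbreviation thickness :: "nat \<Rightarrow> real" where
  "thickness K \<equiv> (real K ^ 15) powr (1 - (4/5) ^ 10)"

lemma int_quintic_seq: "int (quintic_seq Y P i) = quintic (int Y) (int (P + i))"
  unfolding quintic_seq_def by (simp add: quintic_def)

lemma real_quintic_seq: "real (quintic_seq Y P i) = of_int (quintic (int Y) (int (P + i)))"
  using int_quintic_seq by (metis of_int_of_nat_eq)

lemma quintic_seq_props:
  assumes "Y \<ge> 1" "P \<ge> 1"
  shows "strict_mono (quintic_seq Y P)" 
    and "real (quintic_seq Y P (Suc i) - quintic_seq Y P i) \<ge> 625 * real Y ^ 4 * real P ^ 4"
    and "i < P \<Longrightarrow> real (quintic_seq Y P (Suc i) - quintic_seq Y P i) \<le> 14641 * real Y ^ 4 * real P ^ 4"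
    and "quintic_seq Y P (Suc i) - quintic_seq Y P i \<le> quintic_seq Y P (Suc (Suc i)) - quintic_seq Y P (Suc i)"
proof -
  have low: "625 * int Y ^ 4 * int P ^ 4 \<le> int (quintic_seq Y P (Suc i)) - int (quintic_seq Y P i)" for i
    unfolding int_quintic_seq using quintic_step_lower[of "int Y" "int P" "int (P + i)"] assms by (simp add: add_ac)
  have pos: "625 * int Y ^ 4 * int P ^ 4 > 0" using assms by simp
  have lt: "quintic_seq Y P i < quintic_seq Y P (Suc i)" for i using low[of i] pos by linarith
  show "strict_mono (quintic_seq Y P)" using lt by (simp add: strict_mono_Suc_iff)
  have d: "int (quintic_seq Y P (Suc i) - quintic_seq Y P i) = int (quintic_seq Y P (Suc i)) - int (quintic_seq Y P i)" for i
    using lt[of i] by simp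
  have "real_of_int (625 * int Y ^ 4 * int P ^ 4) \<le> real_of_int (int (quintic_seq Y P (Suc i) - quintic_seq Y P i))"
    unfolding d by (rule of_int_le_iff[THEN iffD2], rule low)
  then show "real (quintic_seq Y P (Suc i) - quintic_seq Y P i) \<ge> 625 * real Y ^ 4 * real P ^ 4" by simp
  show "real (quintic_seq Y P (Suc i) - quintic_seq Y P i) \<le> 14641 * real Y ^ 4 * real P ^ 4" if "i < P"
  proof -
    have "int (quintic_seq Y P (Suc i)) - int (quintic_seq Y P i) \<le> 14641 * int Y ^ 4 * int P ^ 4"
      unfolding int_quintic_seq using quintic_step_upper[of "int Y" "int (P + i)" "int P"] assms that by (simp add: add_ac)
    then have "real_of_int (int (quintic_seq Y P (Suc i) - quintic_seq Y P i)) \<le> real_of_int (14641 * int Y ^ 4 * int P ^ 4)"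
      unfolding d by (rule of_int_le_iff[THEN iffD2])
    then show ?thesis by simp
  qed
  have "int (quintic_seq Y P (Suc i) - quintic_seq Y P i) \<le> int (quintic_seq Y P (Suc (Suc i)) - quintic_seq Y P (Suc i))"
    unfolding d int_quintic_seq using quintic_convex[of "int Y" "int (P + i)"] by (simp add: add_ac)
  then show "quintic_seq Y P (Suc i) - quintic_seq Y P i \<le> quintic_seq Y P (Suc (Suc i)) - quintic_seq Y P (Suc i)" by simp
qed

lemma quintic_seq_range_bounds:
  assumes "Y \<ge> 1" "P \<ge> 1"
  shows "625 * real Y ^ 4 * real P ^ 5 \<le> real (quintic_seq Y P P) - real (quintic_seq Y P 0)"
    and "real (quintic_seq Y P P) - real (quintic_seq Y P 0) \<le> 14641 * real Y ^ 4 * real P ^ 5"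
proof -
  have lt: "quintic_seq Y P i < quintic_seq Y P (Suc i)" for i using quintic_seq_props(1)[OF assms] by (simp add: strict_mono_Suc_iff)
  have tel: "real (quintic_seq Y P P) - real (quintic_seq Y P 0) = (\<Sum>i<P. real (quintic_seq Y P (Suc i) - quintic_seq Y P i))"
    using sum_lessThan_telescope[of "\<lambda>i. real (quintic_seq Y P i)" P] lt by (simp add: of_nat_diff less_imp_le)
  have "(\<Sum>i<P. real (quintic_seq Y P (Suc i) - quintic_seq Y P i)) \<ge> (\<Sum>i<P. 625 * real Y ^ 4 * real P ^ 4)"
    by (intro sum_mono quintic_seq_props(2)[OF assms])
  then show "625 * real Y ^ 4 * real P ^ 5 \<le> real (quintic_seq Y P P) - real (quintic_seq Y P 0)"
    unfolding tel by (simp add: eval_nat_numeral mult_ac)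
  have "(\<Sum>i<P. real (quintic_seq Y P (Suc i) - quintic_seq Y P i)) \<le> (\<Sum>i<P. 14641 * real Y ^ 4 * real P ^ 4)"
    by (intro sum_mono quintic_seq_props(3)[OF assms]) auto
  then show "real (quintic_seq Y P P) - real (quintic_seq Y P 0) \<le> 14641 * real Y ^ 4 * real P ^ 5"
    unfolding tel by (simp add: eval_nat_numeral mult_ac)
qed

lemma trig_value_poly_quintic_seq:
  "trig (value_poly (quintic_seq Y P) P) \<alpha> = (\<Sum>x\<in>{int P..<int P + int P}. unit_exp (\<alpha> * of_int (quintic (int Y) x)))"
  unfolding trig_value_poly real_quintic_seq
  by (rule sum.reindex_bij_witness[of _ "\<lambda>x. nat (x - int P)" "\<lambda>i. int (P + i)"]) auto

lemma trig_periodic: "trig p (\<alpha> + of_int k) = trig p \<alpha>"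
  by (simp add: trig_def unit_exp_add_int)

text \<open>The number 15000 is \<open>120 * 125\<close>: four differencings of \<open>\<alpha> * quintic Y x\<close> leave the linear coefficient
  \<open>120 * (125 * Y ^ 4 * \<alpha>)\<close>. The trivial bound would be \<open>K ^ 111\<close>, and \<open>481/256 = 37/16 * (1 - 3/16)\<close>.\<close>
lemma minor_bound:
  "\<exists>C>0. \<forall>Y K \<alpha> h k. Y \<ge> 1 \<longrightarrow> K \<ge> 1 \<longrightarrow> coprime h (int k) \<longrightarrow> K < k \<longrightarrow> k \<le> K ^ 14 \<longrightarrow>
     \<bar>15000 * real Y ^ 4 * \<alpha> - of_int h / real k\<bar> \<le> 1 / (real k)^2 \<longrightarrow>
     norm (trig (value_K Y K) \<alpha>) ^ 37 \<le> C * minor_size K"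
proof -
  obtain C where C: "C > 0" "\<And>P q b \<theta> \<phi> u. 1 \<le> P \<Longrightarrow> 1 \<le> q \<Longrightarrow> q \<le> P ^ 5 \<Longrightarrow> coprime b (int q) \<Longrightarrow>
     \<bar>\<theta> - of_int b / real q\<bar> \<le> 1 / (real q)^2 \<Longrightarrow> iter_lin 4 \<theta> \<phi> \<Longrightarrow>
     norm (\<Sum>x\<in>{u..<u + int P}. unit_exp (\<phi> x)) ^ 16 
       \<le> C * real P powr (16 + 1/16) * (1 / real P + 1 / real q + real q / real P ^ 5)"
    using weyl_inequality by blast
  have "norm (trig (value_K Y K) \<alpha>) ^ 37 \<le> (3 * C) powr (37/16) * minor_size K"
    if Y: "Y \<ge> 1" and K: "K \<ge> 1" and cop: "coprime h (int k)" and k: "K < k" "k \<le> K ^ 14" and 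
      ap: "\<bar>15000 * real Y ^ 4 * \<alpha> - of_int h / real k\<bar> \<le> 1 / (real k)^2" for Y K :: nat and \<alpha> h k
  proof -
    define z where "z = norm (trig (value_K Y K) \<alpha>)"
    have k15: "k \<le> (K ^ 3) ^ 5"
    proof -
      have "K ^ 14 \<le> K ^ 15" using K by (intro power_increasing) auto
      then show ?thesis using k(2) by (simp flip: power_mult)
    qed
    have lin: "iter_lin 4 (15000 * real Y ^ 4 * \<alpha>) (\<lambda>x. \<alpha> * of_int (quintic (int Y) x))"
      using iter_lin_quintic[of "int Y" \<alpha>] by simp
    have "z ^ 16 \<le> C * real (K ^ 3) powr (16 + 1/16) * (1 / real (K ^ 3) + 1 / real k + real k / real (K ^ 3) ^ 5)"
      unfolding z_def trig_value_poly_quintic_seq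
      by (rule C(2)[OF _ _ k15 cop ap lin]) (use K k in auto)
    also have "\<dots> \<le> C * real (K ^ 3) powr (16 + 1/16) * (3 / real K)"
    proof (rule mult_left_mono)
      have "real K \<le> real K ^ 3" using K by (simp add: self_le_power)
      then have 1: "1 / real (K ^ 3) \<le> 1 / real K" using K by (simp add: frac_le)
      have 2: "1 / real k \<le> 1 / real K" using k K by (simp add: frac_le)
      have "real k \<le> real K ^ 14" using of_nat_mono[OF k(2), where ?'a = real] by simp
      then have "real k / real (K ^ 3) ^ 5 \<le> real K ^ 14 / real K ^ 15"
        by (simp add: divide_right_mono flip: power_mult)
      also have "\<dots> = 1 / real K" using K by (simp add: eval_nat_numeral)
      finally show "1 / real (K ^ 3) + 1 / real k + real k / real (K ^ 3) ^ 5 \<le> 3 / real K"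
        using 1 2 by simp
    qed (use C in auto)
    also have "real (K ^ 3) powr (16 + 1/16) = real K powr (771/16)"
      using K by (simp add: powr_powr flip: powr_numeral)
    also have "C * real K powr (771/16) * (3 / real K) = 3 * C * (real K powr (771/16) / real K)" by simp
    also have "real K powr (771/16) / real K = real K powr (755/16)"
      using K powr_diff[of "real K" "771/16" 1] by simp
    finally have 2: "z ^ 16 \<le> 3 * C * real K powr (755/16)" .
    have z0: "z \<ge> 0" by (simp add: z_def)
    have "z ^ 37 = (z ^ 16) powr (37/16)"
      using z0 by (cases "z = 0") (simp_all add: powr_powr flip: powr_numeral)
    also have "\<dots> \<le> (3 * C * real K powr (755/16)) powr (37/16)"
      using 2 z0 by (intro powr_mono2) auto
    also have "\<dots> = (3 * C) powr (37/16) * minor_size K"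
      using C K by (simp add: powr_mult powr_powr)
    finally show ?thesis by (simp add: z_def)
  qed
  moreover have "(3 * C) powr (37/16) > 0" using C by simp
  ultimately show ?thesis by blast
qed

lemma value_poly_quintic_seq_major:
  assumes Y: "Y \<ge> 1" and P: "P \<ge> 1" and q: "q \<ge> 1" and \<alpha>: "\<alpha> = of_int a / real q + \<beta>"
  defines "g \<equiv> quintic_seq Y P"
  shows "norm (trig (value_poly g P) \<alpha>) \<le> norm (complete_sum (int Y) q a) / real q * norm (trig (value_poly g P) \<beta>) 
     + 2 * (real q + 2 * pi * \<bar>\<beta>\<bar> * real q * (real (g P) - real (g 0)))"
proof -
  define F where "F i = unit_exp (of_int (a * quintic (int Y) (int (P + i))) / real q)" for i :: nat
  have "trig (value_poly g P) \<alpha> = (\<Sum>i<P. F i * unit_exp (\<beta> * real (g i)))"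
    unfolding trig_value_poly F_def unit_exp_add[symmetric] g_def real_quintic_seq \<alpha> by (simp add: algebra_simps)
  moreover have "norm (\<Sum>i<P. F i * unit_exp (\<beta> * real (g i))) \<le> norm (complete_sum (int Y) q a) / real q * norm (trig (value_poly g P) \<beta>) 
     + 2 * (real q + 2 * pi * \<bar>\<beta>\<bar> * real q * (real (g P) - real (g 0)))"
    unfolding g_def
  proof (rule major_bound)
    show "strict_mono (quintic_seq Y P)" by (rule quintic_seq_props(1)[OF Y P])
    show "625 * real Y ^ 4 * real P ^ 4 > 0" using Y P by simp
    show "(\<Sum>i\<in>{k * q..<k * q + q}. F i) = complete_sum (int Y) q a" for k
    proof -
      define m where "m = k * q"
      have "(\<Sum>i\<in>{m..<m + q}. F i) = (\<Sum>x\<in>{int (P + m)..<int (P + m) + int q}. unit_exp (of_int (a * quintic (int Y) x) / real q))"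
        unfolding F_def
        by (rule sum.reindex_bij_witness[of _ "\<lambda>x. nat (x - int P)" "\<lambda>i. int (P + i)"]) auto
      also have "\<dots> = complete_sum (int Y) q a" by (rule complete_sum_shift) (use q in auto)
      finally show ?thesis by (simp only: m_def)
    qed
  qed (use quintic_seq_props[OF Y P] q norm_complete_sum_le in \<open>auto simp: F_def\<close>)
  ultimately show ?thesis by simp
qed

text \<open>For \<open>2 \<le> q \<le> w\<close> every prime factor of \<open>q\<close> divides
  \<open>fact w\<close>, so the complete sums vanish. For \<open>q > w\<close> they vanish or obey
  \<open>complete_sum_bound\<close>. With at most \<open>2 * q\<close> numerators the terms are of
  order \<open>q powr (1 - 555/256) = q powr (- 299/256)\<close>, and the tail of this convergent
  series is small. The bound does not involve \<open>Q\<close>, which later grows with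
  \<open>K\<close>.\<close>

lemma complete_sum_power_sum_small:
  fixes \<eta> :: real
  assumes "\<eta> > 0"
  shows "\<exists>w\<ge>5. \<forall>Q. (\<Sum>q\<in>{2..Q}. \<Sum>a\<in>reduced q. (norm (complete_sum (fact w) q a) / real q) ^ 37) \<le> \<eta>"
proof -
  obtain C where C: "C > 0" "\<And>Y q a. 30 dvd Y \<Longrightarrow> q \<ge> 1 \<Longrightarrow> coprime a (int q) \<Longrightarrow> coprime Y (int q) \<Longrightarrow>
     (norm (complete_sum Y q a) / real q) ^ 37 \<le> C * real q powr (- 555/256)"
    using complete_sum_bound by blast
  have "summable (\<lambda>n. real n powr (- 299/256))" by (subst summable_real_powr_iff) simp
  then obtain w0 where w0: "\<And>m n. m \<ge> w0 \<Longrightarrow> norm (\<Sum>q\<in>{m..<n}. real q powr (- 299/256)) < \<eta> / (2 * C)"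
    unfolding summable_Cauchy using assms C(1) by (metis divide_pos_pos mult_pos_pos zero_less_numeral)
  define w where "w = max 5 w0"
  have w: "w \<ge> 5" "w \<ge> w0" by (auto simp: w_def)
  have "(\<Sum>q\<in>{2..Q}. \<Sum>a\<in>reduced q. (norm (complete_sum (fact w) q a) / real q) ^ 37) \<le> \<eta>" for Q
  proof -
    define c where "c q = (if q \<le> w then 0 else 2 * C * real q powr (- 299/256))" for q :: nat
    have "(\<Sum>a\<in>reduced q. (norm (complete_sum (fact w) q a) / real q) ^ 37) \<le> c q" if q: "q \<ge> 2" for q
    proof -
      have dv: "int p dvd fact w" if "p \<le> w" "p \<ge> 1" for p
        using dvd_fact[of p w] that by (metis of_nat_dvd_iff of_nat_fact)
      have z: "complete_sum (fact w) q a = 0" if a: "coprime a (int q)" and p: "prime p" "p dvd q" "int p dvd fact w" for a p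
        using complete_sum_eq_0[of q p "fact w" a] a p q by simp
      show ?thesis
      proof (cases "q \<le> w")
        case True
        obtain p where p: "prime p" "p dvd q" using prime_factor_nat[of q] q by auto
        have "p \<le> q" using p(2) q by (simp add: dvd_imp_le)
        then have "int p dvd fact w" using True prime_gt_0_nat[OF p(1)] by (intro dv) auto
        then have "(\<Sum>a\<in>reduced q. (norm (complete_sum (fact w) q a) / real q) ^ 37) = 0"
          using z[OF _ p] by (intro sum.neutral) auto
        then show ?thesis using True by (simp add: c_def)
      next
        case False
        have "(norm (complete_sum (fact w) q a) / real q) ^ 37 \<le> C * real q powr (- 555/256)" if a: "coprime a (int q)" for a
        proof (cases "coprime (fact w) (int q)")
          case True
          have "(30 :: int) dvd fact 5" by (simp add: fact_numeral)
          also have "fact 5 dvd (fact w :: int)" using w(1) by (rule fact_dvd)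
          finally show ?thesis using q True a by (intro C(2)) auto
        next
          case ncop: False
          then have "gcd (fact w) q \<noteq> 1" by (metis coprime_iff_gcd_eq_1 coprime_int_iff of_nat_fact)
          then obtain p where p: "prime p" "p dvd gcd (fact w) q" using prime_factor_nat by blast
          then have pq: "p dvd q" and "p dvd fact w" by (simp_all only: gcd_greatest_iff)
          then have "int p dvd int (fact w)" by (simp only: of_nat_dvd_iff)
          then have "int p dvd fact w" by (simp only: of_nat_fact)
          then show ?thesis using z[OF a p(1) pq] C(1) by simp
        qed
        then have "(\<Sum>a\<in>reduced q. (norm (complete_sum (fact w) q a) / real q) ^ 37)
           \<le> (\<Sum>a\<in>reduced q. C * real q powr (- 555/256))"
          by (intro sum_mono) auto
        also have "\<dots> = real (card (reduced q)) * (C * real q powr (- 555/256))" by simp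
        also have "\<dots> \<le> (2 * real q) * (C * real q powr (- 555/256))"
        proof (rule mult_right_mono)
          have "card (reduced q) \<le> card {0..int q}" by (intro card_mono) auto
          also have "\<dots> \<le> 2 * q" using q by simp
          finally have "real (card (reduced q)) \<le> real (2 * q)" by (rule of_nat_mono)
          then show "real (card (reduced q)) \<le> 2 * real q" by (simp only: of_nat_mult of_nat_numeral)
        qed (use C in auto)
        also have "\<dots> = 2 * C * (real q powr 1 * real q powr (- 555/256))" using q by simp
        also have "\<dots> = c q" using False unfolding powr_add[symmetric] c_def by simp
        finally show ?thesis .
      qed
    qed
    then have "(\<Sum>q\<in>{2..Q}. \<Sum>a\<in>reduced q. (norm (complete_sum (fact w) q a) / real q) ^ 37) \<le> (\<Sum>q\<in>{2..Q}. c q)"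
      by (intro sum_mono) auto
    also have "\<dots> \<le> (\<Sum>q\<in>{w..<Suc Q}. 2 * C * real q powr (- 299/256))"
    proof -
      have "(\<Sum>q\<in>{2..Q}. c q) = (\<Sum>q\<in>{2..Q} \<inter> {w..<Suc Q}. c q)"
        by (intro sum.mono_neutral_right) (auto simp: c_def)
      also have "\<dots> \<le> (\<Sum>q\<in>{2..Q} \<inter> {w..<Suc Q}. 2 * C * real q powr (- 299/256))"
        using C(1) by (intro sum_mono) (auto simp: c_def)
      also have "\<dots> \<le> (\<Sum>q\<in>{w..<Suc Q}. 2 * C * real q powr (- 299/256))"
        using C(1) by (intro sum_mono2) auto
      finally show ?thesis .
    qed
    also have "\<dots> = 2 * C * (\<Sum>q\<in>{w..<Suc Q}. real q powr (- 299/256))" by (rule sum_distrib_left[symmetric])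
    also have "\<dots> \<le> 2 * C * (\<eta> / (2 * C))"
      using w0[OF w(2), of "Suc Q"] C(1) by (intro mult_left_mono) auto
    also have "\<dots> = \<eta>" using C(1) by simp
    finally show ?thesis .
  qed
  then show ?thesis using w(1) by blast
qed

section \<open>Comparison of the two generating functions on the whole circle\<close>

lemma norm_power_diff_le:
  fixes x y :: complex
  assumes "norm x \<le> M" "norm y \<le> M"
  shows "norm (x ^ n - y ^ n) \<le> real n * M ^ (n - 1) * norm (x - y)"
proof (induction n)
  case (Suc n)
  have M: "M \<ge> 0" using assms(1) norm_ge_zero order_trans by blast
  have "x ^ Suc n - y ^ Suc n = x * (x ^ n - y ^ n) + (x - y) * y ^ n" by (simp add: algebra_simps)
  then have "norm (x ^ Suc n - y ^ Suc n) \<le> norm x * norm (x ^ n - y ^ n) + norm (x - y) * norm y ^ n"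
    by (metis norm_mult norm_power norm_triangle_ineq)
  also have "norm x * norm (x ^ n - y ^ n) \<le> M * (real n * M ^ (n - 1) * norm (x - y))"
    using assms M Suc.IH by (intro mult_mono) auto
  also have "norm (x - y) * norm y ^ n \<le> norm (x - y) * M ^ n"
    using assms by (intro mult_left_mono power_mono) auto
  also have "M * (real n * M ^ (n - 1) * norm (x - y)) + norm (x - y) * M ^ n = real (Suc n) * M ^ n * norm (x - y)"
    by (cases n) (simp_all add: algebra_simps)
  finally show ?case by simp
qed simp

lemma power_add_le:
  fixes x y :: real
  assumes "x \<ge> 0" "y \<ge> 0"
  shows "(x + y) ^ n \<le> 2 ^ n * (x ^ n + y ^ n)"
proof -
  have "(x + y) ^ n \<le> (2 * max x y) ^ n" using assms by (intro power_mono) auto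
  also have "\<dots> = 2 ^ n * max x y ^ n" by (simp add: power_mult_distrib)
  also have "max x y ^ n \<le> x ^ n + y ^ n" using assms by (auto simp: max_def)
  finally show ?thesis by simp
qed

definition indicator_poly :: "nat set \<Rightarrow> real poly" where
  "indicator_poly U = (\<Sum>u\<in>U. monom 1 u)"

lemma norm_trig_indicator_poly_le: "norm (trig (indicator_poly U) \<alpha>) \<le> real (card U)"
  using norm_sum[of "\<lambda>u. unit_exp (\<alpha> * real u)" U] by (simp add: indicator_poly_def trig_sum trig_monom)

lemma coeff_indicator_poly: "finite U \<Longrightarrow> coeff (indicator_poly U) m = (if m \<in> U then 1 else 0)"
  by (simp add: indicator_poly_def coeff_sum coeff_monom)

lemma degree_indicator_poly: "finite U \<Longrightarrow> U \<subseteq> {..B} \<Longrightarrow> degree (indicator_poly U) \<le> B"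
  unfolding indicator_poly_def by (intro degree_sum_le) (auto intro: order.trans[OF degree_monom_le])

lemma sum_coeff_indicator_poly_sq:
  assumes "finite U" "U \<subseteq> {..<T}"
  shows "(\<Sum>m<T. coeff (indicator_poly U) m ^ 2) = real (card U)"
proof -
  have "(\<Sum>m<T. coeff (indicator_poly U) m ^ 2) = (\<Sum>m<T. if m \<in> U then 1 else 0)"
    using assms(1) by (intro sum.cong refl) (simp add: coeff_indicator_poly)
  also have "\<dots> = (\<Sum>m\<in>{..<T} \<inter> U. 1)" by (subst sum.inter_restrict) auto
  also have "{..<T} \<inter> U = U" using assms(2) by auto
  finally show ?thesis by simp
qed

lemma coeff_mult_indicator_poly:
  "coeff (p * indicator_poly U) n = (\<Sum>u\<in>U. if u \<le> n then coeff p (n - u) else 0)"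
  unfolding indicator_poly_def sum_distrib_left coeff_sum
  by (intro sum.cong refl) (simp add: mult.commute[of p] coeff_monom_mult not_less)

text \<open>Dirichlet's theorem is applied to \<open>15000 * Y ^ 4 * \<alpha>\<close>, the
  coefficient that Weyl's inequality sees. A denominator above \<open>K\<close> puts
  \<open>\<alpha>\<close> on a minor arc. Otherwise dividing by \<open>15000 * Y ^ 4\<close> gives
  an approximation of \<open>\<alpha>\<close> itself, with the denominator enlarged by at most this
  constant.\<close>

lemma circle_classification:
  "\<exists>C>0. \<forall>Y K \<alpha>. Y \<ge> 1 \<longrightarrow> K \<ge> 1 \<longrightarrow> 0 \<le> \<alpha> \<longrightarrow> \<alpha> < 1 \<longrightarrow>
     (\<exists>k\<in>{0, 1::int}. \<bar>\<alpha> - of_int k\<bar> \<le> 1 / real K ^ 14) \<or>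
     norm (trig (value_K Y K) \<alpha>) ^ 37 \<le> C * minor_size K \<or>
     (\<exists>q a. 2 \<le> q \<and> q \<le> 15000 * Y ^ 4 * K \<and> a \<in> {0..int q} \<and> coprime a (int q) \<and> \<bar>\<alpha> - of_int a / real q\<bar> \<le> 1 / (real q * real K ^ 14))"
proof -
  obtain C where C: "C > 0" "\<And>Y K \<alpha> h k. Y \<ge> 1 \<Longrightarrow> K \<ge> 1 \<Longrightarrow> coprime h (int k) \<Longrightarrow> K < k \<Longrightarrow> k \<le> K ^ 14 \<Longrightarrow>
     \<bar>15000 * real Y ^ 4 * \<alpha> - of_int h / real k\<bar> \<le> 1 / (real k)^2 \<Longrightarrow>
     norm (trig (value_K Y K) \<alpha>) ^ 37 \<le> C * minor_size K"
    using minor_bound by blast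
  have "(\<exists>k\<in>{0, 1::int}. \<bar>\<alpha> - of_int k\<bar> \<le> 1 / real K ^ 14) \<or>
     norm (trig (value_K Y K) \<alpha>) ^ 37 \<le> C * minor_size K \<or>
     (\<exists>q a. 2 \<le> q \<and> q \<le> 15000 * Y ^ 4 * K \<and> a \<in> {0..int q} \<and> coprime a (int q) \<and> \<bar>\<alpha> - of_int a / real q\<bar> \<le> 1 / (real q * real K ^ 14))"
    if Y: "Y \<ge> 1" and K: "K \<ge> 1" and \<alpha>: "0 \<le> \<alpha>" "\<alpha> < 1" for Y K :: nat and \<alpha> :: real
  proof -
    define N where "N = K ^ 14"
    define m where "m = 15000 * Y ^ 4"
    have m: "m \<ge> 1" using Y by (simp add: m_def)
    have N: "N \<ge> 1" using K by (simp add: N_def)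
    define \<theta> where "\<theta> = real m * \<alpha>"
    obtain h k' where hk': "coprime h k'" "0 < k'" "k' \<le> int N" "\<bar>of_int k' * \<theta> - of_int h\<bar> < 1 / real N"
      using Dirichlet_approx_coprime[of N \<theta>] N by (metis less_le_trans zero_less_one)
    define k where "k = nat k'"
    have kk: "k' = int k" using hk' by (simp add: k_def)
    have k: "coprime h (int k)" "k \<ge> 1" "k \<le> N" using hk' kk by auto
    have ap: "\<bar>\<theta> - of_int h / real k\<bar> \<le> 1 / (real k * real N)"
    proof -
      have "\<theta> - of_int h / real k = (real k * \<theta> - of_int h) / real k" using k by (simp add: field_simps)
      then have "\<bar>\<theta> - of_int h / real k\<bar> = \<bar>real k * \<theta> - of_int h\<bar> / real k" by simp
      also have "\<dots> \<le> (1 / real N) / real k" using hk'(4) kk by (intro divide_right_mono) auto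
      finally show ?thesis by (simp add: mult.commute)
    qed
    show ?thesis
    proof (cases "K < k")
      case True
      have "1 / (real k * real N) \<le> 1 / (real k)^2"
        using k by (simp add: power2_eq_square frac_le mult_mono)
      then have "\<bar>15000 * real Y ^ 4 * \<alpha> - of_int h / real k\<bar> \<le> 1 / (real k)^2"
        using ap by (simp add: \<theta>_def m_def)
      then show ?thesis using C(2)[OF Y K k(1) True] k(3) by (auto simp: N_def)
    next
      case False
      \<comment> \<open>The fraction \<open>h / (m * k)\<close> approximating
        \<open>\<alpha>\<close> need not be reduced, since \<open>h\<close> may share factors with
        \<open>m\<close>.\<close>
      define d where "d = gcd h (int (m * k))"
      have mk: "m * k \<ge> 1" using m k by (simp add: Suc_leI)
      have d: "d > 0" using mk by (simp add: d_def)
      define a where "a = h div d"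
      define q where "q = nat (int (m * k) div d)"
      have had: "h = a * d" by (simp add: a_def d_def)
      have mkd: "int (m * k) = int q * d" 
      proof -
        have "int (m * k) div d \<ge> 0" using d by (simp add: pos_imp_zdiv_nonneg_iff)
        then show ?thesis by (simp add: q_def d_def del: of_nat_mult)
      qed
      have q1: "q \<ge> 1" using mkd mk d by (cases q) auto
      have cop: "coprime a (int q)"
      proof -
        have "coprime (h div d) (int (m * k) div d)"
          unfolding d_def by (rule div_gcd_coprime) (use mk in auto)
        moreover have "int q = int (m * k) div d" using mkd d by simp
        ultimately show ?thesis by (simp add: a_def)
      qed
      have "q \<le> m * k"
      proof -
        have "int q * 1 \<le> int q * d" using d by (intro mult_left_mono) auto
        then show ?thesis using mkd by linarith
      qed
      also have "m * k \<le> m * K" using False by simp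
      finally have qQ: "q \<le> m * K" .
      have frac: "of_int a / real q = of_int h / (real m * real k)"
      proof -
        have "real_of_int (int (m * k)) = real_of_int (int q * d)" using mkd by simp
        then have "real m * real k = real q * of_int d" by simp
        then show ?thesis using had d q1 by simp
      qed
      have "\<alpha> - of_int a / real q = (\<theta> - of_int h / real k) / real m"
        unfolding frac \<theta>_def using m k by (simp add: field_simps)
      then have "\<bar>\<alpha> - of_int a / real q\<bar> = \<bar>\<theta> - of_int h / real k\<bar> / real m" by simp
      also have "\<dots> \<le> 1 / (real k * real N) / real m" using ap by (intro divide_right_mono) auto
      also have "\<dots> = 1 / (real (m * k) * real N)" by (simp add: mult_ac)
      also have "\<dots> \<le> 1 / (real q * real N)"
        using \<open>q \<le> m * k\<close> q1 N m k(2) by (intro divide_left_mono mult_right_mono of_nat_mono mult_pos_pos) auto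
      finally have b: "\<bar>\<alpha> - of_int a / real q\<bar> \<le> 1 / (real q * real N)" .
      have qb: "\<bar>real q * \<alpha> - of_int a\<bar> \<le> 1 / real N"
      proof -
        have "real q * \<alpha> - of_int a = real q * (\<alpha> - of_int a / real q)"
          using q1 by (simp add: field_simps)
        then have "\<bar>real q * \<alpha> - of_int a\<bar> = real q * \<bar>\<alpha> - of_int a / real q\<bar>"
          by (simp only: abs_mult abs_of_nat)
        also have "\<dots> \<le> real q * (1 / (real q * real N))" using b by (intro mult_left_mono) auto
        also have "\<dots> = 1 / real N" using q1 by simp
        finally show ?thesis .
      qed
      show ?thesis
      \<comment> \<open>\<open>N = 1\<close> is the degenerate case \<open>K = 1\<close>, in which
        the arc around 0 has radius 1 and contains every \<open>\<alpha>\<close>.\<close>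
      proof (cases "q = 1 \<or> N = 1")
        case True
        have "\<exists>k\<in>{0, 1::int}. \<bar>\<alpha> - of_int k\<bar> \<le> 1 / real N"
        proof (cases "N = 1")
          case True
          then show ?thesis using \<alpha> by (intro bexI[of _ 0]) auto
        next
          case False
          then have q: "q = 1" and N2: "N \<ge> 2" using True N by auto
          have "1 / real N \<le> 1 / 2" using N2 by (intro divide_left_mono) auto
          then have "\<bar>\<alpha> - of_int a\<bar> \<le> 1 / 2" using qb q by simp
          then have "a = 0 \<or> a = 1" using \<alpha> by linarith
          then show ?thesis using qb q by auto
        qed
        then show ?thesis by (simp add: N_def)
      next
        case False
        then have "q \<ge> 2" "N \<ge> 2" using q1 N by auto
        have "1 / real N \<le> 1 / 2" using \<open>N \<ge> 2\<close> by (intro divide_left_mono) auto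
        moreover have "0 \<le> real q * \<alpha>" "real q * \<alpha> < real q * 1" 
          using \<alpha> q1 by (auto intro!: mult_strict_left_mono)
        ultimately have "a \<ge> 0" "a \<le> int q" using qb by linarith+
        then show ?thesis using \<open>q \<ge> 2\<close> qQ cop b by (auto simp: N_def m_def)
      qed
    qed
  qed
  then show ?thesis using C(1) by blast
qed

lemma quintic_seq_poly_bounds:
  assumes Y: "Y \<ge> 1" and P: "P \<ge> 1"
  shows "norm (trig (density_poly (quintic_seq Y P) P) \<alpha>) \<le> real P"
    and "degree (value_poly (quintic_seq Y P) P) \<le> quintic_seq Y P P"
    and "degree (density_poly (quintic_seq Y P) P) \<le> quintic_seq Y P P"
    and "dist_int \<beta> > 0 \<Longrightarrow> norm (trig (density_poly (quintic_seq Y P) P) \<beta>) \<le> 1 / (625 * real Y ^ 4 * real P ^ 4 * dist_int \<beta>)"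
    and "norm (trig (value_poly (quintic_seq Y P) P) \<beta> - trig (density_poly (quintic_seq Y P) P) \<beta>) \<le> 2 * pi * \<bar>\<beta>\<bar> * (real (quintic_seq Y P P) - real (quintic_seq Y P 0))"
    and "quintic_seq Y P P \<le> T \<Longrightarrow> (\<Sum>m<T. coeff (density_poly (quintic_seq Y P) P) m ^ 2) \<le> real P / (625 * real Y ^ 4 * real P ^ 4)"
    and "quintic_seq Y P 0 \<le> m \<Longrightarrow> m < quintic_seq Y P P \<Longrightarrow> coeff (density_poly (quintic_seq Y P) P) m \<ge> 1 / (14641 * real Y ^ 4 * real P ^ 4)"
proof -
  note g = quintic_seq_props[OF Y P]
  have A: "625 * real Y ^ 4 * real P ^ 4 > 0" using Y P by simp
  note ctx = g(1) A g(2,3,4)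
  show "norm (trig (density_poly (quintic_seq Y P) P) \<alpha>) \<le> real P" by (rule norm_trig_density_poly_le[OF ctx])
  show "degree (value_poly (quintic_seq Y P) P) \<le> quintic_seq Y P P" by (rule degree_value_poly[OF ctx])
  show "degree (density_poly (quintic_seq Y P) P) \<le> quintic_seq Y P P" by (rule degree_density_poly[OF ctx])
  show "norm (trig (density_poly (quintic_seq Y P) P) \<beta>) \<le> 1 / (625 * real Y ^ 4 * real P ^ 4 * dist_int \<beta>)" if "dist_int \<beta> > 0"
    by (rule density_poly_decay[OF ctx that]) (use P in auto)
  show "norm (trig (value_poly (quintic_seq Y P) P) \<beta> - trig (density_poly (quintic_seq Y P) P) \<beta>) \<le> 2 * pi * \<bar>\<beta>\<bar> * (real (quintic_seq Y P P) - real (quintic_seq Y P 0))"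
    by (rule value_poly_density_poly_diff[OF ctx])
  show "(\<Sum>m<T. coeff (density_poly (quintic_seq Y P) P) m ^ 2) \<le> real P / (625 * real Y ^ 4 * real P ^ 4)" if "quintic_seq Y P P \<le> T"
    by (rule sum_coeff_density_poly_sq[OF ctx that])
  show "coeff (density_poly (quintic_seq Y P) P) m \<ge> 1 / (14641 * real Y ^ 4 * real P ^ 4)" if "quintic_seq Y P 0 \<le> m" "m < quintic_seq Y P P"
    by (rule coeff_density_poly_ge[OF ctx that])
qed

text \<open>Two factors go to Parseval and the other \<open>n\<close> are bounded by
  \<open>P\<close>. As the coefficients of the density are of order \<open>P ^ (-4)\<close>, the
  mean has order \<open>P ^ (n - 3)\<close>. For \<open>value_poly\<close>, with coefficients of
  order 1, the same argument would lose \<open>P ^ 4\<close>; this is why all mean values are taken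
  of the density.\<close>

lemma parseval_density_poly_quintic_seq:
  assumes Y: "Y \<ge> 1" and P: "P \<ge> 1" and T: "T > quintic_seq Y P P"
  shows "(\<Sum>t<T. norm (trig (density_poly (quintic_seq Y P) P) (real t / real T - \<theta>)) ^ (n + 2)) 
     \<le> real T * (real P ^ n * (real P / (625 * real Y ^ 4 * real P ^ 4)))"
proof -
  define v where "v \<theta> = norm (trig (density_poly (quintic_seq Y P) P) \<theta>)" for \<theta>
  have v: "v x \<le> real P" "v x \<ge> 0" for x
    unfolding v_def using quintic_seq_poly_bounds(1)[OF Y P, of x] by simp_all
  have "(\<Sum>t<T. v (real t / real T - \<theta>) ^ (n + 2)) \<le> (\<Sum>t<T. real P ^ n * v (real t / real T - \<theta>) ^ 2)"
    unfolding power_add by (intro sum_mono mult_right_mono power_mono v) (auto simp: v)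
  also have "\<dots> = real P ^ n * (\<Sum>t<T. v (real t / real T - \<theta>) ^ 2)" by (simp add: sum_distrib_left)
  also have "(\<Sum>t<T. v (real t / real T - \<theta>) ^ 2) = real T * (\<Sum>m<T. coeff (density_poly (quintic_seq Y P) P) m ^ 2)"
    unfolding v_def by (rule parseval, rule le_less_trans[OF quintic_seq_poly_bounds(3)[OF Y P] T])
  also have "real P ^ n * (real T * (\<Sum>m<T. coeff (density_poly (quintic_seq Y P) P) m ^ 2)) \<le> real P ^ n * (real T * (real P / (625 * real Y ^ 4 * real P ^ 4)))"
    by (intro mult_left_mono quintic_seq_poly_bounds(6)[OF Y P]) (use T in auto)
  finally show ?thesis by (simp add: v_def mult_ac)
qed

text \<open>The bounds for the different kinds of arcs are added up, so that one inequality holds at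
  every \<open>\<alpha>\<close> and sums over the grid need not be split. The summands stem from the
  arc around the integers, from the density outside it, from all arcs around \<open>a / q\<close>
  with \<open>q \<ge> 2\<close>, and from the minor arcs.\<close>

lemma power_diff_pointwise:
  assumes Y: "Y \<ge> (1 :: nat)"
  shows "\<exists>C>0. \<forall>K \<alpha>. K \<ge> 1 \<longrightarrow> 0 \<le> \<alpha> \<longrightarrow> \<alpha> < 1 \<longrightarrow>
    (let f = trig (value_K Y K); v = trig (density_K Y K) in
     norm (f \<alpha> ^ 37 - v \<alpha> ^ 37) \<le> C * real K * (norm (v \<alpha>) ^ 36 + real K ^ 36) + real K ^ 70 * norm (v \<alpha>) ^ 2
      + (\<Sum>q\<in>{2..15000 * Y ^ 4 * K}. \<Sum>a\<in>reduced q. 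
           2 ^ 37 * ((norm (complete_sum (int Y) q a) / real q) ^ 37 * norm (v (\<alpha> - of_int a / real q)) ^ 37 + C * real K ^ 37))
      + C * minor_size K)"
proof -
  obtain Cm where Cm: "Cm > 0" and clsf: "\<And>K \<alpha>. K \<ge> 1 \<Longrightarrow> 0 \<le> \<alpha> \<Longrightarrow> \<alpha> < 1 \<Longrightarrow>
     (\<exists>k\<in>{0, 1::int}. \<bar>\<alpha> - of_int k\<bar> \<le> 1 / real K ^ 14) \<or>
     norm (trig (value_K Y K) \<alpha>) ^ 37 \<le> Cm * minor_size K \<or>
     (\<exists>q a. 2 \<le> q \<and> q \<le> 15000 * Y ^ 4 * K \<and> a \<in> {0..int q} \<and> coprime a (int q) \<and> \<bar>\<alpha> - of_int a / real q\<bar> \<le> 1 / (real q * real K ^ 14))"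
    using circle_classification Y by blast
  \<comment> \<open>\<open>e1 * K\<close> bounds the error of replacing \<open>value_poly\<close> by
    \<open>density_poly\<close> on an arc. \<open>e2\<close> adds the error of
    \<open>major_bound\<close>, twice \<open>q + e1 * K\<close>, where
    \<open>q \<le> 15000 * Y ^ 4 * K\<close>.\<close>
  define e1 where "e1 = 2 * pi * (14641 * real Y ^ 4)"
  define e2 where "e2 = 3 * e1 + 30000 * real Y ^ 4"
  have e1: "e1 \<ge> 1"
  proof -
    have "real Y ^ 4 \<ge> 1" using Y by (simp add: one_le_power)
    then have "2 * pi * (14641 * real Y ^ 4) \<ge> 2 * 1 * (14641 * 1)"
      using pi_gt3 by (intro mult_mono) auto
    then show ?thesis by (simp add: e1_def)
  qed
  have "real Y ^ 4 \<ge> 0" by simp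
  then have e2: "e2 \<ge> 1" using e1 unfolding e2_def by linarith
  define C where "C = 37 * 2 ^ 36 * e1 * (1 + e1 ^ 36) + e2 ^ 37 + Cm"
  have C: "C > 0" "C \<ge> e2 ^ 37" "C \<ge> Cm" "C \<ge> 37 * 2 ^ 36 * e1 * (1 + e1 ^ 36)"
    using e1 e2 Cm by (auto simp: C_def add_pos_pos intro!: add_nonneg_pos)
  have "norm (trig (value_K Y K) \<alpha> ^ 37 - trig (density_K Y K) \<alpha> ^ 37) 
      \<le> C * real K * (norm (trig (density_K Y K) \<alpha>) ^ 36 + real K ^ 36) + real K ^ 70 * norm (trig (density_K Y K) \<alpha>) ^ 2
      + (\<Sum>q\<in>{2..15000 * Y ^ 4 * K}. \<Sum>a\<in>reduced q. 
           2 ^ 37 * ((norm (complete_sum (int Y) q a) / real q) ^ 37 * norm (trig (density_K Y K) (\<alpha> - of_int a / real q)) ^ 37 + C * real K ^ 37))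
      + C * minor_size K"
    if K: "K \<ge> 1" and \<alpha>: "0 \<le> \<alpha>" "\<alpha> < 1" for K :: nat and \<alpha> :: real
  proof -
    define P where "P = K ^ 3"
    have P: "P \<ge> 1" using K by (simp add: P_def)
    define g where "g = quintic_seq Y P"
    define f where "f = trig (value_poly g P)"
    define v where "v = trig (density_poly g P)"
    have A: "625 * real Y ^ 4 * real P ^ 4 > 0" using Y P by simp
    define D where "D = real (g P) - real (g 0)"
    have D: "0 \<le> D" "D \<le> 14641 * real Y ^ 4 * real K ^ 15"
    proof -
      have e: "real P ^ 5 = real K ^ 15" by (simp add: P_def flip: power_mult)
      have "0 \<le> 625 * real Y ^ 4 * real P ^ 5" by simp
      also have "\<dots> \<le> D" using quintic_seq_range_bounds(1)[OF Y P] by (simp add: D_def g_def)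
      finally show "0 \<le> D" .
      show "D \<le> 14641 * real Y ^ 4 * real K ^ 15"
        using quintic_seq_range_bounds(2)[OF Y P] unfolding e by (simp add: D_def g_def)
    qed
    have E: "2 * pi * \<bar>\<beta>\<bar> * D \<le> e1 * real K" if "\<bar>\<beta>\<bar> \<le> 1 / real K ^ 14" for \<beta>
    proof -
      have "2 * pi * \<bar>\<beta>\<bar> * D \<le> 2 * pi * (1 / real K ^ 14) * (14641 * real Y ^ 4 * real K ^ 15)"
        using that D by (intro mult_mono) auto
      also have "\<dots> = e1 * (real K ^ 15 / real K ^ 14)" by (simp add: e1_def)
      also have "real K ^ 15 / real K ^ 14 = real K" using K by (simp add: eval_nat_numeral)
      finally show ?thesis .
    qed
    have fv: "norm (f \<beta> - v \<beta>) \<le> e1 * real K" if "\<bar>\<beta>\<bar> \<le> 1 / real K ^ 14" for \<beta>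
      using quintic_seq_poly_bounds(5)[OF Y P, of \<beta>] E[OF that] unfolding f_def v_def D_def g_def by linarith
    have fv2: "norm (f \<beta>) \<le> norm (v \<beta>) + e1 * real K" if "\<bar>\<beta>\<bar> \<le> 1 / real K ^ 14" for \<beta>
      using fv[OF that] norm_triangle_ineq2[of "f \<beta>" "v \<beta>"] by linarith
    define X1 where "X1 = C * real K * (norm (v \<alpha>) ^ 36 + real K ^ 36)"
    define X2 where "X2 = real K ^ 70 * norm (v \<alpha>) ^ 2"
    define x3 where "x3 q a = 2 ^ 37 * ((norm (complete_sum (int Y) q a) / real q) ^ 37 * norm (v (\<alpha> - of_int a / real q)) ^ 37 + C * real K ^ 37)" for q a
    define X3 where "X3 = (\<Sum>q\<in>{2..15000 * Y ^ 4 * K}. \<Sum>a\<in>reduced q. x3 q a)"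
    define X4 where "X4 = C * minor_size K"
    have x3: "x3 q a \<ge> 0" for q a unfolding x3_def using C(1) by (intro mult_nonneg_nonneg add_nonneg_nonneg) auto
    have nn: "X1 \<ge> 0" "X2 \<ge> 0" "X3 \<ge> 0" "X4 \<ge> 0"
      using C(1) by (auto simp: X1_def X2_def X3_def X4_def intro!: sum_nonneg x3)
    have "norm (f \<alpha> ^ 37 - v \<alpha> ^ 37) \<le> X1 + X2 + X3 + X4"
    proof (cases "\<exists>k\<in>{0, 1::int}. \<bar>\<alpha> - of_int k\<bar> \<le> 1 / real K ^ 14")
      case True
      then obtain k :: int where k: "\<bar>\<alpha> - of_int k\<bar> \<le> 1 / real K ^ 14" by blast
      have per: "f (\<alpha> - of_int k) = f \<alpha>" "v (\<alpha> - of_int k) = v \<alpha>"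
        using trig_periodic[of _ \<alpha> "- k"] by (simp_all add: f_def v_def)
      have "norm (f \<alpha> ^ 37 - v \<alpha> ^ 37) \<le> real 37 * (norm (v \<alpha>) + e1 * real K) ^ (37 - 1) * norm (f \<alpha> - v \<alpha>)"
      proof (rule norm_power_diff_le)
        show "norm (f \<alpha>) \<le> norm (v \<alpha>) + e1 * real K" using fv2[OF k] unfolding per .
      qed (use e1 in simp)
      also have "\<dots> \<le> real 37 * (2 ^ 36 * (norm (v \<alpha>) ^ 36 + (e1 * real K) ^ 36)) * (e1 * real K)"
      proof (intro mult_mono mult_left_mono)
        show "norm (f \<alpha> - v \<alpha>) \<le> e1 * real K" using fv[OF k] unfolding per .
        show "(norm (v \<alpha>) + e1 * real K) ^ (37 - 1) \<le> 2 ^ 36 * (norm (v \<alpha>) ^ 36 + (e1 * real K) ^ 36)"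
          using power_add_le[of "norm (v \<alpha>)" "e1 * real K" 36] e1 by simp
      qed (use e1 in auto)
      also have "\<dots> = (37 * 2 ^ 36 * e1) * real K * (norm (v \<alpha>) ^ 36 + e1 ^ 36 * real K ^ 36)"
        by (simp add: power_mult_distrib mult_ac)
      also have "\<dots> \<le> (37 * 2 ^ 36 * e1) * real K * ((1 + e1 ^ 36) * (norm (v \<alpha>) ^ 36 + real K ^ 36))"
      proof (rule mult_left_mono)
        have "0 \<le> e1 ^ 36 * norm (v \<alpha>) ^ 36" "0 \<le> real K ^ 36" using e1 by auto
        then show "norm (v \<alpha>) ^ 36 + e1 ^ 36 * real K ^ 36 \<le> (1 + e1 ^ 36) * (norm (v \<alpha>) ^ 36 + real K ^ 36)"
          unfolding distrib_right distrib_left mult_1 by linarith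
      qed (use e1 in auto)
      also have "\<dots> = (37 * 2 ^ 36 * e1 * (1 + e1 ^ 36)) * (real K * (norm (v \<alpha>) ^ 36 + real K ^ 36))" by simp
      also have "\<dots> \<le> C * (real K * (norm (v \<alpha>) ^ 36 + real K ^ 36))"
        by (intro mult_right_mono C(4)) auto
      also have "\<dots> = X1" by (simp add: X1_def)
      finally show ?thesis using nn by linarith
    next
      case False
      have far: "dist_int \<alpha> > 1 / real K ^ 14"
      proof -
        have "round \<alpha> = 0 \<or> round \<alpha> = 1"
          using \<alpha> of_int_round_abs_le[of \<alpha>] by linarith
        then show ?thesis using False by (auto simp: dist_int_def)
      qed
      have nd0: "dist_int \<alpha> > 0" using far K by (meson divide_pos_pos less_trans of_nat_0_less_iff zero_less_one zero_less_power less_le_trans)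
      \<comment> \<open>By \<open>density_poly_decay\<close>, since
        \<open>P ^ 4 / K ^ 14 = 1 / K ^ 2\<close>. Hence the 37th power is at most
        \<open>K ^ 70\<close> times a square, and the square is left for Parseval.\<close>
      have vs: "norm (v \<alpha>) \<le> real K ^ 2"
      proof -
        have "norm (v \<alpha>) \<le> 1 / (625 * real Y ^ 4 * real P ^ 4 * dist_int \<alpha>)"
          unfolding v_def g_def by (rule quintic_seq_poly_bounds(4)[OF Y P nd0])
        also have "\<dots> \<le> 1 / (real K ^ 12 * (1 / real K ^ 14))"
        proof (rule divide_left_mono)
          have "real K ^ 12 * (1 / real K ^ 14) \<le> (625 * real Y ^ 4 * real P ^ 4) * dist_int \<alpha>"
          proof (intro mult_mono)
            have "1 \<le> real Y ^ 4" using Y by (simp add: one_le_power)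
            then have "1 \<le> 625 * real Y ^ 4" by linarith
            then have "1 * real K ^ 12 \<le> (625 * real Y ^ 4) * real K ^ 12" by (rule mult_right_mono) simp
            then show "real K ^ 12 \<le> 625 * real Y ^ 4 * real P ^ 4" by (simp add: P_def flip: power_mult)
          qed (use far in auto)
          then show "real K ^ 12 * (1 / real K ^ 14) \<le> 625 * real Y ^ 4 * real P ^ 4 * dist_int \<alpha>" .
        qed (use nd0 A K in auto)
        also have "\<dots> = real K ^ 2" using K by (simp add: eval_nat_numeral)
        finally show ?thesis .
      qed
      have "norm (v \<alpha>) ^ 37 = norm (v \<alpha>) ^ 35 * norm (v \<alpha>) ^ 2" by (simp flip: power_add)
      also have "\<dots> \<le> (real K ^ 2) ^ 35 * norm (v \<alpha>) ^ 2"
        using vs by (intro mult_right_mono power_mono) auto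
      also have "\<dots> = X2" by (simp add: X2_def flip: power_mult)
      finally have v37: "norm (v \<alpha>) ^ 37 \<le> X2" .
      have f37: "norm (f \<alpha>) ^ 37 \<le> X3 + X4"
      proof (cases "norm (f \<alpha>) ^ 37 \<le> Cm * minor_size K")
        case True
        also have "Cm * minor_size K \<le> X4" unfolding X4_def using C(3) by (intro mult_right_mono) auto
        finally show ?thesis using nn by linarith
      next
        case nm: False
        obtain q a where qa: "2 \<le> q" "q \<le> 15000 * Y ^ 4 * K" "a \<in> {0..int q}" "coprime a (int q)"
          and b: "\<bar>\<alpha> - of_int a / real q\<bar> \<le> 1 / (real q * real K ^ 14)"
          using clsf[OF K \<alpha>] False nm unfolding f_def g_def P_def by blast
        define \<beta> where "\<beta> = \<alpha> - of_int a / real q"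
        define s where "s = norm (complete_sum (int Y) q a) / real q"
        have s: "0 \<le> s" "s \<le> 1" using norm_complete_sum_le[of "int Y" q a] qa(1) by (auto simp: s_def field_simps)
        have qb: "real q * \<bar>\<beta>\<bar> \<le> 1 / real K ^ 14"
          using mult_left_mono[OF b, of "real q"] qa(1) by (simp add: \<beta>_def)
        have "1 * \<bar>\<beta>\<bar> \<le> real q * \<bar>\<beta>\<bar>" using qa(1) by (intro mult_right_mono) auto
        then have b1: "\<bar>\<beta>\<bar> \<le> 1 / real K ^ 14" using qb by linarith
        have "norm (f \<alpha>) \<le> s * norm (f \<beta>) + 2 * (real q + 2 * pi * \<bar>\<beta>\<bar> * real q * D)"
          unfolding f_def s_def D_def g_def by (rule value_poly_quintic_seq_major[OF Y P]) (use qa(1) in \<open>auto simp: \<beta>_def\<close>)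
        also have "2 * pi * \<bar>\<beta>\<bar> * real q * D = 2 * pi * \<bar>real q * \<beta>\<bar> * D" by (simp add: abs_mult mult_ac)
        also have "\<dots> \<le> e1 * real K" by (rule E) (use qb in \<open>simp add: abs_mult\<close>)
        also have "s * norm (f \<beta>) \<le> s * (norm (v \<beta>) + e1 * real K)"
          using fv2[OF b1] s by (intro mult_left_mono) auto
        also have "\<dots> = s * norm (v \<beta>) + s * (e1 * real K)" by (simp add: distrib_left)
        also have "s * (e1 * real K) \<le> 1 * (e1 * real K)"
          using s e1 by (intro mult_right_mono) auto
        also have "real q \<le> 15000 * real Y ^ 4 * real K"
          using of_nat_mono[OF qa(2), where ?'a = real] by simp
        finally have "norm (f \<alpha>) \<le> s * norm (v \<beta>) + e2 * real K" by (simp add: e2_def algebra_simps)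
        then have "norm (f \<alpha>) ^ 37 \<le> (s * norm (v \<beta>) + e2 * real K) ^ 37" by (intro power_mono) auto
        also have "\<dots> \<le> 2 ^ 37 * ((s * norm (v \<beta>)) ^ 37 + (e2 * real K) ^ 37)"
          using s e2 by (intro power_add_le) auto
        also have "\<dots> = 2 ^ 37 * (s ^ 37 * norm (v \<beta>) ^ 37 + e2 ^ 37 * real K ^ 37)"
          by (simp add: power_mult_distrib)
        also have "\<dots> \<le> x3 q a"
          unfolding x3_def s_def \<beta>_def using C(2) by (intro mult_left_mono add_left_mono mult_right_mono) auto
        \<comment> \<open>The term of the one arc containing \<open>\<alpha>\<close> is bounded by
          the sum over all arcs; averaged over the grid, each of these is affordable.\<close>
        also have "x3 q a \<le> (\<Sum>a\<in>reduced q. x3 q a)"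
        proof (rule member_le_sum)
          show "finite (reduced q)" by (rule finite_subset[of _ "{0..int q}"]) auto
        qed (use qa x3 in auto)
        also have "\<dots> \<le> X3" unfolding X3_def
          by (rule member_le_sum[of q _ "\<lambda>q. \<Sum>a\<in>reduced q. x3 q a"]) (use qa x3 in \<open>auto intro!: sum_nonneg\<close>)
        finally show ?thesis using nn by linarith
      qed
      have "norm (f \<alpha> ^ 37 - v \<alpha> ^ 37) \<le> norm (f \<alpha>) ^ 37 + norm (v \<alpha>) ^ 37"
        by (metis norm_power norm_triangle_ineq4)
      then show ?thesis using v37 f37 nn by linarith
    qed
    then show ?thesis unfolding X1_def X2_def X3_def X4_def x3_def f_def v_def g_def P_def .
  qed
  then show ?thesis using C(1) unfolding Let_def by blast
qed

section \<open>The main term and the error term\<close>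

lemma trig_diff: "trig (p - q) \<alpha> = trig p \<alpha> - trig q \<alpha>"
  using trig_add[of "p - q" q \<alpha>] by simp

text \<open>Next to the part \<open>Z\<close> of the pointwise bound, whose mean is under control,
  the transforms of \<open>U\<close> and \<open>U'\<close> are bounded by their cardinalities. Next
  to the uniform minor arc bound their product is replaced by the sum of squares, and Parseval gives
  \<open>card U + card U'\<close> instead of \<open>card U * card U'\<close>. The only term of full
  order \<open>K ^ 96\<close> is the one with the factor \<open>\<eta>\<close>.\<close>

lemma coefficient_difference:
  fixes \<eta> :: real
  assumes Y: "Y \<ge> (1 :: nat)"
    and \<eta>: "\<And>Q. (\<Sum>q\<in>{2..Q}. \<Sum>a\<in>reduced q. (norm (complete_sum (int Y) q a) / real q) ^ 37) \<le> \<eta>"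
  shows "\<exists>C>0. \<forall>K U U' B n. K \<ge> 1 \<longrightarrow> finite U \<longrightarrow> finite U' \<longrightarrow> U \<subseteq> {..B} \<longrightarrow> U' \<subseteq> {..B} \<longrightarrow>
    \<bar>coeff (value_K Y K ^ 37 * (indicator_poly U * indicator_poly U')) n - coeff (density_K Y K ^ 37 * (indicator_poly U * indicator_poly U')) n\<bar>
     \<le> real (card U) * real (card U') * (2 ^ 37 * \<eta> * (real K ^ 96 / (625 * real Y ^ 4)) + C * real K ^ 94) 
        + C * minor_size K * (real (card U) + real (card U'))"
proof -
  obtain C0 where C0: "C0 > 0" and pw: "\<And>K \<alpha>. K \<ge> 1 \<Longrightarrow> 0 \<le> \<alpha> \<Longrightarrow> \<alpha> < 1 \<Longrightarrow>
     norm (trig (value_K Y K) \<alpha> ^ 37 - trig (density_K Y K) \<alpha> ^ 37) 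
      \<le> C0 * real K * (norm (trig (density_K Y K) \<alpha>) ^ 36 + real K ^ 36) + real K ^ 70 * norm (trig (density_K Y K) \<alpha>) ^ 2
      + (\<Sum>q\<in>{2..15000 * Y ^ 4 * K}. \<Sum>a\<in>reduced q. 
           2 ^ 37 * ((norm (complete_sum (int Y) q a) / real q) ^ 37 * norm (trig (density_K Y K) (\<alpha> - of_int a / real q)) ^ 37 + C0 * real K ^ 37))
      + C0 * minor_size K"
    using power_diff_pointwise[OF Y] unfolding Let_def by blast
  define R where "R = 15000 * real Y ^ 4"
  define C where "C = 2 * C0 + 1 + 2 ^ 38 * C0 * R ^ 2"
  have C: "C \<ge> C0" "C > 0" using C0 by (auto simp: C_def intro!: add_pos_nonneg)
  have "\<bar>coeff (value_K Y K ^ 37 * (indicator_poly U * indicator_poly U')) n - coeff (density_K Y K ^ 37 * (indicator_poly U * indicator_poly U')) n\<bar>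
     \<le> real (card U) * real (card U') * (2 ^ 37 * \<eta> * (real K ^ 96 / (625 * real Y ^ 4)) + C * real K ^ 94) 
        + C * minor_size K * (real (card U) + real (card U'))"
    if K: "K \<ge> 1" and fin: "finite U" "finite U'" and sub: "U \<subseteq> {..B}" "U' \<subseteq> {..B}" for K U U' B n
  proof -
    define P where "P = K ^ 3"
    have P: "P \<ge> 1" using K by (simp add: P_def)
    define f where "f = value_poly (quintic_seq Y P) P"
    define v where "v = density_poly (quintic_seq Y P) P"
    \<comment> \<open>Larger than \<open>n\<close> and than the degrees of all polynomials involved,
      so that inversion and Parseval on the grid are exact.\<close>
    define T where "T = Suc (37 * quintic_seq Y P P + (B + B) + n)"
    have T0: "T > 0" by (simp add: T_def)
    have subT: "U \<subseteq> {..<T}" "U' \<subseteq> {..<T}" using sub by (auto simp: T_def)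
    define p where "p = (f ^ 37 - v ^ 37) * (indicator_poly U * indicator_poly U')"
    have "degree (f ^ 37) \<le> degree f * 37" "degree (v ^ 37) \<le> degree v * 37"
      by (rule degree_power_le)+
    then have "degree (f ^ 37) \<le> 37 * quintic_seq Y P P" "degree (v ^ 37) \<le> 37 * quintic_seq Y P P"
      using quintic_seq_poly_bounds(2,3)[OF Y P] unfolding f_def v_def by linarith+
    then have d1: "degree (f ^ 37 - v ^ 37) \<le> 37 * quintic_seq Y P P" by (rule degree_diff_le)
    have d2: "degree (indicator_poly U * indicator_poly U') \<le> B + B"
      using degree_mult_le[of "indicator_poly U" "indicator_poly U'"] degree_indicator_poly[OF fin(1) sub(1)] degree_indicator_poly[OF fin(2) sub(2)] by linarith
    have dp: "degree p < T"
      using degree_mult_le[of "f ^ 37 - v ^ 37" "indicator_poly U * indicator_poly U'"] d1 d2 unfolding p_def T_def by linarith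
    have cp: "coeff p n = coeff (f ^ 37 * (indicator_poly U * indicator_poly U')) n - coeff (v ^ 37 * (indicator_poly U * indicator_poly U')) n"
      by (simp add: p_def left_diff_distrib)
    define u where "u = real (card U)"
    define u' where "u' = real (card U')"
    define vt where "vt \<theta> = norm (trig v \<theta>)" for \<theta>
    define Z where "Z \<alpha> = C0 * real K * (vt \<alpha> ^ 36 + real K ^ 36) + real K ^ 70 * vt \<alpha> ^ 2
      + (\<Sum>q\<in>{2..15000 * Y ^ 4 * K}. \<Sum>a\<in>reduced q. 
           2 ^ 37 * ((norm (complete_sum (int Y) q a) / real q) ^ 37 * vt (\<alpha> - of_int a / real q) ^ 37 + C0 * real K ^ 37))" for \<alpha>
    define \<mu> where "\<mu> = C0 * minor_size K"
    have Z0: "Z \<alpha> \<ge> 0" for \<alpha>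
      unfolding Z_def vt_def using C0 by (intro add_nonneg_nonneg sum_nonneg mult_nonneg_nonneg) auto
    have \<mu>0: "\<mu> \<ge> 0" using C0 by (simp add: \<mu>_def)
    define a where "a t = real t / real T" for t
    define ut where "ut t = norm (trig (indicator_poly U) (a t))" for t
    define ut' where "ut' t = norm (trig (indicator_poly U') (a t))" for t
    have ut: "0 \<le> ut t" "ut t \<le> u" "0 \<le> ut' t" "ut' t \<le> u'" for t
      unfolding ut_def ut'_def u_def u'_def by (auto intro: norm_trig_indicator_poly_le)
    have "real T * \<bar>coeff p n\<bar> = norm (of_nat T * of_real (coeff p n) :: complex)" by (simp add: norm_mult)
    also have "of_nat T * of_real (coeff p n) = (\<Sum>t<T. trig p (real t / real T) * unit_exp (- (real t / real T * real n)))"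
      by (rule coeff_trig[symmetric, OF dp]) (simp add: T_def)
    also have "norm \<dots> \<le> (\<Sum>t<T. (Z (a t) + \<mu>) * (ut t * ut' t))"
    proof (rule sum_norm_le)
      fix t assume t: "t \<in> {..<T}"
      have "norm (trig p (real t / real T) * unit_exp (- (real t / real T * real n))) = norm (trig f (a t) ^ 37 - trig v (a t) ^ 37) * (ut t * ut' t)"
        by (simp add: norm_mult p_def trig_mult trig_power ut_def ut'_def a_def trig_diff)
      also have "\<dots> \<le> (Z (a t) + \<mu>) * (ut t * ut' t)"
      proof (rule mult_right_mono)
        show "norm (trig f (a t) ^ 37 - trig v (a t) ^ 37) \<le> Z (a t) + \<mu>"
          unfolding Z_def \<mu>_def vt_def f_def v_def P_def by (rule pw[OF K]) (use t in \<open>auto simp: a_def\<close>)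
      qed (use ut in auto)
      finally show "norm (trig p (real t / real T) * unit_exp (- (real t / real T * real n))) \<le> (Z (a t) + \<mu>) * (ut t * ut' t)" .
    qed
    also have "\<dots> \<le> (\<Sum>t<T. Z (a t) * (u * u') + \<mu> * (ut t ^ 2 + ut' t ^ 2))"
    proof (rule sum_mono)
      fix t
      have "Z (a t) * (ut t * ut' t) \<le> Z (a t) * (u * u')"
        using ut[of t] Z0 by (intro mult_left_mono mult_mono) auto
      moreover have "ut t * ut' t \<le> ut t ^ 2 + ut' t ^ 2"
      proof -
        have "2 * ut t * ut' t \<le> ut t ^ 2 + ut' t ^ 2" by (rule sum_squares_bound)
        moreover have "0 \<le> ut t * ut' t" using ut[of t] by simp
        ultimately show ?thesis by linarith
      qed
      then have "\<mu> * (ut t * ut' t) \<le> \<mu> * (ut t ^ 2 + ut' t ^ 2)" using \<mu>0 by (rule mult_left_mono)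
      ultimately show "(Z (a t) + \<mu>) * (ut t * ut' t) \<le> Z (a t) * (u * u') + \<mu> * (ut t ^ 2 + ut' t ^ 2)"
        by (simp add: distrib_right)
    qed
    also have "\<dots> = (\<Sum>t<T. Z (a t)) * (u * u') + \<mu> * ((\<Sum>t<T. ut t ^ 2) + (\<Sum>t<T. ut' t ^ 2))"
      by (simp add: sum.distrib sum_distrib_left sum_distrib_right distrib_left)
    also have "(\<Sum>t<T. ut t ^ 2) = real T * u"
    proof -
      have "degree (indicator_poly U) < T" using degree_indicator_poly[OF fin(1) sub(1)] by (simp add: T_def)
      from parseval[OF this, of 0] show ?thesis
        unfolding ut_def a_def u_def sum_coeff_indicator_poly_sq[OF fin(1) subT(1)] by simp
    qed
    also have "(\<Sum>t<T. ut' t ^ 2) = real T * u'"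
    proof -
      have "degree (indicator_poly U') < T" using degree_indicator_poly[OF fin(2) sub(2)] by (simp add: T_def)
      from parseval[OF this, of 0] show ?thesis
        unfolding ut'_def a_def u'_def sum_coeff_indicator_poly_sq[OF fin(2) subT(2)] by simp
    qed
    also have "(\<Sum>t<T. Z (a t)) * (u * u') + \<mu> * (real T * u + real T * u') \<le> real T * (2 ^ 37 * \<eta> * (real K ^ 96 / (625 * real Y ^ 4)) + C * real K ^ 94) * (u * u') + \<mu> * (real T * u + real T * u')"
    proof (intro add_right_mono mult_right_mono)
      show "(\<Sum>t<T. Z (a t)) \<le> real T * (2 ^ 37 * \<eta> * (real K ^ 96 / (625 * real Y ^ 4)) + C * real K ^ 94)"
      proof -
        have gT: "T > quintic_seq Y P P" by (simp add: T_def)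
        define A where "A = 625 * real Y ^ 4"
        have Y41: "1 \<le> real Y ^ 4" using Y by (simp add: one_le_power)
        have A1: "A \<ge> 1" using Y41 unfolding A_def by linarith
        have pv: "(\<Sum>t<T. vt (a t - \<theta>) ^ (m + 2)) \<le> real T * (real K ^ (3 * m) / (A * real K ^ 9))" for \<theta> m
        proof -
          have "(\<Sum>t<T. vt (a t - \<theta>) ^ (m + 2)) \<le> real T * (real P ^ m * (real P / (625 * real Y ^ 4 * real P ^ 4)))"
            unfolding vt_def v_def a_def by (rule parseval_density_poly_quintic_seq[OF Y P gT])
          also have "real P ^ m * (real P / (625 * real Y ^ 4 * real P ^ 4)) = real P ^ m / (A * real P ^ 3)"
            using P by (simp add: A_def eval_nat_numeral)
          also have "\<dots> = real K ^ (3 * m) / (A * real K ^ 9)" by (simp add: P_def power_mult flip: power_mult)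
          finally show ?thesis .
        qed
        have s1: "(\<Sum>t<T. vt (a t) ^ 36) \<le> real T * real K ^ 93"
        proof -
          have "(\<Sum>t<T. vt (a t) ^ 36) \<le> real T * (real K ^ 102 / (A * real K ^ 9))" using pv[of 0 34] by simp
          also have "real K ^ 102 / (A * real K ^ 9) = real K ^ 93 / A"
          proof -
            have e: "real K ^ 102 = real K ^ 93 * real K ^ 9" by (simp flip: power_add)
            show ?thesis unfolding e using K by (intro nonzero_mult_divide_mult_cancel_right) simp
          qed
          also have "\<dots> \<le> real K ^ 93 / 1" using A1 by (intro divide_left_mono) auto
          finally show ?thesis by (simp add: mult_left_mono)
        qed
        have s2: "(\<Sum>t<T. vt (a t) ^ 2) \<le> real T * 1"
        proof -
          have "(\<Sum>t<T. vt (a t) ^ 2) \<le> real T * (1 / (A * real K ^ 9))" using pv[of 0 0] by (simp add: power2_eq_square)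
          also have "1 / (A * real K ^ 9) \<le> 1"
          proof -
            have "1 * 1 \<le> A * real K ^ 9" using A1 K by (intro mult_mono) (auto simp: one_le_power)
            then show ?thesis by simp
          qed
          finally show ?thesis by (simp add: mult_left_mono)
        qed
        have s3: "(\<Sum>t<T. vt (a t - \<theta>) ^ 37) \<le> real T * (real K ^ 96 / A)" for \<theta>
        proof -
          have "(\<Sum>t<T. vt (a t - \<theta>) ^ 37) \<le> real T * (real K ^ 105 / (A * real K ^ 9))" using pv[of \<theta> 35] by simp
          also have "real K ^ 105 / (A * real K ^ 9) = real K ^ 96 / A"
          proof -
            have e: "real K ^ 105 = real K ^ 96 * real K ^ 9" by (simp flip: power_add)
            show ?thesis unfolding e using K by (intro nonzero_mult_divide_mult_cancel_right) simp
          qed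
          finally show ?thesis .
        qed
        define Q where "Q = 15000 * Y ^ 4 * K"
        have QR: "real Q = R * real K" by (simp add: Q_def R_def)
        have Q1: "Q \<ge> 1" using Y K by (simp add: Q_def Suc_leI)
        define S where "S q = reduced q" for q
        define cs where "cs q a = (norm (complete_sum (int Y) q a) / real q) ^ 37" for q a
        have cs0: "cs q a \<ge> 0" for q a by (simp add: cs_def)
        have cardS: "real (card (S q)) \<le> real Q + 1" if "q \<le> Q" for q
        proof -
          have "card (S q) \<le> card {0..int q}" unfolding S_def by (intro card_mono) auto
          also have "\<dots> \<le> Q + 1" using that by simp
          finally have "real (card (S q)) \<le> real (Q + 1)" by (rule of_nat_mono)
          then show ?thesis by simp
        qed
        have "(\<Sum>t<T. \<Sum>q\<in>{2..Q}. \<Sum>b\<in>S q. 2 ^ 37 * (cs q b * vt (a t - of_int b / real q) ^ 37 + C0 * real K ^ 37))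
           = (\<Sum>q\<in>{2..Q}. \<Sum>b\<in>S q. 2 ^ 37 * (cs q b * (\<Sum>t<T. vt (a t - of_int b / real q) ^ 37) + real T * (C0 * real K ^ 37)))"
        proof -
          have "(\<Sum>t<T. \<Sum>q\<in>{2..Q}. \<Sum>b\<in>S q. F t q b) = (\<Sum>q\<in>{2..Q}. \<Sum>b\<in>S q. \<Sum>t<T. F t q b)" for F :: "nat \<Rightarrow> nat \<Rightarrow> int \<Rightarrow> real"
          proof -
            have "(\<Sum>t<T. \<Sum>q\<in>{2..Q}. \<Sum>b\<in>S q. F t q b) = (\<Sum>q\<in>{2..Q}. \<Sum>t<T. \<Sum>b\<in>S q. F t q b)" by (rule sum.swap)
            also have "\<dots> = (\<Sum>q\<in>{2..Q}. \<Sum>b\<in>S q. \<Sum>t<T. F t q b)" by (rule sum.cong[OF refl sum.swap])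
            finally show ?thesis .
          qed
          note sw = this
          show ?thesis unfolding sw
            by (intro sum.cong refl, simp only: sum_distrib_left[symmetric] sum.distrib sum_constant card_lessThan, simp)
        qed
        also have "\<dots> \<le> (\<Sum>q\<in>{2..Q}. \<Sum>b\<in>S q. 2 ^ 37 * (cs q b * (real T * (real K ^ 96 / A)) + real T * (C0 * real K ^ 37)))"
          by (intro sum_mono mult_left_mono add_right_mono s3 cs0) auto
        also have "\<dots> = real T * (2 ^ 37 * (real K ^ 96 / A) * (\<Sum>q\<in>{2..Q}. \<Sum>b\<in>S q. cs q b) + 2 ^ 37 * C0 * real K ^ 37 * (\<Sum>q\<in>{2..Q}. real (card (S q))))"
        proof -
          define c1 where "c1 = real T * (2 ^ 37 * (real K ^ 96 / A))"
          define c2 where "c2 = real T * (2 ^ 37 * C0 * real K ^ 37)"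
          have e1: "2 ^ 37 * (x * (real T * (real K ^ 96 / A)) + real T * (C0 * real K ^ 37)) = c1 * x + c2 * 1" for x
            unfolding c1_def c2_def by (simp add: algebra_simps)
          have e2: "c1 * x + c2 * y = real T * (2 ^ 37 * (real K ^ 96 / A) * x + 2 ^ 37 * C0 * real K ^ 37 * y)" for x y
            unfolding c1_def c2_def by (simp add: algebra_simps)
          have "(\<Sum>q\<in>{2..Q}. \<Sum>b\<in>S q. c1 * cs q b + c2 * 1) = c1 * (\<Sum>q\<in>{2..Q}. \<Sum>b\<in>S q. cs q b) + c2 * (\<Sum>q\<in>{2..Q}. \<Sum>b\<in>S q. 1)"
            by (simp only: sum.distrib sum_distrib_left[symmetric])
          then show ?thesis unfolding e1 e2[symmetric] by simp
        qed
        \<comment> \<open>There are at most \<open>Q * (Q + 1)\<close> arcs, a number of order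
          \<open>K ^ 2\<close>, so their errors \<open>K ^ 37\<close> add up to order
          \<open>K ^ 39\<close> only.\<close>
        also have "\<dots> \<le> real T * (2 ^ 37 * (real K ^ 96 / A) * \<eta> + 2 ^ 37 * C0 * real K ^ 37 * (2 * R ^ 2 * real K ^ 2))"
        proof (intro mult_left_mono add_mono)
          show "(\<Sum>q\<in>{2..Q}. \<Sum>b\<in>S q. cs q b) \<le> \<eta>" unfolding cs_def S_def by (rule \<eta>)
          have "(\<Sum>q\<in>{2..Q}. real (card (S q))) \<le> (\<Sum>q\<in>{2..Q}. real Q + 1)"
            by (intro sum_mono cardS) auto
          also have "\<dots> \<le> real Q * (real Q + 1)"
            by (simp add: mult_right_mono)
          also have "\<dots> \<le> real Q * (2 * real Q)" using Q1 by (intro mult_left_mono) auto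
          also have "\<dots> = 2 * R ^ 2 * real K ^ 2" unfolding QR by (simp add: power2_eq_square)
          finally show "(\<Sum>q\<in>{2..Q}. real (card (S q))) \<le> 2 * R ^ 2 * real K ^ 2" .
        qed (use C0 A1 in auto)
        finally have s4: "(\<Sum>t<T. \<Sum>q\<in>{2..Q}. \<Sum>b\<in>S q. 2 ^ 37 * (cs q b * vt (a t - of_int b / real q) ^ 37 + C0 * real K ^ 37))
           \<le> real T * (2 ^ 37 * (real K ^ 96 / A) * \<eta> + 2 ^ 37 * C0 * real K ^ 37 * (2 * R ^ 2 * real K ^ 2))" .
        have "(\<Sum>t<T. Z (a t)) = C0 * real K * ((\<Sum>t<T. vt (a t) ^ 36) + real T * real K ^ 36) + real K ^ 70 * (\<Sum>t<T. vt (a t) ^ 2)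
           + (\<Sum>t<T. \<Sum>q\<in>{2..Q}. \<Sum>b\<in>S q. 2 ^ 37 * (cs q b * vt (a t - of_int b / real q) ^ 37 + C0 * real K ^ 37))"
          unfolding Z_def Q_def[symmetric] S_def[symmetric] cs_def[symmetric]
          by (simp only: sum.distrib sum_distrib_left[symmetric] sum_constant card_lessThan)
        also have "\<dots> \<le> C0 * real K * (real T * real K ^ 93 + real T * real K ^ 36) + real K ^ 70 * (real T * 1)
           + real T * (2 ^ 37 * (real K ^ 96 / A) * \<eta> + 2 ^ 37 * C0 * real K ^ 37 * (2 * R ^ 2 * real K ^ 2))"
          using C0 by (intro add_mono mult_left_mono s1 s2 s4) auto
        also have "\<dots> = real T * (2 ^ 37 * \<eta> * (real K ^ 96 / A) + (C0 * (real K * real K ^ 93) + C0 * (real K * real K ^ 36) + real K ^ 70 + 2 ^ 38 * C0 * R ^ 2 * (real K ^ 37 * real K ^ 2)))"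
          by (simp add: algebra_simps)
        also have "\<dots> \<le> real T * (2 ^ 37 * \<eta> * (real K ^ 96 / A) + C * real K ^ 94)"
        proof (intro mult_left_mono add_left_mono)
          have pk: "real K ^ m \<le> real K ^ 94" if "m \<le> 94" for m using K that by (intro power_increasing) auto
          have "C0 * (real K * real K ^ 93) + C0 * (real K * real K ^ 36) + real K ^ 70 + 2 ^ 38 * C0 * R ^ 2 * (real K ^ 37 * real K ^ 2)
            \<le> C0 * real K ^ 94 + C0 * real K ^ 94 + real K ^ 94 + 2 ^ 38 * C0 * R ^ 2 * real K ^ 94"
          proof (intro add_mono mult_left_mono)
            show "real K * real K ^ 93 \<le> real K ^ 94" by (simp flip: power_Suc)
            show "real K * real K ^ 36 \<le> real K ^ 94" using pk[of 37] by (simp flip: power_Suc)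
            show "real K ^ 37 * real K ^ 2 \<le> real K ^ 94" using pk[of 39] by (simp flip: power_add)
          qed (use C0 pk in auto)
          also have "\<dots> = C * real K ^ 94" by (simp add: C_def algebra_simps)
          finally show "C0 * (real K * real K ^ 93) + C0 * (real K * real K ^ 36) + real K ^ 70 + 2 ^ 38 * C0 * R ^ 2 * (real K ^ 37 * real K ^ 2) \<le> C * real K ^ 94" .
        qed auto
        finally show ?thesis by (simp only: A_def)
      qed
    qed (auto simp: u_def u'_def)
    also have "real T * (2 ^ 37 * \<eta> * (real K ^ 96 / (625 * real Y ^ 4)) + C * real K ^ 94) * (u * u') + \<mu> * (real T * u + real T * u')
       = real T * (u * u' * (2 ^ 37 * \<eta> * (real K ^ 96 / (625 * real Y ^ 4)) + C * real K ^ 94) + \<mu> * (u + u'))"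
      by (simp add: algebra_simps)
    finally have "real T * \<bar>coeff p n\<bar> \<le> real T * (u * u' * (2 ^ 37 * \<eta> * (real K ^ 96 / (625 * real Y ^ 4)) + C * real K ^ 94) + \<mu> * (u + u'))"
      by (simp add: u_def u'_def)
    then have "\<bar>coeff p n\<bar> \<le> u * u' * (2 ^ 37 * \<eta> * (real K ^ 96 / (625 * real Y ^ 4)) + C * real K ^ 94) + \<mu> * (u + u')"
      using T0 by simp
    also have "\<mu> * (u + u') \<le> C * minor_size K * (u + u')"
      unfolding \<mu>_def using C(1) by (intro mult_right_mono) (auto simp: u_def u'_def)
    finally show ?thesis unfolding cp f_def v_def P_def u_def u'_def by simp
  qed
  then show ?thesis using C(2) by blast
qed

text \<open>The density is at least \<open>\<gamma>\<close> throughout the middle half of its range,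
  so \<open>coeff_power_ge\<close> bounds the coefficients of its 37th power within a quarter width
  of 37 times the midpoint. The exponent of \<open>K\<close> is
  \<open>36 * 15 - 37 * 12 = 96\<close>, and that of \<open>Y ^ 4\<close> is
  \<open>36 - 37\<close>.\<close>

lemma coefficient_main_term:
  assumes Y: "Y \<ge> (1 :: nat)" and K: "K \<ge> 1"
    and near: "\<And>u u'. u \<in> U \<Longrightarrow> u' \<in> U' \<Longrightarrow> u + u' \<le> n \<and>
      \<bar>real (n - u' - u) - 37 * ((real (quintic_seq Y (K ^ 3) 0) + real (quintic_seq Y (K ^ 3) (K ^ 3))) / 2)\<bar> \<le> width Y K / 4"
  shows "real (card U) * real (card U') * (78 ^ 36 / 14641 ^ 37 * (real K ^ 96 / real Y ^ 4)) \<le> coeff (density_K Y K ^ 37 * (indicator_poly U * indicator_poly U')) n"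
proof -
  define P where "P = K ^ 3"
  have P: "P \<ge> 1" using K by (simp add: P_def)
  define g where "g = quintic_seq Y P"
  define v where "v = density_poly g P"
  define z where "z = (real (g 0) + real (g P)) / 2"
  define \<delta> where "\<delta> = (real (g P) - real (g 0)) / 4"
  define \<gamma> where "\<gamma> = 1 / (14641 * real Y ^ 4 * real P ^ 4)"
  have Y41: "1 \<le> real Y ^ 4" using Y by (simp add: one_le_power)
  have K151: "1 \<le> real K ^ 15" using K by (simp add: one_le_power)
  have YK: "1 \<le> real Y ^ 4 * real K ^ 15" using mult_mono[OF Y41 K151] by simp
  have "real P ^ 5 = real K ^ 15" by (simp add: P_def flip: power_mult)
  then have gap: "625 * (real Y ^ 4 * real K ^ 15) \<le> real (g P) - real (g 0)"
    using quintic_seq_range_bounds(1)[OF Y P] by (simp add: g_def)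
  define D where "D = real (g P) - real (g 0)"
  have \<delta>D: "\<delta> = D / 4" by (simp add: \<delta>_def D_def)
  \<comment> \<open>The quarter width is at least \<open>625 / 4\<close> times
    \<open>Y ^ 4 * K ^ 15\<close>, which leaves ample room to absorb the 1.\<close>
  have d1: "\<delta> - 1 \<ge> 78 * (real Y ^ 4 * real K ^ 15)" and d2: "\<delta> \<ge> 1"
    using gap YK unfolding \<delta>D D_def[symmetric] by linarith+
  have dz: "\<delta> \<le> z" by (simp add: \<delta>_def z_def)
  have vge: "coeff v m \<ge> \<gamma>" if "\<bar>real m - z\<bar> \<le> \<delta>" for m
  proof -
    have "4 * z = 2 * real (g 0) + 2 * real (g P)" "4 * \<delta> = real (g P) - real (g 0)"
      by (simp_all add: z_def \<delta>_def)
    moreover have "real (g 0) < real (g P)" using gap YK by linarith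
    ultimately have "real (g 0) \<le> real m" "real m < real (g P)" using that by linarith+
    then show ?thesis unfolding v_def g_def \<gamma>_def by (intro quintic_seq_poly_bounds(7)[OF Y P]) auto
  qed
  have \<gamma>0: "\<gamma> \<ge> 0" by (simp add: \<gamma>_def)
  have low: "coeff (v ^ 37) m \<ge> \<gamma> ^ 37 * (\<delta> - 1) ^ 36" if "\<bar>real m - 37 * z\<bar> \<le> \<delta>" for m
    using coeff_power_ge[of v z \<delta> \<gamma> m 36] vge \<gamma>0 d2 dz that by (simp add: v_def coeff_density_poly_nonneg)
  have "78 ^ 36 / 14641 ^ 37 * (real K ^ 96 / real Y ^ 4) = \<gamma> ^ 37 * (78 * (real Y ^ 4 * real K ^ 15)) ^ 36"
  proof -
    define y where "y = real Y ^ 4"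
    have y: "y > 0" using Y by (simp add: y_def)
    have g: "\<gamma> ^ 37 = 1 / (14641 ^ 37 * (y ^ 36 * y) * real K ^ 444)"
    proof -
      have "\<gamma> = 1 / (14641 * y * real K ^ 12)" by (simp add: \<gamma>_def y_def P_def flip: power_mult)
      then have "\<gamma> ^ 37 = 1 / (14641 ^ 37 * y ^ 37 * (real K ^ 12) ^ 37)"
        by (simp only: power_divide power_mult_distrib power_one)
      also have "(real K ^ 12) ^ 37 = real K ^ 444" by (simp flip: power_mult)
      also have "y ^ 37 = y ^ 36 * y" by (simp flip: power_Suc2)
      finally show ?thesis .
    qed
    have h: "(78 * (y * real K ^ 15)) ^ 36 = 78 ^ 36 * (y ^ 36 * (real K ^ 96 * real K ^ 444))"
    proof -
      have "(78 * (y * real K ^ 15)) ^ 36 = 78 ^ 36 * (y ^ 36 * (real K ^ 15) ^ 36)" by (simp only: power_mult_distrib)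
      also have "(real K ^ 15) ^ 36 = real K ^ 96 * real K ^ 444" by (simp flip: power_mult power_add)
      finally show ?thesis .
    qed
    have ar: "a / b * (k / y) = 1 / (b * (e * y) * l) * (a * (e * (k * l)))" if "b \<noteq> 0" "e \<noteq> 0" "l \<noteq> 0" for a b e k l :: real
      using that y by (simp add: field_simps)
    show ?thesis unfolding y_def[symmetric] g h by (rule ar) (use y K in auto)
  qed
  also have "\<dots> \<le> \<gamma> ^ 37 * (\<delta> - 1) ^ 36"
    using d1 \<gamma>0 by (intro mult_left_mono power_mono) auto
  finally have low2: "78 ^ 36 / 14641 ^ 37 * (real K ^ 96 / real Y ^ 4) \<le> \<gamma> ^ 37 * (\<delta> - 1) ^ 36" .
  have "real (card U) * real (card U') * (78 ^ 36 / 14641 ^ 37 * (real K ^ 96 / real Y ^ 4)) = (\<Sum>u'\<in>U'. \<Sum>u\<in>U. 78 ^ 36 / 14641 ^ 37 * (real K ^ 96 / real Y ^ 4))"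
    by simp
  also have "\<dots> \<le> (\<Sum>u'\<in>U'. \<Sum>u\<in>U. coeff (v ^ 37) (n - u' - u))"
  proof (intro sum_mono)
    fix u' u assume u: "u' \<in> U'" "u \<in> U"
    have "\<bar>real (n - u' - u) - 37 * z\<bar> \<le> \<delta>" using near[OF u(2,1)] unfolding z_def \<delta>_def g_def P_def by blast
    then show "78 ^ 36 / 14641 ^ 37 * (real K ^ 96 / real Y ^ 4) \<le> coeff (v ^ 37) (n - u' - u)"
      using low low2 by fastforce
  qed
  also have "\<dots> = (\<Sum>u'\<in>U'. if u' \<le> n then (\<Sum>u\<in>U. if u \<le> n - u' then coeff (v ^ 37) (n - u' - u) else 0) else 0)"
  proof (intro sum.cong refl)
    fix u' assume u': "u' \<in> U'"
    show "(\<Sum>u\<in>U. coeff (v ^ 37) (n - u' - u)) = (if u' \<le> n then (\<Sum>u\<in>U. if u \<le> n - u' then coeff (v ^ 37) (n - u' - u) else 0) else 0)"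
    proof (cases "U = {}")
      case False
      then have "u' \<le> n" using near[OF _ u'] by force
      moreover have "u \<le> n - u'" if "u \<in> U" for u using near[OF that u'] by linarith
      ultimately show ?thesis by simp
    qed simp
  qed
  also have "\<dots> = coeff ((v ^ 37 * indicator_poly U) * indicator_poly U') n"
    by (simp only: coeff_mult_indicator_poly)
  also have "(v ^ 37 * indicator_poly U) * indicator_poly U' = v ^ 37 * (indicator_poly U * indicator_poly U')" by (simp only: mult.assoc)
  finally show ?thesis by (simp add: v_def g_def P_def)
qed

section \<open>Representations of large numbers\<close>

lemma representable_lessThan: "representable r k n \<longleftrightarrow> (\<exists>x. (\<forall>i<r. x i > 0) \<and> n = (\<Sum>i<r. x i ^ k))"
proof
  assume "representable r k n"
  then obtain x where x: "\<forall>i\<in>{1..r}. x i > 0" "n = (\<Sum>i=1..r. x i ^ k)" unfolding representable_def by blast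
  have "(\<Sum>i=1..r. x i ^ k) = (\<Sum>i<r. x (Suc i) ^ k)"
    by (rule sum.reindex_bij_witness[of _ Suc "\<lambda>i. i - 1"]) auto
  then show "\<exists>x. (\<forall>i<r. x i > 0) \<and> n = (\<Sum>i<r. x i ^ k)"
    using x by (intro exI[of _ "\<lambda>i. x (Suc i)"]) auto
next
  assume "\<exists>x. (\<forall>i<r. x i > 0) \<and> n = (\<Sum>i<r. x i ^ k)"
  then obtain x where x: "\<forall>i<r. x i > 0" "n = (\<Sum>i<r. x i ^ k)" by blast
  have "(\<Sum>i<r. x i ^ k) = (\<Sum>i=1..r. x (i - 1) ^ k)"
    by (rule sum.reindex_bij_witness[of _ "\<lambda>i. i - 1" Suc]) auto
  then show "representable r k n"
    unfolding representable_def using x by (intro exI[of _ "\<lambda>i. x (i - 1)"]) auto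
qed

lemma representable_add:
  assumes "representable a k m" "representable b k n"
  shows "representable (a + b) k (m + n)"
proof -
  obtain x y where x: "\<forall>i<a. x i > 0" "m = (\<Sum>i<a. x i ^ k)" and y: "\<forall>i<b. y i > 0" "n = (\<Sum>i<b. y i ^ k)"
    using assms unfolding representable_lessThan by blast
  define z where "z i = (if i < a then x i else y (i - a))" for i
  have "(\<Sum>i<a + b. z i ^ k) = (\<Sum>i<a. z i ^ k) + (\<Sum>i<b. z (a + i) ^ k)"
    by (induction b) (simp_all add: add_ac)
  also have "\<dots> = m + n" by (simp add: z_def x(2) y(2))
  finally have "m + n = (\<Sum>i<a + b. z i ^ k)" by simp
  moreover have "\<forall>i<a + b. z i > 0" using x(1) y(1) by (auto simp: z_def)
  ultimately show ?thesis unfolding representable_lessThan by blast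
qed

lemma representable_ones: "representable r k r"
  unfolding representable_lessThan by (intro exI[of _ "\<lambda>_. 1"]) auto

lemma representable_finite_sum:
  assumes "finite J" "\<And>i. i \<in> J \<Longrightarrow> x i > 0"
  shows "representable (card J) k (\<Sum>i\<in>J. x i ^ k)"
  using assms
proof (induction J rule: finite_induct)
  case empty
  then show ?case using representable_ones[of 0] by simp
next
  case (insert i J)
  have "representable 1 k (x i ^ k)"
    unfolding representable_lessThan using insert.prems by (intro exI[of _ "\<lambda>_. x i"]) auto
  from representable_add[OF this insert.IH] show ?case using insert by simp
qed

section \<open>Choosing the scale \<open>K\<close> for a given target\<close>

definition centre :: "nat \<Rightarrow> nat \<Rightarrow> real" where
  "centre Y K = 37 * ((real (quintic_seq Y (K ^ 3) 0) + real (quintic_seq Y (K ^ 3) (K ^ 3))) / 2)"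

lemma quintic_diff_upper:
  assumes "Y \<ge> 1" "x \<ge> 0"
  shows "quintic Y (x + int d) - quintic Y x \<le> int d * (14641 * Y ^ 4 * (x + int d) ^ 4)"
proof (induction d)
  case (Suc d)
  have "quintic Y (x + int d + 1) - quintic Y (x + int d) \<le> 14641 * Y ^ 4 * (x + int d + 1) ^ 4"
    using assms by (intro quintic_step_upper) auto
  moreover have "int d * (14641 * Y ^ 4 * (x + int d) ^ 4) \<le> int d * (14641 * Y ^ 4 * (x + int d + 1) ^ 4)"
    using assms by (intro mult_left_mono power_mono) auto
  ultimately show ?case using Suc.IH by (simp add: algebra_simps)
qed simp

text \<open>Passing from \<open>K\<close> to \<open>K + 1\<close> moves the argument by order
  \<open>K ^ 2\<close>, where the polynomial has slope of order \<open>K ^ 12\<close>. The resulting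
  \<open>K ^ 14\<close> is one power less than the width. The cases \<open>c = 1\<close> and
  \<open>c = 2\<close> are the two ends of the range.\<close>

lemma quintic_cube_step:
  assumes "Y \<ge> 1" "c \<ge> 1" "K \<ge> 1"
  shows "quintic (int Y) (int (c * (K + 1) ^ 3)) - quintic (int Y) (int (c * K ^ 3)) \<le> int (7 * 8 ^ 4 * 14641 * c ^ 5 * (Y ^ 4 * K ^ 14))"
proof -
  define d where "d = c * (3 * K ^ 2 + 3 * K + 1)"
  have e: "c * (K + 1) ^ 3 = c * K ^ 3 + d" by (simp add: d_def power3_eq_cube power2_eq_square algebra_simps)
  have "K + 1 \<le> 2 * K" using assms by simp
  then have "(K + 1) ^ 3 \<le> (2 * K) ^ 3" by (rule power_mono) simp
  then have b: "c * K ^ 3 + d \<le> 8 * c * K ^ 3" unfolding e[symmetric] by (simp add: power_mult_distrib)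
  have "K \<le> K ^ 2" "1 \<le> K ^ 2" using assms by (simp_all add: self_le_power)
  then have d: "d \<le> c * (7 * K ^ 2)" unfolding d_def by (intro mult_left_mono) auto
  have "quintic (int Y) (int (c * (K + 1) ^ 3)) - quintic (int Y) (int (c * K ^ 3)) \<le> int d * (14641 * int Y ^ 4 * (int (c * K ^ 3) + int d) ^ 4)"
    unfolding e using quintic_diff_upper[of "int Y" "int (c * K ^ 3)" d] assms by simp
  also have "\<dots> = int (d * (14641 * Y ^ 4 * (c * K ^ 3 + d) ^ 4))" by simp
  also have "\<dots> \<le> int (c * (7 * K ^ 2) * (14641 * Y ^ 4 * (8 * c * K ^ 3) ^ 4))"
    using b d by (intro of_nat_mono mult_mono power_mono) auto
  also have "c * (7 * K ^ 2) * (14641 * Y ^ 4 * (8 * c * K ^ 3) ^ 4) = 7 * 8 ^ 4 * 14641 * c ^ 5 * (Y ^ 4 * K ^ 14)"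
    by algebra
  finally show ?thesis .
qed

text \<open>The step is below \<open>2.6 * 10 ^ 11 * E\<close> with
  \<open>E = Y ^ 4 * K ^ 14\<close>, while a quarter of the width is at least
  \<open>625 / 4 * K * E\<close>; the threshold for \<open>K\<close> comes from comparing the
  two.\<close>

lemma centre_step:
  assumes Y: "Y \<ge> 1" and K: "K \<ge> 2 * 10 ^ 9"
  shows "centre Y (K + 1) - centre Y K \<le> width Y K / 4"
proof -
  have K1: "K \<ge> 1" using K by simp
  define p where "p c K = real_of_int (quintic (int Y) (int (c * K ^ 3)))" for c K :: nat
  have g: "real (quintic_seq Y (K ^ 3) 0) = p 1 K" "real (quintic_seq Y (K ^ 3) (K ^ 3)) = p 2 K" for K
    unfolding real_quintic_seq p_def by (simp_all only: mult_1 mult_2 add_0_right)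
  define E where "E = real Y ^ 4 * real K ^ 14"
  have E0: "E \<ge> 0" by (simp add: E_def)
  have st: "p c (K + 1) - p c K \<le> 7 * 8 ^ 4 * 14641 * real c ^ 5 * E" if c: "c \<ge> 1" for c
  proof -
    have "p c (K + 1) - p c K \<le> real_of_int (int (7 * 8 ^ 4 * 14641 * c ^ 5 * (Y ^ 4 * K ^ 14)))"
      unfolding p_def of_int_diff[symmetric] by (rule of_int_le_iff[THEN iffD2, OF quintic_cube_step[OF Y c K1]])
    also have "\<dots> = 7 * 8 ^ 4 * 14641 * real c ^ 5 * E" by (simp add: E_def)
    finally show ?thesis .
  qed
  have "centre Y (K + 1) - centre Y K = 37 * (((p 1 (K + 1) - p 1 K) + (p 2 (K + 1) - p 2 K)) / 2)"
    unfolding centre_def g by (simp add: field_simps)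
  also have "\<dots> \<le> 37 * ((7 * 8 ^ 4 * 14641 * real 1 ^ 5 * E + 7 * 8 ^ 4 * 14641 * real 2 ^ 5 * E) / 2)"
    by (intro mult_left_mono divide_right_mono add_mono st) auto
  also have "\<dots> \<le> (625 * (2 * 10 ^ 9) / 4) * E"
    using E0 by simp
  also have "\<dots> \<le> (625 * real K / 4) * E"
  proof (rule mult_right_mono)
    have "real (2 * 10 ^ 9) \<le> real K" using K by (rule of_nat_mono)
    then show "625 * (2 * 10 ^ 9) / 4 \<le> 625 * real K / 4" by simp
  qed (simp add: E_def)
  also have "\<dots> = (625 * real Y ^ 4 * real (K ^ 3) ^ 5) / 4"
    by (simp add: E_def eval_nat_numeral)
  also have "\<dots> \<le> width Y K / 4"
    using quintic_seq_range_bounds(1)[OF Y, of "K ^ 3"] K1 by (intro divide_right_mono) auto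
  finally show ?thesis .
qed

text \<open>Take the largest \<open>K\<close> whose centre does not exceed \<open>t\<close>; the
  next centre does, and by \<open>centre_step\<close> it is within a quarter width.\<close>

lemma exists_scale:
  assumes Y: "Y \<ge> 1"
  shows "\<exists>t0. \<forall>t\<ge>t0. \<exists>K\<ge>K0. K \<ge> 1 \<and> centre Y K \<le> real t \<and> real t \<le> centre Y K + width Y K / 4"
proof -
  define K1 where "K1 = max K0 (2 * 10 ^ 9)"
  have large: "real K \<le> centre Y K" if "K \<ge> 1" for K
  proof -
    have P: "K ^ 3 \<ge> 1" using that by simp
    have "real K \<le> real K ^ 15" using that by (simp add: self_le_power)
    also have "\<dots> \<le> 625 * real Y ^ 4 * real K ^ 15"
    proof -
      have "1 \<le> real Y ^ 4" using Y by (simp add: one_le_power)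
      then have "1 \<le> 625 * real Y ^ 4" by linarith
      from mult_right_mono[OF this, of "real K ^ 15"] show ?thesis by simp
    qed
    also have "real K ^ 15 = real (K ^ 3) ^ 5" by (simp flip: power_mult)
    also have "625 * real Y ^ 4 * real (K ^ 3) ^ 5 \<le> width Y K"
      by (rule quintic_seq_range_bounds(1)[OF Y P])
    also have "\<dots> \<le> centre Y K" by (simp add: centre_def)
    finally show ?thesis .
  qed
  have "\<exists>K\<ge>K0. K \<ge> 1 \<and> centre Y K \<le> real t \<and> real t \<le> centre Y K + width Y K / 4"
    if t: "t \<ge> nat \<lceil>centre Y K1\<rceil>" for t
  proof -
    define A where "A = {K. K \<ge> K1 \<and> centre Y K \<le> real t}"
    have K11: "K1 \<ge> 1" by (simp add: K1_def)
    have "centre Y K1 \<le> real t" using t by linarith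
    then have "K1 \<in> A" by (simp add: A_def)
    have "A \<subseteq> {..t}"
    proof
      fix K assume "K \<in> A"
      then have "real K \<le> real t" using large[of K] K11 by (auto simp: A_def)
      then show "K \<in> {..t}" by simp
    qed
    then have fin: "finite A" using finite_subset by blast
    define K where "K = Max A"
    have KA: "K \<in> A" unfolding K_def using fin \<open>K1 \<in> A\<close> by (intro Max_in) auto
    have "K + 1 \<notin> A"
    proof
      assume "K + 1 \<in> A"
      then have "K + 1 \<le> K" unfolding K_def using fin by (intro Max_ge)
      then show False by simp
    qed
    then have "real t < centre Y (K + 1)" using KA by (simp add: A_def)
    also have "\<dots> \<le> centre Y K + width Y K / 4"
    proof -
      have "K \<ge> 2 * 10 ^ 9" using KA by (simp add: A_def K1_def)
      from centre_step[OF Y this] show ?thesis by linarith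
    qed
    finally show ?thesis using KA by (intro exI[of _ K]) (auto simp: A_def K1_def)
  qed
  then show ?thesis by blast
qed

text \<open>The exponent of \<open>K\<close> in the second summand is \<open>96 - 481/256 + 15 * (4/5) ^ 10\<close>, which is less than 95.9.\<close>
lemma main_term_dominates:
  fixes C c a :: real
  assumes "C > 0" "c > 0" "a > 0"
  shows "\<exists>K0. \<forall>K::nat\<ge>K0. C * real K ^ 94 + C * minor_size K * (2 / (c * thickness K)) < a * real K ^ 96"
proof -
  define D where "D = 2 * C / c"
  have D: "D > 0" using assms by (simp add: D_def)
  have "eventually (\<lambda>x::real. C * x ^ 94 + D * x powr (959/10) < a * x ^ 96) at_top"
    using assms D by real_asymp
  then have "eventually (\<lambda>K. C * real K ^ 94 + D * real K powr (959/10) < a * real K ^ 96) sequentially"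
    by (rule eventually_compose_filterlim[OF _ filterlim_real_sequentially])
  then obtain K0 where K0: "\<And>K. K \<ge> K0 \<Longrightarrow> C * real K ^ 94 + D * real K powr (959/10) < a * real K ^ 96"
    unfolding eventually_sequentially by blast
  have "C * real K ^ 94 + C * minor_size K * (2 / (c * thickness K)) < a * real K ^ 96"
    if K: "K \<ge> max 1 K0" for K
  proof -
    have K1: "real K \<ge> 1" using K by simp
    have "thickness K = real K powr (15 * (1 - (4/5) ^ 10))"
      using K1 by (simp add: powr_powr flip: powr_numeral)
    then have "C * minor_size K * (2 / (c * thickness K))
      = D * (minor_size K / real K powr (15 * (1 - (4/5) ^ 10)))"
      by (simp add: D_def)
    also have "minor_size K / real K powr (15 * (1 - (4/5) ^ 10)) = real K powr (111 - 481/256 - 15 * (1 - (4/5) ^ 10))"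
      by (rule powr_diff[symmetric])
    also have "D * \<dots> \<le> D * real K powr (959/10)"
      using D K1 by (intro mult_left_mono powr_mono) (simp_all add: power_divide)
    finally show ?thesis using K0[of K] K by simp
  qed
  then show ?thesis by blast
qed

text \<open>A pair from \<open>U\<close> and \<open>U'\<close> contributes at least
  \<open>\<kappa> * k96\<close> to the main term. The tail of the singular series takes exactly half
  of this by the condition on \<open>\<eta>\<close>, and by \<open>dom\<close> the errors with a
  power saving take less than the other half. So the coefficient is positive, which can only come
  from an actual representation.\<close>

lemma exists_solution:
  fixes C \<eta> c :: real
  assumes Y: "Y \<ge> (1 :: nat)" and K: "K \<ge> 1" and c: "c > 0" and C: "C > 0"
    and diff: "\<bar>coeff (value_K Y K ^ 37 * (indicator_poly U * indicator_poly U')) t - coeff (density_K Y K ^ 37 * (indicator_poly U * indicator_poly U')) t\<bar>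
     \<le> real (card U) * real (card U') * (2 ^ 37 * \<eta> * (real K ^ 96 / (625 * real Y ^ 4)) + C * real K ^ 94) 
        + C * minor_size K * (real (card U) + real (card U'))"
    and \<eta>: "2 ^ 37 * \<eta> / 625 = 78 ^ 36 / 14641 ^ 37 / 2"
    and dom: "C * real K ^ 94 + C * minor_size K * (2 / (c * thickness K)) < 78 ^ 36 / 14641 ^ 37 / 2 / real Y ^ 4 * real K ^ 96"
    and fin: "finite U" "finite U'"
    and card: "c * thickness K \<le> real (card U)" "c * thickness K \<le> real (card U')"
    and le: "\<And>u. u \<in> U \<union> U' \<Longrightarrow> real u \<le> real K ^ 15"
    and t: "centre Y K \<le> real t" "real t \<le> centre Y K + width Y K / 4"
  shows "\<exists>(i :: nat \<Rightarrow> nat) u u'. u \<in> U \<and> u' \<in> U' \<and> t = (\<Sum>k<37. quintic_seq Y (K ^ 3) (i k)) + (u + u')"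
proof -
  define x where "x = real (card U)"
  define y where "y = real (card U')"
  define L where "L = c * thickness K"
  define E where "E = C * minor_size K"
  define \<kappa> where "\<kappa> = (78 ^ 36 / 14641 ^ 37 :: real)"
  define k96 where "k96 = real K ^ 96 / real Y ^ 4"
  have L: "L > 0" "L \<le> x" "L \<le> y" using card c K by (simp_all add: L_def x_def y_def)
  have E: "E > 0" using C K by (simp add: E_def)
  have P: "K ^ 3 \<ge> 1" using K by simp
  have gap: "2 * real K ^ 15 \<le> width Y K / 4"
  proof -
    have "1 \<le> real Y ^ 4" using Y by (simp add: one_le_power)
    then have "8 * real K ^ 15 \<le> (625 * real Y ^ 4) * real K ^ 15" by (intro mult_right_mono) auto
    also have "real K ^ 15 = real (K ^ 3) ^ 5" by (simp flip: power_mult)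
    also have "625 * real Y ^ 4 * real (K ^ 3) ^ 5 \<le> width Y K"
      by (rule quintic_seq_range_bounds(1)[OF Y P])
    finally show ?thesis by (simp add: power_mult[symmetric])
  qed
  have main: "x * y * (\<kappa> * k96) \<le> coeff (density_K Y K ^ 37 * (indicator_poly U * indicator_poly U')) t"
    unfolding x_def y_def \<kappa>_def k96_def
  proof (rule coefficient_main_term[OF Y K])
    fix u u' assume u: "u \<in> U" "u' \<in> U'"
    have b: "real u + real u' \<le> width Y K / 4"
    proof -
      have "real u \<le> real K ^ 15" "real u' \<le> real K ^ 15" using le u by blast+
      then show ?thesis using gap by linarith
    qed
    also have "\<dots> \<le> centre Y K" by (simp add: centre_def)
    finally have le_t: "real u + real u' \<le> real t" using t(1) by linarith
    then have "u + u' \<le> t" by linarith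
    moreover have "real (t - u' - u) = real t - real u' - real u" using le_t by linarith
    moreover have "\<bar>real t - real u' - real u - centre Y K\<bar> \<le> width Y K / 4"
      using b t by linarith
    ultimately show "u + u' \<le> t \<and> \<bar>real (t - u' - u) - 37 * ((real (quintic_seq Y (K ^ 3) 0) + real (quintic_seq Y (K ^ 3) (K ^ 3))) / 2)\<bar>
        \<le> width Y K / 4"
      by (simp add: centre_def)
  qed
  \<comment> \<open>This turns the Parseval term into a multiple of \<open>x * y\<close>: since both
    cardinalities are at least \<open>L\<close>, \<open>1 / x + 1 / y \<le> 2 / L\<close>.\<close>
  have e1: "E * (x + y) \<le> x * y * (E * (2 / L))"
  proof -
    have "x * L \<le> x * y" "L * y \<le> x * y" using L by (auto intro!: mult_left_mono mult_right_mono)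
    then have "(x + y) * L \<le> 2 * (x * y)" by (simp add: algebra_simps)
    then have "x + y \<le> x * y * (2 / L)" using L by (simp add: field_simps)
    then have "E * (x + y) \<le> E * (x * y * (2 / L))" using E by (intro mult_left_mono) auto
    then show ?thesis by (simp add: mult_ac)
  qed
  have e2: "2 ^ 37 * \<eta> * (real K ^ 96 / (625 * real Y ^ 4)) = \<kappa> * k96 / 2"
  proof -
    have "2 ^ 37 * \<eta> * (real K ^ 96 / (625 * real Y ^ 4)) = (2 ^ 37 * \<eta> / 625) * k96" by (simp add: k96_def)
    also have "\<dots> = \<kappa> / 2 * k96" unfolding \<eta> \<kappa>_def ..
    finally show ?thesis by simp
  qed
  have e3: "x * y * (C * real K ^ 94 + E * (2 / L)) < x * y * (\<kappa> * k96 / 2)"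
  proof (rule mult_strict_left_mono)
    have "C * real K ^ 94 + E * (2 / L) < \<kappa> / 2 / real Y ^ 4 * real K ^ 96"
      unfolding E_def L_def \<kappa>_def by (rule dom)
    then show "C * real K ^ 94 + E * (2 / L) < \<kappa> * k96 / 2" by (simp add: k96_def)
  qed (use L in simp)
  have "x * y * (2 ^ 37 * \<eta> * (real K ^ 96 / (625 * real Y ^ 4)) + C * real K ^ 94) + E * (x + y)
     \<le> x * y * (\<kappa> * k96 / 2 + C * real K ^ 94) + x * y * (E * (2 / L))"
    unfolding e2 by (intro add_left_mono e1)
  also have "\<dots> = x * y * (\<kappa> * k96 / 2) + x * y * (C * real K ^ 94 + E * (2 / L))"
    by (simp only: distrib_left add.assoc)
  also have "\<dots> < x * y * (\<kappa> * k96 / 2) + x * y * (\<kappa> * k96 / 2)" using e3 by (rule add_strict_left_mono)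
  also have "\<dots> = x * y * (\<kappa> * k96)" by simp
  finally have "x * y * (2 ^ 37 * \<eta> * (real K ^ 96 / (625 * real Y ^ 4)) + C * real K ^ 94) + E * (x + y) < x * y * (\<kappa> * k96)" .
  then have "coeff (value_K Y K ^ 37 * (indicator_poly U * indicator_poly U')) t > 0"
    using diff main unfolding x_def[symmetric] y_def[symmetric] E_def[symmetric] by linarith
  then obtain m j where mj: "t = m + j" "coeff (value_K Y K ^ 37) m \<noteq> 0" "coeff (indicator_poly U * indicator_poly U') j \<noteq> 0"
    using coeff_mult_neq_0[of "value_K Y K ^ 37" "indicator_poly U * indicator_poly U'" t] by auto
  obtain u u' where u: "j = u + u'" "coeff (indicator_poly U) u \<noteq> 0" "coeff (indicator_poly U') u' \<noteq> 0"
    using coeff_mult_neq_0[OF mj(3)] by blast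
  then have uU: "u \<in> U" "u' \<in> U'" using coeff_indicator_poly[OF fin(1), of u] coeff_indicator_poly[OF fin(2), of u'] by metis+
  obtain h :: "nat \<Rightarrow> nat" where h: "\<forall>k<37. coeff (value_K Y K) (h k) \<noteq> 0" "m = (\<Sum>k<37. h k)"
    using coeff_power_neq_0[OF mj(2)] by blast
  have "\<forall>k. \<exists>i. k < 37 \<longrightarrow> h k = quintic_seq Y (K ^ 3) i" using h(1) coeff_value_poly_neq_0 by metis
  then obtain i where i: "\<And>k. k < 37 \<Longrightarrow> h k = quintic_seq Y (K ^ 3) (i k)" by metis
  have "m = (\<Sum>k<37. quintic_seq Y (K ^ 3) (i k))" unfolding h(2) using i by (intro sum.cong refl) auto
  then show ?thesis using uU u(1) mj(1) by blast
qed

lemma fifth_power_quintic_seq: "(5 * Y * (P + i) + 1) ^ 5 = 25 * Y * quintic_seq Y P i + 1"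
proof -
  have "int ((5 * Y * (P + i) + 1) ^ 5) = (5 * int Y * int (P + i) + 1) ^ 5" by (simp add: add.commute)
  also have "\<dots> = int (25 * Y * quintic_seq Y P i + 1)" unfolding quintic_eq by (simp add: int_quintic_seq)
  finally show ?thesis by (simp only: of_nat_eq_iff)
qed

lemma sum_power_mod_cong:
  fixes x y :: "nat \<Rightarrow> nat"
  assumes "\<And>j. j < r \<Longrightarrow> x j mod M = y j mod M"
  shows "(\<Sum>j<r. x j ^ k) mod M = (\<Sum>j<r. y j ^ k) mod M"
proof -
  have "(\<Sum>j<r. x j ^ k) mod M = (\<Sum>j<r. (x j ^ k) mod M) mod M" by (rule mod_sum_eq[symmetric])
  also have "\<dots> = (\<Sum>j<r. (y j ^ k) mod M) mod M"
  proof -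
    have "(x j ^ k) mod M = (y j ^ k) mod M" if "j \<in> {..<r}" for j
      using power_mod[of "x j" M k] power_mod[of "y j" M k] assms[of j] that by simp
    then have "(\<Sum>j<r. (x j ^ k) mod M) = (\<Sum>j<r. (y j ^ k) mod M)" by (rule sum.cong[OF refl])
    then show ?thesis by simp
  qed
  also have "\<dots> = (\<Sum>j<r. y j ^ k) mod M" by (rule mod_sum_eq)
  finally show ?thesis .
qed

text \<open>Ten fifth powers reach every class modulo \<open>M\<close>, and fixing the classes of
  their bases puts all the sums into class \<open>s\<close>. The quotients by \<open>M\<close> are
  then distinct, so no density is lost, and they add up with values of
  \<open>quintic\<close>.\<close>

lemma many_representable_in_class:
  assumes M: "M \<ge> (1 :: nat)" and s: "s < M"
  shows "\<exists>c>0. \<exists>X0. \<forall>X\<ge>X0. \<exists>U. finite U \<and> (\<forall>u\<in>U. real u \<le> X) \<and> c * X powr (1 - (4/5) ^ 10) \<le> real (card U) \<and>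
     (\<forall>u\<in>U. representable 10 5 (M * u + s))"
proof -
  obtain \<rho> :: "nat \<Rightarrow> nat" where \<rho>: "int M dvd (\<Sum>j<10. int (\<rho> j) ^ 5) - int s"
    using residue_sum_of_ten_fifth_powers[OF M] by blast
  have \<rho>s: "(\<Sum>j<10. \<rho> j ^ 5) mod M = s"
  proof -
    have "int (\<Sum>j<10. \<rho> j ^ 5) mod int M = int s mod int M" using \<rho> by (simp add: mod_eq_dvd_iff)
    then have "(\<Sum>j<10. \<rho> j ^ 5) mod M = s mod M" by (metis of_nat_eq_iff zmod_int)
    then show ?thesis using s by simp
  qed
  obtain c X0 where c: "c > 0" and S: "\<And>X. X \<ge> X0 \<Longrightarrow> \<exists>S. finite S \<and> (\<forall>u\<in>S. real u \<le> X) \<and> real (card S) \<ge> c * X powr (1 - (4/5) ^ 10) \<and>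
     (\<forall>u\<in>S. \<exists>x. (\<forall>j<10. x j > 0 \<and> x j mod M = \<rho> j mod M) \<and> u = (\<Sum>j<10. x j ^ 5))"
    using many_sums_of_fifth_powers[OF M, of 10 \<rho>] by blast
  have "\<exists>U. finite U \<and> (\<forall>u\<in>U. real u \<le> X) \<and> c * X powr (1 - (4/5) ^ 10) \<le> real (card U) \<and>
     (\<forall>u\<in>U. representable 10 5 (M * u + s))" if X: "X \<ge> X0" for X
  proof -
    obtain S where S: "finite S" "\<And>u. u \<in> S \<Longrightarrow> real u \<le> X" "real (card S) \<ge> c * X powr (1 - (4/5) ^ 10)"
      "\<And>u. u \<in> S \<Longrightarrow> \<exists>x. (\<forall>j<10. x j > 0 \<and> x j mod M = \<rho> j mod M) \<and> u = (\<Sum>j<10. x j ^ 5)"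
      using S[OF X] by blast
    have md: "u mod M = s" if u: "u \<in> S" for u
    proof -
      obtain x where x: "\<And>j. j < 10 \<Longrightarrow> x j mod M = \<rho> j mod M" "u = (\<Sum>j<10. x j ^ 5)" using S(4)[OF u] by blast
      then show ?thesis using sum_power_mod_cong[of 10 x M \<rho> 5] \<rho>s by simp
    qed
    have eq: "M * (u div M) + s = u" if "u \<in> S" for u using md[OF that] mult_div_mod_eq[of M u] by simp
    define U where "U = (\<lambda>u. u div M) ` S"
    have inj: "inj_on (\<lambda>u. u div M) S" using eq by (intro inj_onI) metis
    have "finite U" using S(1) by (simp add: U_def)
    moreover have "card U = card S" unfolding U_def by (rule card_image[OF inj])
    moreover have "real v \<le> X" if v: "v \<in> U" for v
    proof -
      obtain u where u: "u \<in> S" "v = u div M" using v by (auto simp: U_def)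
      have "real v \<le> real u" unfolding u(2) by (intro of_nat_mono div_le_dividend)
      then show ?thesis using S(2)[OF u(1)] by linarith
    qed
    moreover have "representable 10 5 (M * v + s)" if v: "v \<in> U" for v
    proof -
      obtain u where u: "u \<in> S" "v = u div M" using v by (auto simp: U_def)
      then show ?thesis using S(4)[OF u(1)] eq[OF u(1)] unfolding representable_lessThan by metis
    qed
    ultimately show ?thesis using S(3) by (intro exI[of _ U]) auto
  qed
  then show ?thesis using c by blast
qed

text \<open>The order of choices is what avoids circularity: \<open>\<eta>\<close> is a numerical
  constant, then \<open>w\<close>, \<open>Y\<close> and \<open>M\<close> are fixed, then
  \<open>C\<close> and \<open>c\<close>, and finally \<open>K0\<close>.\<close>

lemma representable_57_eventually: "\<exists>n0. \<forall>n\<ge>n0. representable 57 5 n"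
proof -
  define \<kappa> where "\<kappa> = (78 ^ 36 / 14641 ^ 37 :: real)"
  define \<eta> where "\<eta> = \<kappa> / 2 * 625 / 2 ^ 37"
  have \<kappa>: "\<kappa> > 0" unfolding \<kappa>_def by (intro divide_pos_pos zero_less_power) simp_all
  then have "\<eta> > 0" by (simp add: \<eta>_def)
  then obtain w where w: "w \<ge> 5" "\<And>Q. (\<Sum>q\<in>{2..Q}. \<Sum>a\<in>reduced q. (norm (complete_sum (fact w) q a) / real q) ^ 37) \<le> \<eta>"
    using complete_sum_power_sum_small by blast
  define Y where "Y = (fact w :: nat)"
  have Y: "Y \<ge> 1" by (simp add: Y_def)
  have \<eta>Y: "(\<Sum>q\<in>{2..Q}. \<Sum>a\<in>reduced q. (norm (complete_sum (int Y) q a) / real q) ^ 37) \<le> \<eta>" for Q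
    using w(2)[of Q] by (simp add: Y_def)
  define M where "M = 25 * Y"
  have M: "M \<ge> 25" using Y by (simp add: M_def)
  obtain C where C: "C > 0" and diff: "\<And>K U U' B n. K \<ge> 1 \<Longrightarrow> finite U \<Longrightarrow> finite U' \<Longrightarrow> U \<subseteq> {..B} \<Longrightarrow> U' \<subseteq> {..B} \<Longrightarrow>
    \<bar>coeff (value_K Y K ^ 37 * (indicator_poly U * indicator_poly U')) n - coeff (density_K Y K ^ 37 * (indicator_poly U * indicator_poly U')) n\<bar>
     \<le> real (card U) * real (card U') * (2 ^ 37 * \<eta> * (real K ^ 96 / (625 * real Y ^ 4)) + C * real K ^ 94) 
        + C * minor_size K * (real (card U) + real (card U'))"
    using coefficient_difference[OF Y \<eta>Y] by blast
  define good where "good s c X0 \<longleftrightarrow> c > 0 \<and> (\<forall>X\<ge>X0. \<exists>U. finite U \<and> (\<forall>u\<in>U. real u \<le> X) \<and> c * X powr (1 - (4/5) ^ 10) \<le> real (card U) \<and>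
     (\<forall>u\<in>U. representable 10 5 (M * u + s)))" for s c X0
  have "\<exists>c X0. good s c X0" if "s < M" for s
    using many_representable_in_class[OF _ that] M unfolding good_def by force
  then obtain cf Xf where gd: "\<And>s. s < M \<Longrightarrow> good s (cf s) (Xf s)" by metis
  have cX: "cf s > 0" "X \<ge> Xf s \<Longrightarrow> \<exists>U. finite U \<and> (\<forall>u\<in>U. real u \<le> X) \<and> cf s * X powr (1 - (4/5) ^ 10) \<le> real (card U) \<and>
     (\<forall>u\<in>U. representable 10 5 (M * u + s))" if "s < M" for s X
    using gd[OF that] unfolding good_def by blast+
  \<comment> \<open>There are finitely many classes \<open>s < M\<close>, so the constants can be
    made uniform in \<open>s\<close>.\<close>
  define c where "c = Min (cf ` {..<M})"
  define X0 where "X0 = Max (Xf ` {..<M})"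
  have "0 \<in> {..<M}" using M by simp
  then have ne: "{..<M} \<noteq> {}" by blast
  have c: "c > 0" unfolding c_def using ne cX(1) by (subst Min_gr_iff) auto
  have cle: "c \<le> cf s" if "s < M" for s unfolding c_def using that by (intro Min_le) auto
  have Xle: "Xf s \<le> X0" if "s < M" for s unfolding X0_def using that by (intro Max_ge) auto
  have "\<kappa> / 2 / real Y ^ 4 > 0" using Y \<kappa> by simp
  then obtain K0 where K0: "\<And>K. K \<ge> K0 \<Longrightarrow> C * real K ^ 94 + C * minor_size K * (2 / (c * thickness K)) < \<kappa> / 2 / real Y ^ 4 * real K ^ 96"
    using main_term_dominates[OF C c] by blast
  obtain t0 where t0: "\<And>t. t \<ge> t0 \<Longrightarrow> \<exists>K\<ge>max K0 (nat \<lceil>X0\<rceil>). K \<ge> 1 \<and> centre Y K \<le> real t \<and> real t \<le> centre Y K + width Y K / 4"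
    using exists_scale[OF Y, of "max K0 (nat \<lceil>X0\<rceil>)"] by blast
  have "representable 57 5 n" if n: "n \<ge> 47 + M * t0" for n
  proof -
    \<comment> \<open>\<open>47 = 37 + 10\<close>: each of the 37 fifth powers is 1 modulo
      \<open>M\<close>, the second thick set is placed in class 10, and the first one takes the
      remaining class \<open>s\<close>.\<close>
    define s where "s = (n - 47) mod M"
    define t where "t = (n - 47) div M"
    have n_eq: "n = 47 + s + M * t"
      using n div_mult_mod_eq[of "n - 47" M] unfolding s_def t_def by (simp add: mult.commute)
    have s: "s < M" using M by (simp add: s_def)
    have "t \<ge> t0"
    proof -
      have "M * t0 div M \<le> (n - 47) div M" using n by (intro div_le_mono) simp
      then show ?thesis using M by (simp add: t_def)
    qed
    then obtain K where K: "K \<ge> K0" "K \<ge> nat \<lceil>X0\<rceil>" "K \<ge> 1" 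
      and t: "centre Y K \<le> real t" "real t \<le> centre Y K + width Y K / 4"
      using t0 by (metis max.bounded_iff)
    have "X0 \<le> real K" using K(2) by linarith
    also have "real K \<le> real K ^ 15" using K(3) by (simp add: self_le_power)
    finally have X: "X0 \<le> real K ^ 15" .
    have get: "\<exists>U. finite U \<and> (\<forall>u\<in>U. real u \<le> real K ^ 15) \<and> c * thickness K \<le> real (card U) \<and>
       (\<forall>u\<in>U. representable 10 5 (M * u + s))" if s: "s < M" for s
    proof -
      have "Xf s \<le> real K ^ 15" using Xle[OF s] X by linarith
      then obtain U where U: "finite U" "\<forall>u\<in>U. real u \<le> real K ^ 15" "cf s * thickness K \<le> real (card U)"
        "\<forall>u\<in>U. representable 10 5 (M * u + s)" using cX(2)[OF s] by blast
      have "c * thickness K \<le> cf s * thickness K"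
        using cle[OF s] by (intro mult_right_mono) auto
      then show ?thesis using U by (intro exI[of _ U]) auto
    qed
    obtain U where U: "finite U" "\<And>u. u \<in> U \<Longrightarrow> real u \<le> real K ^ 15" "c * thickness K \<le> real (card U)"
        "\<And>u. u \<in> U \<Longrightarrow> representable 10 5 (M * u + s)" using get[OF s] by blast
    obtain U' where U': "finite U'" "\<And>u. u \<in> U' \<Longrightarrow> real u \<le> real K ^ 15" "c * thickness K \<le> real (card U')"
        "\<And>u. u \<in> U' \<Longrightarrow> representable 10 5 (M * u + 10)" using get[of 10] M by auto
    have sub: "U \<subseteq> {..K ^ 15}" "U' \<subseteq> {..K ^ 15}"
      using U(2) U'(2) by (auto simp flip: of_nat_power)
    have eq: "2 ^ 37 * \<eta> / 625 = 78 ^ 36 / 14641 ^ 37 / 2" unfolding \<kappa>_def[symmetric] by (simp add: \<eta>_def)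
    have le: "real u \<le> real K ^ 15" if "u \<in> U \<union> U'" for u using that U(2) U'(2) by blast
    obtain i :: "nat \<Rightarrow> nat" and u u' where sol: "u \<in> U" "u' \<in> U'" "t = (\<Sum>k<37. quintic_seq Y (K ^ 3) (i k)) + (u + u')"
      using exists_solution[OF Y K(3) c C diff[OF K(3) U(1) U'(1) sub] eq K0[OF K(1), unfolded \<kappa>_def] U(1) U'(1) U(3) U'(3) le t]
      by blast
    have r1: "representable 37 5 (\<Sum>k<37. (5 * Y * (K ^ 3 + i k) + 1) ^ 5)"
      unfolding representable_lessThan by (intro exI[of _ "\<lambda>k. 5 * Y * (K ^ 3 + i k) + 1"]) auto
    have "representable (37 + (10 + 10)) 5 ((\<Sum>k<37. (5 * Y * (K ^ 3 + i k) + 1) ^ 5) + ((M * u + s) + (M * u' + 10)))"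
      by (intro representable_add r1 U(4)[OF sol(1)] U'(4)[OF sol(2)])
    moreover have "(\<Sum>k<37. (5 * Y * (K ^ 3 + i k) + 1) ^ 5) + ((M * u + s) + (M * u' + 10)) = n"
    proof -
      have "(\<Sum>k<37. (5 * Y * (K ^ 3 + i k) + 1) ^ 5) = M * (\<Sum>k<37. quintic_seq Y (K ^ 3) (i k)) + 37"
        unfolding fifth_power_quintic_seq M_def sum.distrib sum_distrib_left by simp
      then show ?thesis unfolding n_eq sol(3) by (simp add: distrib_left)
    qed
    ultimately show ?thesis by simp
  qed
  then show ?thesis by blast
qed

section \<open>From 57 summands to \<open>j\<close> summands, and the exceptional small
  differences\<close>

lemma representable_pad:
  assumes "representable r k m" "r \<le> j"
  shows "representable j k (m + (j - r))"
  using representable_add[OF assms(1) representable_ones[of "j - r" k]] assms(2) by simp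

theorem theorem5p3:
  "\<exists>N::nat. \<forall>j\<ge>57. \<forall>n\<ge>N. n > j - 1 \<and> n - j \<notin> stable_nonrep 5 \<longrightarrow> representable j 5 n"
proof -
  obtain n0 where n0: "\<And>n. n \<ge> n0 \<Longrightarrow> representable 57 5 n" using representable_57_eventually by blast
  \<comment> \<open>The threshold \<open>2 * n0\<close> serves the case of small
    \<open>m = n - j\<close>: if \<open>m < n0\<close>, then
    \<open>j = n - m > n0 > m\<close>.\<close>
  have "representable j 5 n" if j: "j \<ge> 57" and n: "n \<ge> 2 * n0" and nj: "n > j - 1" and notin: "n - j \<notin> stable_nonrep 5" for j n
  proof -
    define m where "m = n - j"
    have n_eq: "n = m + j" using nj by (simp add: m_def)
    show ?thesis
    proof (cases "m + 57 \<ge> n0")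
      case True
      have "representable j 5 (m + 57 + (j - 57))" by (rule representable_pad[OF n0[OF True] j])
      then show ?thesis using j n_eq by simp
    next
      case False
      \<comment> \<open>The sets \<open>shifted_nonrep r 5\<close> contain positive numbers only, so
        for \<open>m = 0\<close> the hypothesis carries no information; the empty sum with
        \<open>r = 0\<close> serves there.\<close>
      obtain x r where x: "\<And>i. i \<in> {1..r} \<Longrightarrow> x i > (0 :: nat)" "m + r = (\<Sum>i=1..r. x i ^ 5)"
      proof (cases "m = 0")
        case True
        then show ?thesis by (intro that[where x = "\<lambda>_. 1" and r = 0]) auto
      next
        case m: False
        obtain r where r: "m \<notin> shifted_nonrep r 5"
          using notin unfolding m_def[symmetric] stable_nonrep_def by blast
        have "m + r \<notin> nonrep r 5"
        proof
          assume "m + r \<in> nonrep r 5"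
          then have "m + r - r \<in> shifted_nonrep r 5"
            unfolding shifted_nonrep_def mem_Collect_eq using m by (intro exI[of _ "m + r"] conjI) simp_all
          then show False using r by simp
        qed
        then have "representable r 5 (m + r)" using m by (simp add: nonrep_def)
        then obtain x where "\<forall>i\<in>{1..r}. x i > 0" "m + r = (\<Sum>i=1..r. x i ^ 5)"
          unfolding representable_def by blast
        then show ?thesis by (intro that[where x = x and r = r]) auto
      qed
      \<comment> \<open>Dropping the ones lowers the sum and the number of summands equally, so the
        excess \<open>m\<close> of the sum over that number is kept.\<close>
      define J where "J = {i\<in>{1..r}. x i \<noteq> 1}"
      have J: "finite J" "J \<subseteq> {1..r}" by (auto simp: J_def)
      have "(\<Sum>i=1..r. x i ^ 5) = (\<Sum>i\<in>J. x i ^ 5) + (\<Sum>i\<in>{1..r} - J. x i ^ 5)"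
        using J by (subst sum.subset_diff[of J]) auto
      also have "(\<Sum>i\<in>{1..r} - J. x i ^ 5) = (\<Sum>i\<in>{1..r} - J. 1)" by (intro sum.cong refl) (auto simp: J_def)
      also have "\<dots> = r - card J" using J by (simp add: card_Diff_subset)
      finally have "m + r = (\<Sum>i\<in>J. x i ^ 5) + (r - card J)" using x(2) by simp
      moreover have cJr: "card J \<le> r" using card_mono[of "{1..r}" J] J by simp
      ultimately have mJ: "(\<Sum>i\<in>J. x i ^ 5) = m + card J" by linarith
      \<comment> \<open>Each remaining summand is at least 2, so
        \<open>2 * card J \<le> m + card J\<close>; this bounds the number of summands without any
        control of \<open>r\<close>.\<close>
      have "(\<Sum>i\<in>J. 2) \<le> (\<Sum>i\<in>J. x i ^ 5)"
      proof (rule sum_mono)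
        fix i assume i: "i \<in> J"
        have "x i > 0" using x(1)[of i] i J by blast
        moreover have "x i \<noteq> 1" using i by (simp add: J_def)
        ultimately have "2 \<le> x i" by linarith
        also have "x i \<le> x i ^ 5" using \<open>x i > 0\<close> by (simp add: self_le_power)
        finally show "2 \<le> x i ^ 5" .
      qed
      then have cJ: "card J \<le> m" using mJ by simp
      have "representable (card J) 5 (m + card J)"
        using representable_finite_sum[OF J(1), of x 5] x(1) J(2) mJ by (metis subsetD)
      moreover have "card J \<le> j" using cJ False n n_eq by linarith
      ultimately have "representable j 5 (m + card J + (j - card J))" by (rule representable_pad)
      then show ?thesis using \<open>card J \<le> j\<close> n_eq by simp
    qed
  qed
  then show ?thesis by blast
qed

end
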